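(* Fix integers $\ell\ge 2$, $t\ge 4$ and $3\le r\le 2\ell-1$. For all sufficiently large $n$, $$\max\{\mathcal N(P_t,G): |V(G)|=n,\ G \text{ is } C_{2\ell+1}\text{-free},\ \chi(G)\ge r\}=\mathcal N(P_t,S)$$ for every $S\in\mathcal S_{t,r}(n)$. Moreover, the extremal graphs (those attaining this maximum) are precisely the members of $\mathcal S_{t,r}(n)$.
   Context: Graphs are finite and simple, and membership in graph families is up to isomorphism. $\chi(G)$ is the chromatic number. $P_t$ is the path with $t$ vertices and $C_t$ the cycle with $t$ vertices. $G$ is $F$-free if it contains no (not necessarily induced) subgraph isomorphic to $F$. $\mathcal N(F,G)$ is the number of unlabeled copies of $F$ in $G$, i.e. the number of subgraphs of $G$ isomorphic to $F$. $T_{m,2}$ is the complete bipartite graph with parts of sizes $\lfloor m/2\rfloor$ and $\lceil m/2\rceil$. Suspending a graph $H$ on a graph $B$ at a vertex $x\in V(B)$ means taking the disjoint union of $B$ and $H$, identifying $x$ with one vertex of $H$, and adding no further edges. $\mathcal T^*(r,n)$ is the family of graphs obtained from $T_{n-r+1,2}$ by suspending a clique $K_r$ (at any vertex). $\mathcal S_{t,r}(n)$ is the subfamily of $\mathcal T^*(r,n)$ consisting of those graphs in $\mathcal T^*(r,n)$ with the maximum number of copies of $P_t$. *)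

theory Defs
  imports Main
begin

datatype 'a graph = Graph (verts: "'a set") (edges: "'a set set")

definition simple_graph :: "'a graph \<Rightarrow> bool" where
  "simple_graph G \<longleftrightarrow> finite (verts G) \<and> (\<forall>e\<in>edges G. e \<subseteq> verts G \<and> card e = 2)"

definition isomorphic :: "'a graph \<Rightarrow> 'b graph \<Rightarrow> bool" where
  "isomorphic G H \<longleftrightarrow> (\<exists>f. bij_betw f (verts G) (verts H) \<and>
     (\<forall>u\<in>verts G. \<forall>v\<in>verts G. {u, v} \<in> edges G \<longleftrightarrow> {f u, f v} \<in> edges H))"

definition subgraph :: "'a graph \<Rightarrow> 'a graph \<Rightarrow> bool" where
  "subgraph H G \<longleftrightarrow> simple_graph H \<and> verts H \<subseteq> verts G \<and> edges H \<subseteq> edges G"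

text \<open>Unlabelled, not necessarily induced copies: each copy is counted once, as a subgraph.\<close>

definition num_copies :: "'b graph \<Rightarrow> 'a graph \<Rightarrow> nat" where
  "num_copies F G = card {H. subgraph H G \<and> isomorphic H F}"

definition free_of :: "'b graph \<Rightarrow> 'a graph \<Rightarrow> bool" where
  "free_of F G \<longleftrightarrow> \<not> (\<exists>H. subgraph H G \<and> isomorphic H F)"

definition proper_colouring :: "'a graph \<Rightarrow> nat \<Rightarrow> ('a \<Rightarrow> nat) \<Rightarrow> bool" where
  "proper_colouring G k c \<longleftrightarrow>
     (\<forall>v\<in>verts G. c v < k) \<and> (\<forall>u v. {u, v} \<in> edges G \<longrightarrow> c u \<noteq> c v)"

definition chromatic_number :: "'a graph \<Rightarrow> nat" where
  "chromatic_number G = (LEAST k. \<exists>c. proper_colouring G k c)"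

definition path_graph :: "nat \<Rightarrow> nat graph" where
  "path_graph t = Graph {..<t} {{i, Suc i} | i. Suc i < t}"

text \<open>The cycle \<open>C\<^sub>t\<close>; meaningful for \<open>t \<ge> 3\<close>.\<close>

definition cycle_graph :: "nat \<Rightarrow> nat graph" where
  "cycle_graph t = Graph {..<t} {{i, Suc i mod t} | i. i < t}"

definition complete_graph :: "nat \<Rightarrow> nat graph" where
  "complete_graph r = Graph {..<r} {{i, j} | i j. i < r \<and> j < r \<and> i \<noteq> j}"

text \<open>The graph \<open>T\<^bsub>m,2\<^esub>\<close>: the parts are \<open>{..<m div 2}\<close> and \<open>{m div 2..<m}\<close>, so the second
  one has \<open>\<lceil>m/2\<rceil>\<close> vertices.\<close>

definition turan_bipartite :: "nat \<Rightarrow> nat graph" where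
  "turan_bipartite m =
     Graph {..<m} {{i, j} | i j. i < m div 2 \<and> m div 2 \<le> j \<and> j < m}"

text \<open>\<open>suspend H y B x\<close> is the disjoint union of \<open>B\<close> (left summand) and \<open>H\<close> (right summand)
  in which the vertex \<open>y\<close> of \<open>H\<close> has been identified with the vertex \<open>x\<close> of \<open>B\<close>; the merged
  vertex is represented by \<open>Inl x\<close>.\<close>

definition suspend :: "'h graph \<Rightarrow> 'h \<Rightarrow> 'b graph \<Rightarrow> 'b \<Rightarrow> ('b + 'h) graph" where
  "suspend H y B x =
     (let g = (\<lambda>v. if v = y then Inl x else Inr v) in
      Graph (Inl ` verts B \<union> g ` verts H)
            ((\<lambda>e. Inl ` e) ` edges B \<union> (\<lambda>e. g ` e) ` edges H))"

text \<open>Families of graphs are closed under isomorphism. Their members, like all host graphs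
  considered here, have natural numbers as vertices; every finite graph is isomorphic to such
  a graph.\<close>

definition T_star :: "nat \<Rightarrow> nat \<Rightarrow> nat graph set" where
  "T_star r n = {G. simple_graph G \<and>
     (\<exists>x\<in>verts (turan_bipartite (n - r + 1)). \<exists>y\<in>verts (complete_graph r).
        isomorphic G (suspend (complete_graph r) y (turan_bipartite (n - r + 1)) x))}"

definition S_family :: "nat \<Rightarrow> nat \<Rightarrow> nat \<Rightarrow> nat graph set" where
  "S_family t r n = {G \<in> T_star r n.
     \<forall>G'\<in>T_star r n. num_copies (path_graph t) G' \<le> num_copies (path_graph t) G}"

definition admissible :: "nat \<Rightarrow> nat \<Rightarrow> nat \<Rightarrow> nat graph set" where
  "admissible l r n = {G. simple_graph G \<and> card (verts G) = n \<and>
     free_of (cycle_graph (2 * l + 1)) G \<and> r \<le> chromatic_number G}"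

end

theory Submission
  imports Defs Complex_Main
begin

text \<open>
  Let \<open>G\<close> be an admissible graph on \<open>n\<close> vertices. A path is treated as the list of its vertices
  (\<open>paths\<close>); every copy of the path on \<open>t\<close> vertices comes from the same positive number of lists
  (\<open>card_paths_eq_copies\<close>), so it suffices to compare numbers of lists. By definition the members of
  \<open>S_family\<close> are the best members of \<open>T_star\<close>, and these are admissible (\<open>T_star_admissible\<close>). The
  theorem therefore follows once every admissible graph outside \<open>T_star\<close> has strictly fewer paths
  than some member of \<open>T_star\<close> (\<open>admissible_le_T_star\<close>). Only graphs with at least as many paths as the
  balanced complete bipartite graph on \<open>n - r + 1\<close> vertices have to be considered.

  \<^bold>\<open>Density.\<close> A neighbourhood contains no path on \<open>2 * l\<close> vertices, hence spans only linearly many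
  edges. So the degrees of the neighbours of a vertex add up to at most \<open>e + O(n)\<close>, where \<open>e\<close> is the
  number of edges (\<open>two_step_sum\<close>). Extending a path by two vertices thus multiplies the number of
  paths by at most \<open>e + O(n)\<close>, and having many paths forces \<open>e\<close> to be close to \<open>n\<^sup>2 / 4\<close>
  (\<open>degsum_large\<close>). The same inequality bounds the variance of the degrees, so almost all degrees are
  close to \<open>n / 2\<close>, and the neighbourhoods of two adjacent typical vertices yield an almost complete
  bipartite subgraph, the kernel (\<open>kernel_exists\<close>).

  \<^bold>\<open>Structure.\<close> Inside the kernel, any two vertices are joined by paths of every prescribed small
  length of the right parity, except possibly length one. Let \<open>X\<close> and \<open>Y\<close> be the sets of vertices
  with many neighbours in one or the other part of the kernel, and \<open>Z\<close> the set of the remaining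
  vertices, which have small degree. Since the graph has no cycle of length \<open>2 * l + 1\<close>, the sets
  \<open>X\<close> and \<open>Y\<close> are independent and no vertex has neighbours in both. Every vertex of \<open>Z\<close> costs a
  constant times \<open>n ^ (t - 1)\<close> paths, which gives \<open>card Z < r\<close> (\<open>few_outside\<close>). Greedy colouring with
  \<open>r - 1\<close> colours must fail, which gives \<open>card Z = r - 1\<close>, and then that \<open>Z\<close> is a clique attached to
  one side only. Counting paths again, all vertices of \<open>X \<union> Y\<close> have large degree
  (\<open>core_degree_X\<close>); then two different attachment vertices would create a cycle of length
  \<open>2 * l + 1\<close>. Hence \<open>G\<close> is a subgraph of a clique on \<open>r\<close> vertices suspended on the complete
  bipartite graph with parts \<open>X\<close> and \<open>Y\<close> (\<open>near_extremal_structure\<close>).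

  \<^bold>\<open>Optimization.\<close> Each missing edge costs a path (\<open>suspended_strict_subgraph\<close>). If the sizes of \<open>X\<close>
  and \<open>Y\<close> differ by at least two, moving a vertex to the smaller part gains a number of paths of
  order \<open>n ^ (t - 2)\<close> inside the bipartite part. The paths that can get lost meet both the clique and
  the moved vertex, hence also the attachment vertex, so their number is \<open>O(n ^ (t - 3))\<close>
  (\<open>suspended_balance\<close>).
\<close>

section \<open>Counting paths as lists of vertices\<close>

text \<open>A path subgraph with at least two vertices appears as two lists, one for each direction.\<close>

definition paths :: "'a set \<Rightarrow> ('a \<Rightarrow> 'a \<Rightarrow> bool) \<Rightarrow> nat \<Rightarrow> 'a list set" where
  "paths V E k = {xs. length xs = k \<and> distinct xs \<and> set xs \<subseteq> V \<and> successively E xs}"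

lemma finite_paths: "finite V \<Longrightarrow> finite (paths V E k)"
  by (rule finite_subset[OF _ finite_lists_length_eq[of V k]]) (auto simp: paths_def)

lemma paths_mono:
  assumes "V \<subseteq> W" "\<And>u v. u \<in> V \<Longrightarrow> v \<in> V \<Longrightarrow> E u v \<Longrightarrow> E' u v"
  shows "paths V E k \<subseteq> paths W E' k"
  using assms by (auto simp: paths_def elim!: successively_mono)

lemma card_paths_le: "finite V \<Longrightarrow> card (paths V E k) \<le> card V ^ k"
  by (subst card_lists_length_eq[symmetric, of V k], assumption, rule card_mono)
     (auto simp: paths_def finite_lists_length_eq)

lemma card_lists_nth:
  assumes "\<And>i. i < k \<Longrightarrow> finite (S i)"
  shows "finite {xs. length xs = k \<and> (\<forall>i<k. xs ! i \<in> S i)} \<and>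
         card {xs. length xs = k \<and> (\<forall>i<k. xs ! i \<in> S i)} = (\<Prod>i<k. card (S i))"
  using assms
proof (induction k)
  case 0
  have "{xs. length xs = 0 \<and> (\<forall>i<0. xs ! i \<in> S i)} = {[]}" by auto
  then show ?case by simp
next
  case (Suc k)
  let ?L = "\<lambda>k. {xs. length xs = k \<and> (\<forall>i<k. xs ! i \<in> S i)}"
  have eq: "?L (Suc k) = (\<lambda>(ys, y). ys @ [y]) ` (?L k \<times> S k)"
  proof (intro equalityI subsetI)
    fix xs assume xs: "xs \<in> ?L (Suc k)"
    then obtain ys y where y: "xs = ys @ [y]" by (cases xs rule: rev_cases) auto
    have "ys ! i \<in> S i" if "i < k" for i
    proof -
      have "xs ! i \<in> S i" using xs that by simp
      then show ?thesis using xs y that by (simp add: nth_append)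
    qed
    moreover have "y \<in> S k"
    proof -
      have "xs ! k \<in> S k" using xs by simp
      then show ?thesis using xs y by (simp add: nth_append)
    qed
    ultimately have "ys \<in> ?L k" "y \<in> S k" using xs y by auto
    with y show "xs \<in> (\<lambda>(ys, y). ys @ [y]) ` (?L k \<times> S k)" by auto
  next
    fix xs assume "xs \<in> (\<lambda>(ys, y). ys @ [y]) ` (?L k \<times> S k)"
    then show "xs \<in> ?L (Suc k)" by (auto simp: nth_append less_Suc_eq)
  qed
  have inj: "inj_on (\<lambda>(ys, y). ys @ [y]) (?L k \<times> S k)" by (auto simp: inj_on_def)
  have IH: "finite (?L k) \<and> card (?L k) = (\<Prod>i<k. card (S i))"
    using Suc.prems by (intro Suc.IH) simp
  have "finite (S k)" using Suc.prems by simp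
  with IH show ?case unfolding eq using card_image[OF inj] by (simp add: card_cartesian_product)
qed

text \<open>The crude bound behind all error terms: prescribing a vertex at some position saves a factor
  \<open>card V\<close>.\<close>

lemma card_lists_prescribed:
  assumes "finite V" "I \<subseteq> {..<k}" "\<And>i. i \<in> I \<Longrightarrow> finite (S i)"
  shows "finite {xs. length xs = k \<and> set xs \<subseteq> V \<and> (\<forall>i\<in>I. xs ! i \<in> S i)} \<and>
    card {xs. length xs = k \<and> set xs \<subseteq> V \<and> (\<forall>i\<in>I. xs ! i \<in> S i)}
    \<le> (\<Prod>i\<in>I. card (S i)) * card V ^ (k - card I)"
proof -
  let ?S = "\<lambda>i. if i \<in> I then S i else V"
  let ?L = "{xs. length xs = k \<and> set xs \<subseteq> V \<and> (\<forall>i\<in>I. xs ! i \<in> S i)}"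
  let ?M = "{xs. length xs = k \<and> (\<forall>i<k. xs ! i \<in> ?S i)}"
  have M: "finite ?M \<and> card ?M = (\<Prod>i<k. card (?S i))"
    using assms by (intro card_lists_nth) auto
  have sub: "?L \<subseteq> ?M" by (auto simp: set_conv_nth)
  have [simp]: "finite I" using assms(2) finite_subset by blast
  have "(\<Prod>i<k. card (?S i)) = (\<Prod>i<k. if i \<in> I then card (S i) else card V)"
    by (intro prod.cong) auto
  also have "\<dots> = (\<Prod>i\<in>I. card (S i)) * card V ^ card ({..<k} - I)"
    using assms(2) by (simp add: prod.If_cases Int_absorb1 Diff_eq)
  also have "card ({..<k} - I) = k - card I"
    using assms(2) by (simp add: card_Diff_subset)
  finally have "card ?M = (\<Prod>i\<in>I. card (S i)) * card V ^ (k - card I)" using M by simp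
  moreover have "card ?L \<le> card ?M" using M sub by (intro card_mono) auto
  moreover have "finite ?L" using M sub by (auto intro: finite_subset)
  ultimately show ?thesis by simp
qed

text \<open>Apart from the vertex \<open>z\<close> of \<open>Z\<close>, which occupies one of \<open>k\<close> positions, the entry next to it has
  only \<open>d\<close> possible values.\<close>

lemma card_paths_touching_low_degree:
  assumes V: "finite V" "Z \<subseteq> V" and k: "2 \<le> k"
    and d: "\<And>z. z \<in> Z \<Longrightarrow> card {u \<in> V. E z u} \<le> d"
    and sym: "\<And>u v. E u v \<Longrightarrow> E v u"
  shows "card {xs \<in> paths V E k. set xs \<inter> Z \<noteq> {}} \<le> card Z * k * d * card V ^ (k - 2)"
proof -
  \<comment> \<open>A position next to \<open>i\<close>; at the end of the list it has to be the preceding one.\<close>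
  define nx where "nx i = (if Suc i < k then Suc i else i - 1)" for i
  define L where "L z i = {xs. length xs = k \<and> set xs \<subseteq> V \<and>
     (\<forall>j\<in>{i, nx i}. xs ! j \<in> (if j = i then {z} else {u \<in> V. E z u}))}" for z i
  have nx: "nx i < k" "nx i \<noteq> i" if "i < k" for i
    using that k by (auto simp: nx_def)
  have finZ: "finite Z" using V finite_subset by blast
  have L: "finite (L z i) \<and> card (L z i) \<le> d * card V ^ (k - 2)" if "z \<in> Z" "i < k" for z i
  proof -
    have "finite (L z i) \<and> card (L z i) \<le>
       (\<Prod>j\<in>{i, nx i}. card (if j = i then {z} else {u \<in> V. E z u})) * card V ^ (k - card {i, nx i})"
      unfolding L_def using V nx[OF that(2)] that by (intro card_lists_prescribed) auto
    moreover have "(\<Prod>j\<in>{i, nx i}. card (if j = i then {z} else {u \<in> V. E z u})) = card {u \<in> V. E z u}"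
      using nx(2)[OF that(2)] by auto
    moreover have "card {i, nx i} = 2" using nx(2)[OF that(2)] by auto
    moreover have "card {u \<in> V. E z u} * card V ^ (k - 2) \<le> d * card V ^ (k - 2)"
      using d[OF that(1)] by simp
    ultimately show ?thesis by (metis order_trans)
  qed
  have "{xs \<in> paths V E k. set xs \<inter> Z \<noteq> {}} \<subseteq> (\<Union>z\<in>Z. \<Union>i<k. L z i)"
  proof
    fix xs assume xs: "xs \<in> {xs \<in> paths V E k. set xs \<inter> Z \<noteq> {}}"
    then have len: "length xs = k" and sub: "set xs \<subseteq> V" and suc: "successively E xs"
      by (auto simp: paths_def)
    from xs obtain z where z: "z \<in> Z" "z \<in> set xs" by auto
    then obtain i where i: "i < k" "xs ! i = z" by (metis in_set_conv_nth len)
    have "E z (xs ! nx i)"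
    proof (cases "Suc i < k")
      case True
      then show ?thesis using suc i len unfolding nx_def by (auto simp: successively_conv_nth)
    next
      case False
      then have "Suc (i - 1) = i" using k i by auto
      then have "E (xs ! (i - 1)) (xs ! i)" using suc i len unfolding successively_conv_nth by metis
      then show ?thesis using sym False i by (auto simp: nx_def)
    qed
    moreover have "xs ! nx i \<in> V" using sub nx(1)[OF i(1)] len nth_mem by blast
    ultimately have "xs \<in> L z i" using len sub i by (auto simp: L_def)
    then show "xs \<in> (\<Union>z\<in>Z. \<Union>i<k. L z i)" using z i by auto
  qed
  then have "card {xs \<in> paths V E k. set xs \<inter> Z \<noteq> {}} \<le> card (\<Union>z\<in>Z. \<Union>i<k. L z i)"
    using L finZ by (intro card_mono) auto
  also have "\<dots> \<le> (\<Sum>z\<in>Z. \<Sum>i<k. card (L z i))"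
    by (intro order_trans[OF card_UN_le] sum_mono) (auto simp: finZ intro: card_UN_le)
  also have "\<dots> \<le> (\<Sum>z\<in>Z. \<Sum>i<k. d * card V ^ (k - 2))"
    using L by (intro sum_mono) auto
  finally show ?thesis by (simp add: mult.assoc)
qed

lemma card_paths_through_three:
  assumes V: "finite V" "Z \<subseteq> V" and "x \<noteq> u" "x \<notin> Z" "u \<notin> Z"
  shows "card {xs \<in> paths V E k. set xs \<inter> Z \<noteq> {} \<and> x \<in> set xs \<and> u \<in> set xs}
    \<le> card Z * k ^ 3 * card V ^ (k - 3)"
proof -
  define L where "L z i j h = {xs. length xs = k \<and> set xs \<subseteq> V \<and>
     (\<forall>m\<in>{i, j, h}. xs ! m \<in> {if m = i then z else if m = j then x else u})}" for z i j h
  define T where "T = {(i, j, h). i < k \<and> j < k \<and> h < k \<and> i \<noteq> j \<and> i \<noteq> h \<and> j \<noteq> h}"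
  have finZ: "finite Z" using V finite_subset by blast
  have Tsub: "T \<subseteq> {..<k} \<times> {..<k} \<times> {..<k}" by (auto simp: T_def)
  then have finT: "finite T" using finite_subset by blast
  have cT: "card T \<le> k ^ 3"
    using card_mono[OF _ Tsub] by (simp add: card_cartesian_product power3_eq_cube)
  have L: "finite (L z i j h) \<and> card (L z i j h) \<le> card V ^ (k - 3)" if "(i, j, h) \<in> T" for z i j h
  proof -
    have "finite (L z i j h) \<and> card (L z i j h) \<le>
       (\<Prod>m\<in>{i, j, h}. card {if m = i then z else if m = j then x else u}) * card V ^ (k - card {i, j, h})"
      unfolding L_def using V that by (intro card_lists_prescribed) (auto simp: T_def)
    moreover have "card {i, j, h} = 3" using that by (auto simp: T_def)
    ultimately show ?thesis by simp
  qed
  have "{xs \<in> paths V E k. set xs \<inter> Z \<noteq> {} \<and> x \<in> set xs \<and> u \<in> set xs}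
      \<subseteq> (\<Union>z\<in>Z. \<Union>(i, j, h)\<in>T. L z i j h)"
  proof
    fix xs assume xs: "xs \<in> {xs \<in> paths V E k. set xs \<inter> Z \<noteq> {} \<and> x \<in> set xs \<and> u \<in> set xs}"
    then have len: "length xs = k" and sub: "set xs \<subseteq> V" by (auto simp: paths_def)
    from xs obtain z where z: "z \<in> Z" "z \<in> set xs" by auto
    obtain i where i: "i < k" "xs ! i = z" using z(2) by (metis in_set_conv_nth len)
    from xs have xu: "x \<in> set xs" "u \<in> set xs" by auto
    obtain j where j: "j < k" "xs ! j = x" using xu(1) by (metis in_set_conv_nth len)
    obtain h where h: "h < k" "xs ! h = u" using xu(2) by (metis in_set_conv_nth len)
    have "z \<noteq> x" "z \<noteq> u" using z(1) assms(4,5) by blast+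
    then have ne: "i \<noteq> j" "i \<noteq> h" "j \<noteq> h"
      using i(2) j(2) h(2) \<open>x \<noteq> u\<close> by blast+
    then have "(i, j, h) \<in> T" using i j h by (simp add: T_def)
    moreover have "xs \<in> L z i j h" using i j h ne len sub by (simp add: L_def)
    ultimately show "xs \<in> (\<Union>z\<in>Z. \<Union>(i, j, h)\<in>T. L z i j h)" using z by blast
  qed
  then have "card {xs \<in> paths V E k. set xs \<inter> Z \<noteq> {} \<and> x \<in> set xs \<and> u \<in> set xs}
      \<le> card (\<Union>z\<in>Z. \<Union>(i, j, h)\<in>T. L z i j h)"
    using L finZ finT by (intro card_mono) auto
  also have "\<dots> \<le> (\<Sum>z\<in>Z. \<Sum>p\<in>T. card ((\<lambda>(i, j, h). L z i j h) p))"
    by (intro order_trans[OF card_UN_le] sum_mono) (auto simp: finZ finT intro: card_UN_le)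
  also have "\<dots> \<le> (\<Sum>z\<in>Z. \<Sum>p\<in>T. card V ^ (k - 3))"
    using L by (intro sum_mono) auto
  also have "\<dots> \<le> card Z * k ^ 3 * card V ^ (k - 3)"
    using mult_le_mono1[OF mult_le_mono2[OF cT, of "card Z"], of "card V ^ (k - 3)"]
    by (simp add: mult.assoc)
  finally show ?thesis .
qed

section \<open>Paths in complete bipartite graphs\<close>

definition bip :: "'a set \<Rightarrow> 'a set \<Rightarrow> 'a \<Rightarrow> 'a \<Rightarrow> bool" where
  "bip X Y u v \<longleftrightarrow> u \<in> X \<and> v \<in> Y \<or> u \<in> Y \<and> v \<in> X"

text \<open>\<open>alt_count k a b\<close> is the number of paths on \<open>k\<close> vertices in a complete bipartite graph that start
  in the part of size \<open>a\<close>; after the first vertex the two parts exchange their roles.\<close>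

primrec alt_count :: "nat \<Rightarrow> nat \<Rightarrow> nat \<Rightarrow> nat" where
  "alt_count 0 a b = 1"
| "alt_count (Suc k) a b = a * alt_count k b (a - 1)"

definition bip_count :: "nat \<Rightarrow> nat \<Rightarrow> nat \<Rightarrow> nat" where
  "bip_count t a b = alt_count t a b + alt_count t b a"

definition alt_paths :: "'a set \<Rightarrow> 'a set \<Rightarrow> nat \<Rightarrow> 'a list set" where
  "alt_paths X Y k = {xs \<in> paths (X \<union> Y) (bip X Y) k. xs \<noteq> [] \<longrightarrow> hd xs \<in> X}"

lemma bip_commute: "bip X Y = bip Y X"
  by (auto simp: bip_def fun_eq_iff)

lemma alt_paths_Suc:
  assumes "X \<inter> Y = {}"
  shows "alt_paths X Y (Suc k) = (\<Union>x\<in>X. (#) x ` alt_paths Y (X - {x}) k)"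
proof (intro equalityI subsetI)
  fix xs assume "xs \<in> alt_paths X Y (Suc k)"
  then obtain x ys where x: "xs = x # ys" and ys: "length ys = k" "x \<in> X" "x \<notin> set ys" "distinct ys"
    "set ys \<subseteq> X \<union> Y" "successively (bip X Y) (x # ys)"
    by (cases xs) (auto simp: alt_paths_def paths_def)
  have "ys \<noteq> [] \<Longrightarrow> hd ys \<in> Y"
    using ys assms by (auto simp: successively_Cons bip_def)
  moreover have "successively (bip Y (X - {x})) ys"
    by (rule successively_mono[of "bip X Y"]) (use ys in \<open>auto simp: successively_Cons bip_def\<close>)
  ultimately have "ys \<in> alt_paths Y (X - {x}) k" using ys by (auto simp: alt_paths_def paths_def)
  then show "xs \<in> (\<Union>x\<in>X. (#) x ` alt_paths Y (X - {x}) k)" using x ys by auto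
next
  fix xs assume "xs \<in> (\<Union>x\<in>X. (#) x ` alt_paths Y (X - {x}) k)"
  then obtain x ys where x: "xs = x # ys" "x \<in> X" and ys: "ys \<in> alt_paths Y (X - {x}) k" by auto
  have "successively (bip X Y) ys"
    by (rule successively_mono[of "bip Y (X - {x})"])
       (use ys in \<open>auto simp: alt_paths_def paths_def bip_def\<close>)
  then show "xs \<in> alt_paths X Y (Suc k)"
    using x ys assms by (fastforce simp: alt_paths_def paths_def bip_def successively_Cons)
qed

lemma finite_alt_paths: "finite X \<Longrightarrow> finite Y \<Longrightarrow> finite (alt_paths X Y k)"
  using finite_paths[of "X \<union> Y" "bip X Y" k] by (simp add: alt_paths_def)

lemma card_alt_paths:
  assumes "finite X" "finite Y" "X \<inter> Y = {}"
  shows "card (alt_paths X Y k) = alt_count k (card X) (card Y)"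
  using assms
proof (induction k arbitrary: X Y)
  case 0
  have "alt_paths X Y 0 = {[]}" by (auto simp: alt_paths_def paths_def)
  then show ?case by simp
next
  case (Suc k)
  have "card (alt_paths X Y (Suc k)) = (\<Sum>x\<in>X. card ((#) x ` alt_paths Y (X - {x}) k))"
    unfolding alt_paths_Suc[OF Suc.prems(3)] using Suc.prems
    by (intro card_UN_disjoint) (auto simp: finite_alt_paths)
  also have "\<dots> = (\<Sum>x\<in>X. alt_count k (card Y) (card X - 1))"
  proof (intro sum.cong refl)
    fix x assume x: "x \<in> X"
    have "card ((#) x ` alt_paths Y (X - {x}) k) = card (alt_paths Y (X - {x}) k)"
      by (intro card_image) auto
    also have "\<dots> = alt_count k (card Y) (card (X - {x}))"
      using Suc.prems by (intro Suc.IH) auto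
    finally show "card ((#) x ` alt_paths Y (X - {x}) k) = alt_count k (card Y) (card X - 1)"
      using x Suc.prems by simp
  qed
  finally show ?case by simp
qed

lemma card_paths_bip:
  assumes "finite X" "finite Y" "X \<inter> Y = {}" "0 < k"
  shows "card (paths (X \<union> Y) (bip X Y) k) = bip_count k (card X) (card Y)"
proof -
  have "paths (X \<union> Y) (bip X Y) k = alt_paths X Y k \<union> alt_paths Y X k"
    using assms(4) hd_in_set by (fastforce simp: alt_paths_def paths_def bip_commute[of Y X])
  moreover have "alt_paths X Y k \<inter> alt_paths Y X k = {}"
    using assms by (auto simp: alt_paths_def paths_def)
  ultimately show ?thesis using assms
    by (simp add: card_Un_disjoint finite_alt_paths card_alt_paths bip_count_def Int_commute)
qed

text \<open>A subgraph in which \<open>v\<close> has no neighbour in \<open>W\<close> loses at least these paths.\<close>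

lemma card_paths_bip_first_edge:
  assumes fin: "finite X" "finite Y" and disj: "X \<inter> Y = {}" and v: "v \<in> X" and W: "W \<subseteq> Y"
  shows "card W * alt_count k (card X - 1) (card Y - 1)
    \<le> card {xs \<in> paths (X \<union> Y) (bip X Y) (Suc (Suc k)). hd xs = v \<and> xs ! 1 \<in> W}"
proof -
  let ?L = "{xs \<in> paths (X \<union> Y) (bip X Y) (Suc (Suc k)). hd xs = v \<and> xs ! 1 \<in> W}"
  have "(\<Union>y\<in>W. (\<lambda>zs. v # y # zs) ` alt_paths (X - {v}) (Y - {y}) k) \<subseteq> ?L"
  proof
    fix xs assume "xs \<in> (\<Union>y\<in>W. (\<lambda>zs. v # y # zs) ` alt_paths (X - {v}) (Y - {y}) k)"
    then obtain y zs where y: "y \<in> W" "xs = v # y # zs" and zs: "zs \<in> alt_paths (X - {v}) (Y - {y}) k"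
      by auto
    have "y # zs \<in> alt_paths Y (X - {v}) (Suc k)" using alt_paths_Suc[of Y "X - {v}" k] zs y W disj by auto
    then have "xs \<in> alt_paths X Y (Suc (Suc k))" using alt_paths_Suc[OF disj, of "Suc k"] y v by auto
    then show "xs \<in> ?L" using y by (auto simp: alt_paths_def)
  qed
  then have "card (\<Union>y\<in>W. (\<lambda>zs. v # y # zs) ` alt_paths (X - {v}) (Y - {y}) k) \<le> card ?L"
    using fin finite_paths[of "X \<union> Y"] by (intro card_mono) auto
  moreover have "card (\<Union>y\<in>W. (\<lambda>zs. v # y # zs) ` alt_paths (X - {v}) (Y - {y}) k)
      = (\<Sum>y\<in>W. card ((\<lambda>zs. v # y # zs) ` alt_paths (X - {v}) (Y - {y}) k))"
    using fin W by (intro card_UN_disjoint) (auto simp: finite_alt_paths intro: finite_subset)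
  moreover have "(\<Sum>y\<in>W. card ((\<lambda>zs. v # y # zs) ` alt_paths (X - {v}) (Y - {y}) k))
      = (\<Sum>y\<in>W. alt_count k (card X - 1) (card Y - 1))"
  proof (intro sum.cong refl)
    fix y assume y: "y \<in> W"
    have "card ((\<lambda>zs. v # y # zs) ` alt_paths (X - {v}) (Y - {y}) k) = card (alt_paths (X - {v}) (Y - {y}) k)"
      by (intro card_image) (auto simp: inj_on_def)
    also have "\<dots> = alt_count k (card (X - {v})) (card (Y - {y}))"
      using fin disj by (intro card_alt_paths) auto
    finally show "card ((\<lambda>zs. v # y # zs) ` alt_paths (X - {v}) (Y - {y}) k) = alt_count k (card X - 1) (card Y - 1)"
      using y v W fin by (auto simp: card_Diff_singleton subset_iff)
  qed
  ultimately show ?thesis by simp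
qed

lemma alt_count_mono: "a \<le> a' \<Longrightarrow> b \<le> b' \<Longrightarrow> alt_count k a b \<le> alt_count k a' b'"
proof (induction k arbitrary: a b a' b')
  case (Suc k)
  have "alt_count k b (a - 1) \<le> alt_count k b' (a' - 1)" using Suc.prems by (intro Suc.IH) auto
  then show ?case using Suc.prems by (simp add: mult_le_mono)
qed simp

lemma alt_count_lower: "(min a b - k) ^ k \<le> alt_count k a b"
proof (induction k arbitrary: a b)
  case (Suc k)
  have "(min a b - Suc k) ^ k \<le> (min b (a - 1) - k) ^ k" by (intro power_mono) auto
  also have "\<dots> \<le> alt_count k b (a - 1)" by (rule Suc.IH)
  finally have "(min a b - Suc k) * (min a b - Suc k) ^ k \<le> a * alt_count k b (a - 1)"
    by (intro mult_le_mono) auto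
  then show ?case by simp
qed simp

lemma bip_count_commute: "bip_count t a b = bip_count t b a"
  by (simp add: bip_count_def)

lemma bip_count_lower: "2 * (min a b - t) ^ t \<le> bip_count t a b"
  using alt_count_lower[of a b t] alt_count_lower[of b a t] by (simp add: bip_count_def min.commute)

lemma bip_count_grow: "bip_count (Suc k) a b + alt_count k a b \<le> bip_count (Suc k) a (Suc b)"
proof -
  have "alt_count (Suc k) a b \<le> alt_count (Suc k) a (Suc b)" by (rule alt_count_mono) auto
  moreover have "alt_count (Suc k) b a + alt_count k a b \<le> alt_count (Suc k) (Suc b) a"
  proof -
    have "alt_count k a (b - 1) \<le> alt_count k a b" by (rule alt_count_mono) auto
    then have "b * alt_count k a (b - 1) \<le> b * alt_count k a b" by (rule mult_le_mono2)
    then show ?thesis by simp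
  qed
  ultimately show ?thesis unfolding bip_count_def by linarith
qed

text \<open>Peeling off two vertices at a time gives a product that is symmetric in the two sides.\<close>

definition pair_prod :: "nat \<Rightarrow> nat \<Rightarrow> nat \<Rightarrow> nat" where
  "pair_prod s a b = (\<Prod>i<s. (a - i) * (b - i))"

lemma pair_prod_Suc: "pair_prod (Suc s) a b = a * b * pair_prod s (a - 1) (b - 1)"
  unfolding pair_prod_def prod.lessThan_Suc_shift by simp

lemma alt_count_even: "alt_count (2 * s) a b = pair_prod s a b"
  by (induction s arbitrary: a b) (simp_all add: pair_prod_Suc, simp add: pair_prod_def)

lemma alt_count_odd: "alt_count (2 * s + 1) a b = pair_prod s a b * (a - s)"
proof (induction s arbitrary: a b)
  case (Suc s)
  have "alt_count (2 * Suc s + 1) a b = a * b * alt_count (2 * s + 1) (a - 1) (b - 1)" by simp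
  also have "\<dots> = pair_prod (Suc s) a b * (a - Suc s)" unfolding Suc.IH by (simp add: pair_prod_Suc)
  finally show ?case .
qed (simp add: pair_prod_def)

lemma pair_prod_shift_le:
  assumes "b + 2 \<le> a"
  shows "pair_prod s a b \<le> pair_prod s (a - 1) (b + 1)"
  unfolding pair_prod_def
proof (intro prod_mono conjI)
  fix i assume "i \<in> {..<s}"
  show "(a - i) * (b - i) \<le> (a - 1 - i) * (b + 1 - i)"
  proof (cases "i \<le> b")
    case True
    then obtain p where p: "b = i + p" using le_Suc_ex by blast
    with assms obtain q where "a = i + p + 2 + q" using le_Suc_ex by (metis add.assoc)
    with p show ?thesis by (simp add: algebra_simps)
  qed simp
qed simp

text \<open>With \<open>b + 2 \<le> a\<close>, no factor decreases when the two sizes are moved towards each other, and the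
  first one increases by at least one.\<close>

lemma pair_prod_shift_less:
  assumes "b + 2 \<le> a" "s \<le> b"
  shows "pair_prod (Suc s) a b + (b - s) ^ (2 * s) \<le> pair_prod (Suc s) (a - 1) (b + 1)"
proof -
  have le: "pair_prod s (a - 1) (b - 1) \<le> (\<Prod>i<s. (a - 1 - Suc i) * (b + 1 - Suc i))"
    unfolding pair_prod_def
  proof (intro prod_mono conjI)
    fix i assume "i \<in> {..<s}"
    then have "i < b" using assms by auto
    then obtain p where p: "b = Suc (i + p)" using less_imp_Suc_add by blast
    with assms obtain q where "a = Suc (i + p) + 2 + q" using le_Suc_ex by (metis add.assoc)
    with p show "(a - 1 - i) * (b - 1 - i) \<le> (a - 1 - Suc i) * (b + 1 - Suc i)"
      by (simp add: algebra_simps)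
  qed simp
  have low: "(b - s) ^ (2 * s) \<le> pair_prod s (a - 1) (b - 1)"
  proof -
    have "(b - s) ^ (2 * s) = (\<Prod>i<s. (b - s) * (b - s))" by (simp add: power_mult power2_eq_square)
    also have "\<dots> \<le> pair_prod s (a - 1) (b - 1)"
      unfolding pair_prod_def using assms by (intro prod_mono conjI mult_le_mono) auto
    finally show ?thesis .
  qed
  have ab: "a * b + 1 \<le> (a - 1) * (b + 1)"
  proof -
    obtain q where "a = b + 2 + q" using assms(1) le_Suc_ex by blast
    then show ?thesis by (simp add: algebra_simps)
  qed
  have "pair_prod (Suc s) a b + (b - s) ^ (2 * s) \<le> (a * b + 1) * pair_prod s (a - 1) (b - 1)"
    using low by (simp add: pair_prod_Suc)
  also have "\<dots> \<le> (a - 1) * (b + 1) * (\<Prod>i<s. (a - 1 - Suc i) * (b + 1 - Suc i))"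
    using ab le by (rule mult_le_mono)
  also have "\<dots> = pair_prod (Suc s) (a - 1) (b + 1)"
    unfolding pair_prod_def prod.lessThan_Suc_shift by simp
  finally show ?thesis .
qed

lemma bip_count_even: "bip_count (2 * s) a b = 2 * pair_prod s a b"
  by (simp add: bip_count_def alt_count_even) (simp add: pair_prod_def mult.commute)

lemma bip_count_odd:
  assumes "s \<le> a" "s \<le> b"
  shows "bip_count (2 * s + 1) a b = pair_prod s a b * (a + b - 2 * s)"
proof -
  have "pair_prod s b a = pair_prod s a b" by (simp add: pair_prod_def mult.commute)
  then have "bip_count (2 * s + 1) a b = pair_prod s a b * ((a - s) + (b - s))"
    unfolding bip_count_def alt_count_odd by (simp only: distrib_left)
  moreover have "(a - s) + (b - s) = a + b - 2 * s" using assms by simp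
  ultimately show ?thesis by simp
qed

text \<open>For even \<open>t\<close> both starting parts contribute the same symmetric product. For odd \<open>t = 2 * s + 1\<close>
  the last vertices of the paths contribute \<open>(a - s) + (b - s)\<close>, which depends on \<open>a + b\<close> only. So in
  both cases the gain comes from the symmetric product.\<close>

lemma bip_count_shift_less:
  assumes "b + 2 \<le> a" "t \<le> b" "2 \<le> t"
  shows "bip_count t a b + (b - t) ^ (t - 2) \<le> bip_count t (a - 1) (b + 1)"
proof -
  have "t = 2 * Suc (t div 2 - 1) \<or> t = 2 * Suc (t div 2 - 1) + 1" using assms(3) by presburger
  then obtain s where s: "t = 2 * Suc s \<or> t = 2 * Suc s + 1" by blast
  have sb: "s \<le> b" using s assms by auto
  note less = pair_prod_shift_less[OF assms(1) sb]
  have pw: "(b - t) ^ (2 * s) \<le> (b - s) ^ (2 * s)" using s by (intro power_mono) auto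
  from s show ?thesis
  proof
    assume t: "t = 2 * Suc s"
    show ?thesis unfolding t bip_count_even using less pw[unfolded t] by simp
  next
    assume t: "t = 2 * Suc s + 1"
    have st: "Suc s \<le> b" using t assms by simp
    have 1: "bip_count t a b = pair_prod (Suc s) a b * (a + b - 2 * Suc s)"
      unfolding t using st assms(1) by (intro bip_count_odd) auto
    have "bip_count t (a - 1) (b + 1) = pair_prod (Suc s) (a - 1) (b + 1) * (a - 1 + (b + 1) - 2 * Suc s)"
      unfolding t using st assms(1) by (intro bip_count_odd) auto
    also have "a - 1 + (b + 1) = a + b" using assms(1) by simp
    finally have 2: "bip_count t (a - 1) (b + 1) = pair_prod (Suc s) (a - 1) (b + 1) * (a + b - 2 * Suc s)" .
    have "(pair_prod (Suc s) a b + (b - t) ^ (2 * s)) * (a + b - 2 * Suc s) \<le> bip_count t (a - 1) (b + 1)"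
      unfolding 2 using less pw by (intro mult_le_mono) auto
    moreover have "(b - t) ^ (t - 2) \<le> (b - t) ^ (2 * s) * (a + b - 2 * Suc s)"
    proof -
      have "t - 2 = Suc (2 * s)" "b - t \<le> a + b - 2 * Suc s" using t by auto
      then show ?thesis by (simp only: power_Suc2 mult_le_mono2)
    qed
    ultimately show ?thesis using 1 by (simp add: distrib_right)
  qed
qed

lemma bip_count_shift_le:
  assumes "b + 2 \<le> a"
  shows "bip_count t a b \<le> bip_count t (a - 1) (b + 1)"
proof -
  consider s where "t = 2 * s" | s where "t = 2 * s + 1" "s \<le> b" | s where "t = 2 * s + 1" "b < s"
    by (meson evenE oddE not_le)
  then show ?thesis
  proof cases
    case (1 s)
    then show ?thesis using pair_prod_shift_le[OF assms, of s] by (simp add: bip_count_even)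
  next
    case (2 s)
    have "bip_count t a b = pair_prod s a b * (a + b - 2 * s)"
      unfolding 2(1) using 2(2) assms by (intro bip_count_odd) auto
    moreover have "bip_count t (a - 1) (b + 1) = pair_prod s (a - 1) (b + 1) * (a - 1 + (b + 1) - 2 * s)"
      unfolding 2(1) using 2(2) assms by (intro bip_count_odd) auto
    moreover have "a - 1 + (b + 1) = a + b" using assms by simp
    ultimately show ?thesis using pair_prod_shift_le[OF assms] by (simp only: mult_le_mono1)
  next
    case (3 s)
    then have "pair_prod s a b = 0" "pair_prod s b a = 0" by (auto simp: pair_prod_def)
    then show ?thesis unfolding 3(1) bip_count_def alt_count_odd by simp
  qed
qed

text \<open>The number of paths on \<open>t\<close> vertices in the balanced complete bipartite graph on \<open>m\<close> vertices.\<close>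

definition turan_count :: "nat \<Rightarrow> nat \<Rightarrow> nat" where
  "turan_count t m = bip_count t (m div 2) (m - m div 2)"

lemma bip_count_le_turan: "bip_count t a b \<le> turan_count t (a + b)"
proof -
  have main: "bip_count t a b \<le> turan_count t (a + b)" if "b \<le> a" for a b
    using that
  proof (induction "a - b" arbitrary: a b rule: less_induct)
    case less
    show ?case
    proof (cases "b + 2 \<le> a")
      case True
      have "bip_count t a b \<le> bip_count t (a - 1) (b + 1)" by (rule bip_count_shift_le[OF True])
      also have "\<dots> \<le> turan_count t (a - 1 + (b + 1))" using True by (intro less.hyps) auto
      finally show ?thesis using True by simp
    next
      case False
      then have "(a + b) div 2 = b" "a + b - (a + b) div 2 = a" using less.prems by linarith+
      then show ?thesis by (simp add: turan_count_def bip_count_commute[of t a])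
    qed
  qed
  show ?thesis
  proof (cases "b \<le> a")
    case False
    then have "bip_count t b a \<le> turan_count t (b + a)" by (intro main) simp
    then show ?thesis by (simp only: bip_count_commute[of t a b] add.commute[of a b])
  qed (rule main)
qed

lemma turan_count_lower: "2 * (m div 2 - t) ^ t \<le> turan_count t m"
proof -
  have "min (m div 2) (m - m div 2) = m div 2" by linarith
  then show ?thesis using bip_count_lower[of "m div 2" "m - m div 2" t] by (simp add: turan_count_def)
qed

text \<open>The new vertex is joined to at least \<open>m div 2\<close> vertices, and already the paths that start at it are
  many.\<close>

lemma turan_count_Suc:
  assumes "0 < t"
  shows "turan_count t m + (m div 2 - t) ^ (t - 1) \<le> turan_count t (Suc m)"
proof -
  obtain k where k: "t = Suc k" using assms by (cases t) auto
  have low: "(m div 2 - t) ^ (t - 1) \<le> alt_count k a b" if "m div 2 \<le> a" "m div 2 \<le> b" for a b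
  proof -
    have "(m div 2 - t) ^ (t - 1) \<le> (min a b - k) ^ k"
      using that k by (simp add: power_mono)
    also have "\<dots> \<le> alt_count k a b" by (rule alt_count_lower)
    finally show ?thesis .
  qed
  have half: "m div 2 \<le> m - m div 2" by linarith
  show ?thesis
  proof (cases "even m")
    case True
    then have "Suc m div 2 = m div 2" "Suc m - Suc m div 2 = Suc (m - m div 2)" by auto
    then show ?thesis using bip_count_grow[of k "m div 2" "m - m div 2"] low[of "m div 2" "m - m div 2"] half k
      by (simp add: turan_count_def)
  next
    case False
    then have "Suc m div 2 = Suc (m div 2)" "Suc m - Suc m div 2 = m - m div 2"
      by (auto elim!: oddE)
    then show ?thesis using bip_count_grow[of k "m - m div 2" "m div 2"] low[of "m - m div 2" "m div 2"] half k
      unfolding turan_count_def bip_count_commute[of _ "m div 2"] bip_count_commute[of _ "Suc m div 2"] by simp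
  qed
qed

lemma turan_count_add:
  assumes "0 < t"
  shows "turan_count t m + j * (m div 2 - t) ^ (t - 1) \<le> turan_count t (m + j)"
proof (induction j)
  case (Suc j)
  have "(m div 2 - t) ^ (t - 1) \<le> ((m + j) div 2 - t) ^ (t - 1)" by (intro power_mono) auto
  then show ?case using Suc turan_count_Suc[OF assms, of "m + j"] by simp
qed simp

section \<open>Graphs without an odd cycle of given length\<close>

locale fin_graph =
  fixes V :: "'a set" and E :: "'a \<Rightarrow> 'a \<Rightarrow> bool"
  assumes fin: "finite V"
    and E_V: "E u v \<Longrightarrow> u \<in> V"
    and E_sym: "E u v \<Longrightarrow> E v u"
    and E_irrefl: "\<not> E v v"
begin

abbreviation N :: real where "N \<equiv> real (card V)"

definition nb :: "'a \<Rightarrow> 'a set" where "nb v = {u. E v u}"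

definition deg :: "'a \<Rightarrow> nat" where "deg v = card (nb v)"

definition degsum :: nat where "degsum = (\<Sum>v\<in>V. deg v)"

definition cycle_free :: "nat \<Rightarrow> bool" where
  "cycle_free k \<longleftrightarrow> \<not> (\<exists>xs. length xs = k \<and> distinct xs \<and> successively E xs \<and> E (last xs) (hd xs))"

lemma E_V': "E u v \<Longrightarrow> v \<in> V" using E_V E_sym by blast

lemma nb_iff: "u \<in> nb v \<longleftrightarrow> E v u" by (simp add: nb_def)

lemma nb_sub: "nb v \<subseteq> V" using E_V E_sym by (auto simp: nb_def)

lemma fin_nb: "finite (nb v)" using nb_sub fin finite_subset by blast

lemma fin_sub: "S \<subseteq> V \<Longrightarrow> finite S" using fin finite_subset by blast

lemma deg_le: "deg v \<le> card V"
  unfolding deg_def by (intro card_mono fin nb_sub)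

lemma double_count:
  assumes "finite S" "finite T"
  shows "(\<Sum>u\<in>S. card (nb u \<inter> T)) = (\<Sum>w\<in>T. card (nb w \<inter> S))"
proof -
  have c: "card (nb u \<inter> T) = (\<Sum>w\<in>T. if E u w then 1 else 0)" if "finite T" for u T
  proof -
    have "nb u \<inter> T = {w \<in> T. E u w}" by (auto simp: nb_def)
    then show ?thesis using that by (simp flip: sum.inter_filter)
  qed
  have "(\<Sum>u\<in>S. card (nb u \<inter> T)) = (\<Sum>w\<in>T. \<Sum>u\<in>S. if E u w then 1 else 0)"
    unfolding c[OF assms(2)] by (rule sum.swap)
  also have "\<dots> = (\<Sum>w\<in>T. \<Sum>u\<in>S. if E w u then 1 else 0)"
    by (intro sum.cong refl if_cong) (blast intro: E_sym)
  finally show ?thesis unfolding c[OF assms(1)] .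
qed

lemma greedy_path:
  assumes "T \<subseteq> V" "T \<noteq> {}" and d: "\<And>v. v \<in> T \<Longrightarrow> d \<le> card (nb v \<inter> T)" and "0 < k" "k \<le> d"
  shows "paths T E k \<noteq> {}"
  using assms(4,5)
proof (induction k)
  case (Suc k)
  show ?case
  proof (cases "k = 0")
    case True
    from assms(2) obtain v where "v \<in> T" by blast
    then have "[v] \<in> paths T E (Suc k)" using True by (simp add: paths_def)
    then show ?thesis by blast
  next
    case False
    with Suc obtain xs where xs: "xs \<in> paths T E k" by auto
    then have ne: "xs \<noteq> []" and hd: "hd xs \<in> T" using False by (auto simp: paths_def)
    have "card (set xs) < card (nb (hd xs) \<inter> T)"
      using xs Suc.prems d[OF hd] by (auto simp: paths_def distinct_card)
    then have "\<not> nb (hd xs) \<inter> T \<subseteq> set xs"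
      by (meson List.finite_set card_mono not_le)
    then obtain u where "u \<in> nb (hd xs) \<inter> T" "u \<notin> set xs" by blast
    then have "u \<in> T" "E (hd xs) u" "u \<notin> set xs" by (simp_all add: nb_iff)
    then have "u # xs \<in> paths T E (Suc k)"
      using xs ne E_sym by (auto simp: paths_def successively_Cons)
    then show ?thesis by blast
  qed
qed simp

text \<open>If all vertices had at least \<open>d\<close> neighbours in \<open>S\<close>, a path could be extended greedily to \<open>d\<close>
  vertices. So there is a vertex with fewer neighbours, and it can be removed.\<close>

lemma sparse_if_no_path:
  assumes "0 < d" "S \<subseteq> V" "paths S E d = {}"
  shows "(\<Sum>v\<in>S. card (nb v \<inter> S)) \<le> 2 * d * card S"
  using assms(2,3)
proof (induction "card S" arbitrary: S)
  case 0
  then show ?case using fin_sub by auto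
next
  case (Suc m)
  have finS: "finite S" using Suc.prems(1) by (rule fin_sub)
  have "S \<noteq> {}" using Suc.hyps(2) by auto
  then obtain v where v: "v \<in> S" "card (nb v \<inter> S) < d"
    using greedy_path[OF Suc.prems(1) _ _ assms(1), of d] Suc.prems(2) not_le by blast
  let ?S = "S - {v}"
  have "paths ?S E d = {}" using Suc.prems(2) paths_mono[of ?S S E E d] by blast
  then have IH: "(\<Sum>u\<in>?S. card (nb u \<inter> ?S)) \<le> 2 * d * card ?S"
    using Suc v finS by (intro Suc.hyps) auto
  have split: "card (nb u \<inter> S) = card (nb u \<inter> ?S) + card (nb u \<inter> {v})" for u
  proof -
    have "nb u \<inter> S = (nb u \<inter> ?S) \<union> (nb u \<inter> {v})" using v by auto
    moreover have "card ((nb u \<inter> ?S) \<union> (nb u \<inter> {v})) = card (nb u \<inter> ?S) + card (nb u \<inter> {v})"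
      using finS by (intro card_Un_disjoint) auto
    ultimately show ?thesis by simp
  qed
  have "(\<Sum>u\<in>S. card (nb u \<inter> S)) = card (nb v \<inter> S) + (\<Sum>u\<in>?S. card (nb u \<inter> S))"
    using v finS by (simp add: sum.remove)
  also have "(\<Sum>u\<in>?S. card (nb u \<inter> S)) = (\<Sum>u\<in>?S. card (nb u \<inter> ?S)) + card (nb v \<inter> ?S)"
    unfolding split sum.distrib using double_count[of ?S "{v}"] finS by simp
  also have "card (nb v \<inter> ?S) \<le> card (nb v \<inter> S)" using finS by (intro card_mono) auto
  finally have "(\<Sum>u\<in>S. card (nb u \<inter> S)) \<le> 2 * d * card ?S + 2 * d" using IH v by simp
  moreover have "card S = Suc (card ?S)" using card_Suc_Diff1[OF finS v(1)] by simp
  ultimately show ?case by (simp add: algebra_simps)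
qed

text \<open>A path on \<open>2 * l\<close> vertices in the neighbourhood of \<open>v\<close> closes up through \<open>v\<close>.\<close>

lemma sparse_neighbourhood:
  assumes "cycle_free (2 * l + 1)" "0 < l"
  shows "(\<Sum>u\<in>nb v. card (nb u \<inter> nb v)) \<le> 4 * l * card (nb v)"
proof -
  have "paths (nb v) E (2 * l) = {}"
  proof (rule ccontr)
    assume "paths (nb v) E (2 * l) \<noteq> {}"
    then obtain xs where xs: "length xs = 2 * l" "distinct xs" "set xs \<subseteq> nb v" "successively E xs"
      by (auto simp: paths_def)
    then have ne: "xs \<noteq> []" using assms(2) by auto
    then have "E v (hd xs)" "E v (last xs)" "v \<notin> set xs"
      using xs(3) E_irrefl by (auto simp: nb_def subset_iff)
    then have "length (v # xs) = 2 * l + 1 \<and> distinct (v # xs) \<and> successively E (v # xs)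
        \<and> E (last (v # xs)) (hd (v # xs))"
      using xs ne E_sym by (auto simp: successively_Cons)
    then show False using assms(1) unfolding cycle_free_def by blast
  qed
  then show ?thesis using sparse_if_no_path[of "2 * l" "nb v"] assms(2) nb_sub by simp
qed

text \<open>The sum on the left counts the edges that leave the neighbourhood of \<open>v\<close> once and the edges inside
  it twice, and there are few of the latter.\<close>

lemma two_step_sum:
  assumes "cycle_free (2 * l + 1)" "0 < l"
  shows "2 * (\<Sum>u\<in>nb v. deg u) \<le> degsum + 4 * l * card V"
proof -
  let ?N = "nb v"
  have split: "deg u = card (nb u \<inter> ?N) + card (nb u \<inter> (V - ?N))" for u
  proof -
    have "nb u = (nb u \<inter> ?N) \<union> (nb u \<inter> (V - ?N))" using nb_sub by blast
    moreover have "card ((nb u \<inter> ?N) \<union> (nb u \<inter> (V - ?N))) = card (nb u \<inter> ?N) + card (nb u \<inter> (V - ?N))"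
      using fin_nb by (intro card_Un_disjoint) auto
    ultimately show ?thesis by (simp add: deg_def)
  qed
  have "(\<Sum>u\<in>?N. deg u) = (\<Sum>u\<in>?N. card (nb u \<inter> ?N)) + (\<Sum>u\<in>V - ?N. card (nb u \<inter> ?N))"
    unfolding split sum.distrib using double_count[of ?N "V - ?N"] fin_nb fin by simp
  also have "(\<Sum>u\<in>V - ?N. card (nb u \<inter> ?N)) \<le> (\<Sum>u\<in>V - ?N. deg u)"
    unfolding deg_def by (intro sum_mono card_mono fin_nb) auto
  finally have "(\<Sum>u\<in>?N. deg u) \<le> (\<Sum>u\<in>?N. card (nb u \<inter> ?N)) + (\<Sum>u\<in>V - ?N. deg u)" by simp
  moreover have "degsum = (\<Sum>u\<in>?N. deg u) + (\<Sum>u\<in>V - ?N. deg u)"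
    unfolding degsum_def using sum.subset_diff[OF nb_sub fin, of deg v] by simp
  moreover have "4 * l * card ?N \<le> 4 * l * card V" using nb_sub fin by (simp add: card_mono)
  ultimately show ?thesis using sparse_neighbourhood[OF assms, of v] by linarith
qed

lemma card_paths_1: "card (paths V E 1) = card V"
proof -
  have "paths V E 1 = (\<lambda>v. [v]) ` V" by (auto simp: paths_def length_Suc_conv)
  then show ?thesis by (simp add: card_image inj_on_def)
qed

lemma card_paths_2: "card (paths V E 2) = degsum"
proof -
  have "paths V E 2 = (\<lambda>(u, v). [u, v]) ` (SIGMA u:V. nb u)"
    using E_V E_V' E_irrefl by (auto simp: paths_def numeral_2_eq_2 length_Suc_conv nb_def)
  moreover have "inj_on (\<lambda>(u, v). [u, v]) (SIGMA u:V. nb u)" by (auto simp: inj_on_def)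
  ultimately show ?thesis using fin fin_nb by (simp add: card_image degsum_def deg_def)
qed

lemma card_paths_two_more:
  assumes "\<And>v. v \<in> V \<Longrightarrow> (\<Sum>u\<in>nb v. deg u) \<le> M" "0 < k"
  shows "card (paths V E (k + 2)) \<le> card (paths V E k) * M"
proof -
  let ?S = "SIGMA zs:paths V E k. SIGMA y:nb (hd zs). nb y"
  have "paths V E (k + 2) \<subseteq> (\<lambda>(zs, y, x). x # y # zs) ` ?S"
  proof
    fix xs assume "xs \<in> paths V E (k + 2)"
    then obtain x y zs where xs: "xs = x # y # zs" "length zs = k" "distinct zs" "set zs \<subseteq> V"
      "successively E (x # y # zs)"
      by (auto simp: paths_def length_Suc_conv numeral_2_eq_2)
    moreover have "zs \<noteq> []" using xs(2) assms(2) by auto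
    ultimately have "(zs, y, x) \<in> ?S"
      using E_sym by (auto simp: paths_def nb_def successively_Cons)
    then show "xs \<in> (\<lambda>(zs, y, x). x # y # zs) ` ?S" using xs(1) by force
  qed
  then have "card (paths V E (k + 2)) \<le> card ?S"
    using fin fin_nb finite_paths[OF fin] by (intro surj_card_le) auto
  also have "\<dots> = (\<Sum>zs\<in>paths V E k. \<Sum>y\<in>nb (hd zs). deg y)"
    using finite_paths[OF fin] fin_nb by (simp add: deg_def)
  also have "\<dots> \<le> (\<Sum>zs\<in>paths V E k. M)"
  proof (intro sum_mono assms)
    fix zs assume "zs \<in> paths V E k"
    then show "hd zs \<in> V" using assms(2) hd_in_set by (fastforce simp: paths_def)
  qed
  finally show ?thesis by simp
qed

lemma card_paths_upper:
  fixes \<gamma> :: real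
  assumes cf: "cycle_free (2 * l + 1)" "0 < l" and "0 \<le> \<gamma>" "\<gamma> \<le> 1 / 2"
    and D: "real degsum \<le> (1 / 2 - 2 * \<gamma>) * N ^ 2"
    and n: "4 * real l \<le> \<gamma> * N" and k: "0 < k"
  shows "real (card (paths V E k)) \<le> 2 * (N / 2) ^ k * (1 - 2 * \<gamma>) ^ (k div 2)"
  using k
proof (induction k rule: less_induct)
  case (less k)
  consider "k = 1" | "k = 2" | m where "k = m + 2" "0 < m"
    using less.prems by (metis One_nat_def Suc_1 add.commute add_2_eq_Suc' neq0_conv not0_implies_Suc)
  then show ?case
  proof cases
    case 1
    then show ?thesis using card_paths_1 by simp
  next
    case 2
    have "real degsum \<le> (1 / 2 - \<gamma>) * N ^ 2"
      by (rule order_trans[OF D]) (use \<open>0 \<le> \<gamma>\<close> in \<open>simp add: mult_right_mono\<close>)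
    then show ?thesis unfolding 2 card_paths_2 by (simp add: power2_eq_square field_simps)
  next
    case (3 m)
    define M where "M = (degsum + 4 * l * card V) div 2"
    have "card (paths V E (m + 2)) \<le> card (paths V E m) * M"
    proof (rule card_paths_two_more)
      show "(\<Sum>u\<in>nb v. deg u) \<le> M" for v
        using two_step_sum[OF cf, of v] unfolding M_def by linarith
    qed (rule 3)
    then have "real (card (paths V E k)) \<le> real (card (paths V E m)) * real M"
      unfolding 3 by (simp flip: of_nat_mult)
    also have "\<dots> \<le> (2 * (N / 2) ^ m * (1 - 2 * \<gamma>) ^ (m div 2)) * ((N / 2) ^ 2 * (1 - 2 * \<gamma>))"
    proof (rule mult_mono)
      show "real (card (paths V E m)) \<le> 2 * (N / 2) ^ m * (1 - 2 * \<gamma>) ^ (m div 2)"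
        using 3 less.IH by simp
      have "real M \<le> (real degsum + 4 * real l * N) / 2"
        unfolding M_def using of_nat_div_le_of_nat[of "degsum + 4 * l * card V" 2, where 'a=real] by simp
      also have "\<dots> \<le> ((1 / 2 - 2 * \<gamma>) * N ^ 2 + \<gamma> * N * N) / 2"
        using D mult_right_mono[OF n, of N] by simp
      also have "\<dots> = (N / 2) ^ 2 * (1 - 2 * \<gamma>)" by (simp add: power2_eq_square field_simps)
      finally show "real M \<le> (N / 2) ^ 2 * (1 - 2 * \<gamma>)" .
    qed (use assms in auto)
    also have "\<dots> = 2 * (N / 2) ^ k * (1 - 2 * \<gamma>) ^ (k div 2)"
      unfolding 3 by (simp add: power_add power2_eq_square)
    finally show ?thesis .
  qed
qed

text \<open>With fewer edges, the upper bound on the number of paths would fall short of \<open>2 * (N / 2) ^ t\<close> by a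
  constant factor. But the comparison graph falls short of it only by a factor \<open>1 - O(1 / N)\<close>, by
  Bernoulli's inequality.\<close>

lemma degsum_large:
  fixes \<gamma> :: real
  assumes cf: "cycle_free (2 * l + 1)" "0 < l" and \<gamma>: "0 < \<gamma>" "\<gamma> \<le> 1 / 2" and t: "2 \<le> t"
    and n: "4 * real l \<le> \<gamma> * N" "real (r + t) * real t < \<gamma> * N"
      "2 * (r + t) \<le> card V"
    and p: "turan_count t (card V - r + 1) \<le> card (paths V E t)"
  shows "(1 / 2 - 2 * \<gamma>) * N ^ 2 \<le> real degsum"
proof (rule ccontr)
  assume "\<not> ?thesis"
  then have D: "real degsum \<le> (1 / 2 - 2 * \<gamma>) * N ^ 2" by simp
  have n0: "0 < N" using n(1) cf(2) \<gamma> by (cases "card V = 0") auto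
  define c where "c = real (r + t)"
  have c: "2 * c \<le> N" using n(3) unfolding c_def by linarith
  have "(N / 2 - c) ^ t \<le> real (((card V - r + 1) div 2 - t) ^ t)"
  proof -
    have "N / 2 - c \<le> real ((card V - r + 1) div 2 - t)"
    proof -
      have "card V \<le> 2 * ((card V - r + 1) div 2 - t) + 2 * (r + t)"
      proof -
        define h where "h = (card V - r + 1) div 2"
        have "card V \<le> 2 * h + r" unfolding h_def by linarith
        moreover define g where "g = h - t"
        moreover from g_def have "h \<le> g + t" by simp
        ultimately have "card V \<le> 2 * (h - t) + 2 * (r + t)" by simp
        then show ?thesis unfolding h_def .
      qed
      then have "N \<le> real (2 * ((card V - r + 1) div 2 - t) + 2 * (r + t))" by linarith
      then show ?thesis unfolding c_def by simp
    qed
    then show ?thesis using c unfolding of_nat_power by (intro power_mono) auto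
  qed
  then have "2 * (N / 2 - c) ^ t \<le> real (2 * ((card V - r + 1) div 2 - t) ^ t)" by simp
  also have "\<dots> \<le> real (card (paths V E t))"
    using turan_count_lower[where m = "card V - r + 1" and t = t] p by linarith
  also have "\<dots> \<le> 2 * (N / 2) ^ t * (1 - 2 * \<gamma>) ^ (t div 2)"
    using \<gamma> t by (intro card_paths_upper[OF cf _ _ D n(1)]) auto
  also have "\<dots> \<le> 2 * (N / 2) ^ t * (1 - 2 * \<gamma>)"
  proof -
    have "(1 - 2 * \<gamma>) ^ (t div 2) \<le> (1 - 2 * \<gamma>) ^ 1"
      using \<gamma> t by (intro power_decreasing) auto
    then show ?thesis by (intro mult_left_mono) auto
  qed
  finally have "(N / 2 - c) ^ t \<le> (N / 2) ^ t * (1 - 2 * \<gamma>)" by simp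
  moreover have "(N / 2 - c) ^ t = (N / 2) ^ t * (1 + - (2 * c / N)) ^ t"
  proof -
    have "N / 2 - c = N / 2 * (1 + - (2 * c / N))" using n0 by (simp add: field_simps)
    then show ?thesis by (simp only: power_mult_distrib)
  qed
  ultimately have "(1 + - (2 * c / N)) ^ t \<le> 1 - 2 * \<gamma>" using n0 by simp
  moreover have "1 + real t * - (2 * c / N) \<le> (1 + - (2 * c / N)) ^ t"
    using c n0 by (intro Bernoulli_inequality) (simp add: field_simps)
  ultimately have "2 * \<gamma> \<le> real t * (2 * c / N)" by simp
  then have "\<gamma> * N \<le> c * real t" using n0 by (simp add: field_simps)
  then show False using n(2) by (simp add: c_def)
qed

text \<open>The squares of the degrees count walks with two edges, so \<open>two_step_sum\<close> bounds their sum by about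
  \<open>N * degsum / 2\<close>. Expanding the square on the left, this almost cancels if \<open>degsum\<close> is close to
  \<open>N\<^sup>2 / 2\<close>.\<close>

lemma degree_variance:
  fixes \<gamma> :: real
  assumes cf: "cycle_free (2 * l + 1)" "0 < l"
    and n: "4 * real l \<le> \<gamma> * N"
    and D: "(1 / 2 - 2 * \<gamma>) * N ^ 2 \<le> real degsum"
  shows "(\<Sum>v\<in>V. (real (deg v) - N / 2) ^ 2) \<le> 2 * \<gamma> * N ^ 3"
proof -
  have sq: "(\<Sum>v\<in>V. real (deg v) ^ 2) \<le> N * ((real degsum + 4 * real l * N) / 2)"
  proof -
    have "(\<Sum>v\<in>V. deg v * deg v) = (\<Sum>v\<in>V. \<Sum>u\<in>V. if E v u then deg v else 0)"
    proof (intro sum.cong refl)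
      fix v
      have "{u \<in> V. E v u} = nb v" using nb_sub by (auto simp: nb_def)
      then show "deg v * deg v = (\<Sum>u\<in>V. if E v u then deg v else 0)"
        using fin by (simp add: deg_def flip: sum.inter_filter)
    qed
    also have "\<dots> = (\<Sum>u\<in>V. \<Sum>v\<in>V. if E u v then deg v else 0)"
      by (subst sum.swap) (intro sum.cong refl if_cong, blast intro: E_sym)
    also have "\<dots> = (\<Sum>u\<in>V. \<Sum>v\<in>nb u. deg v)"
    proof (rule sum.cong[OF refl])
      fix u
      have "{v \<in> V. E u v} = nb u" using nb_sub by (auto simp: nb_def)
      then show "(\<Sum>v\<in>V. if E u v then deg v else 0) = (\<Sum>v\<in>nb u. deg v)"
        using fin by (simp flip: sum.inter_filter)
    qed
    finally have "2 * (\<Sum>v\<in>V. deg v * deg v) = (\<Sum>u\<in>V. 2 * (\<Sum>v\<in>nb u. deg v))"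
      by (simp only: sum_distrib_left[of 2 _ V, symmetric])
    also have "\<dots> \<le> (\<Sum>u\<in>V. degsum + 4 * l * card V)"
      by (intro sum_mono two_step_sum[OF cf])
    finally have "2 * (\<Sum>v\<in>V. deg v * deg v) \<le> (\<Sum>u\<in>V. degsum + 4 * l * card V)" .
    then have "real (2 * (\<Sum>v\<in>V. deg v * deg v)) \<le> real (card V * (degsum + 4 * l * card V))"
      by (simp only: of_nat_le_iff sum_constant) simp
    then show ?thesis by (simp add: power2_eq_square)
  qed
  have "(\<Sum>v\<in>V. (real (deg v) - N / 2) ^ 2) = (\<Sum>v\<in>V. real (deg v) ^ 2 - N * real (deg v) + N ^ 2 / 4)"
    by (intro sum.cong refl) (simp add: power2_eq_square algebra_simps)
  also have "\<dots> = (\<Sum>v\<in>V. real (deg v) ^ 2) - N * real degsum + N * (N ^ 2 / 4)"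
    by (simp add: sum.distrib sum_subtractf sum_distrib_left degsum_def)
  also have "\<dots> \<le> N * ((real degsum + 4 * real l * N) / 2) - N * real degsum + N * (N ^ 2 / 4)"
    using sq by simp
  also have "\<dots> = N * (N ^ 2 / 4 - real degsum / 2 + 4 * real l * N / 2)" by (simp add: field_simps)
  also have "\<dots> \<le> N * (N ^ 2 / 4 - ((1 / 2 - 2 * \<gamma>) * N ^ 2) / 2 + (\<gamma> * N) * N / 2)"
    using D n by (intro mult_left_mono add_mono diff_mono divide_right_mono mult_right_mono) auto
  also have "\<dots> = 3 / 2 * \<gamma> * N ^ 3" by (simp add: power2_eq_square power3_eq_cube field_simps)
  also have "\<dots> \<le> 2 * \<gamma> * N ^ 3"
  proof -
    have "0 \<le> \<gamma> * N" using n by (meson of_nat_0_le_iff mult_nonneg_nonneg order_trans zero_le_numeral)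
    then have "0 \<le> \<gamma> * N * N ^ 2" by simp
    then show ?thesis by (simp add: power2_eq_square power3_eq_cube field_simps)
  qed
  finally show ?thesis .
qed

lemma card_atypical_le:
  fixes \<epsilon> :: real
  assumes cf: "cycle_free (2 * l + 1)" "0 < l" and \<epsilon>: "0 < \<epsilon>"
    and n: "8 * real l \<le> \<epsilon> ^ 3 * N"
    and D: "(1 / 2 - \<epsilon> ^ 3) * N ^ 2 \<le> real degsum"
  shows "real (card {v \<in> V. \<epsilon> * N < \<bar>real (deg v) - N / 2\<bar>}) \<le> \<epsilon> * N"
proof -
  let ?R = "{v \<in> V. \<epsilon> * N < \<bar>real (deg v) - N / 2\<bar>}"
  have n0: "0 < N" using n cf(2) by (cases "card V = 0") auto
  have "real (card ?R) * (\<epsilon> * N) ^ 2 = (\<Sum>v\<in>?R. (\<epsilon> * N) ^ 2)" by simp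
  also have "\<dots> \<le> (\<Sum>v\<in>?R. (real (deg v) - N / 2) ^ 2)"
  proof (rule sum_mono)
    fix v assume "v \<in> ?R"
    then have "\<bar>\<epsilon> * N\<bar> \<le> \<bar>real (deg v) - N / 2\<bar>" using \<epsilon> by simp
    then show "(\<epsilon> * N) ^ 2 \<le> (real (deg v) - N / 2) ^ 2" by (simp only: abs_le_square_iff)
  qed
  also have "\<dots> \<le> (\<Sum>v\<in>V. (real (deg v) - N / 2) ^ 2)"
    using fin by (intro sum_mono2) auto
  also have "\<dots> \<le> 2 * (\<epsilon> ^ 3 / 2) * N ^ 3"
    using n D by (intro degree_variance[OF cf]) auto
  also have "\<dots> = (\<epsilon> * N) * (\<epsilon> * N) ^ 2" by (simp add: power2_eq_square power3_eq_cube)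
  finally show ?thesis using \<epsilon> n0 by (simp add: mult_le_cancel_right)
qed

section \<open>The dense bipartite kernel\<close>

text \<open>The number \<open>\<kappa>\<close> bounds all defects at once, relative to the number of vertices.\<close>

definition kernel :: "real \<Rightarrow> 'a set \<Rightarrow> 'a set \<Rightarrow> bool" where
  "kernel \<kappa> A B \<longleftrightarrow> A \<subseteq> V \<and> B \<subseteq> V \<and> A \<inter> B = {} \<and>
     (1 / 2 - \<kappa>) * N \<le> real (card A) \<and> (1 / 2 - \<kappa>) * N \<le> real (card B) \<and>
     real (card (V - A - B)) \<le> \<kappa> * N \<and>
     (\<forall>a\<in>A. real (card (B - nb a)) \<le> \<kappa> * N) \<and>
     (\<forall>b\<in>B. real (card (A - nb b)) \<le> \<kappa> * N)"

lemma kernel_sym: "kernel \<kappa> A B \<Longrightarrow> kernel \<kappa> B A"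
proof -
  have "V - A - B = V - B - A" by auto
  then show "kernel \<kappa> A B \<Longrightarrow> kernel \<kappa> B A" unfolding kernel_def by auto
qed

lemma card_few_large:
  fixes \<theta> c :: real
  assumes "finite S" "0 < \<theta>" "real (\<Sum>u\<in>S. f u) \<le> c"
  shows "real (card {u \<in> S. \<theta> < real (f u)}) * \<theta> \<le> c"
proof -
  have "real (card {u \<in> S. \<theta> < real (f u)}) * \<theta> = (\<Sum>u\<in>{u \<in> S. \<theta> < real (f u)}. \<theta>)" by simp
  also have "\<dots> \<le> (\<Sum>u\<in>{u \<in> S. \<theta> < real (f u)}. real (f u))" by (intro sum_mono) auto
  also have "\<dots> \<le> (\<Sum>u\<in>S. real (f u))" using assms by (intro sum_mono2) auto
  finally show ?thesis using assms(3) by simp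
qed

lemma card_split_le:
  assumes "finite T" "S \<subseteq> T \<union> U" "finite U"
  shows "real (card S) \<le> real (card T) + real (card U)"
proof -
  have "card S \<le> card (T \<union> U)" using assms by (intro card_mono) auto
  also have "\<dots> \<le> card T + card U" by (rule card_Un_le)
  finally show ?thesis by linarith
qed

lemma card_Int_Diff_split: "finite S \<Longrightarrow> card S = card (S \<inter> T) + card (S - T)"
  by (metis Diff_disjoint Int_Diff_Un card_Un_disjoint finite_Diff finite_Int inf_commute inf_left_commute inf_bot_right)

lemma sparse_part:
  fixes \<epsilon> :: real
  assumes cf: "cycle_free (2 * l + 1)" "0 < l" and \<epsilon>: "0 < \<epsilon>"
    and n: "4 * real l \<le> \<epsilon> ^ 2 * N" and S: "S \<subseteq> nb v"
  shows "real (card {u \<in> S. \<epsilon> * N < real (card (nb u \<inter> S))}) \<le> \<epsilon> * N"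
proof -
  have n0: "0 < N" using n cf(2) by (cases "card V = 0") auto
  have finS: "finite S" using S fin_nb finite_subset by blast
  have "(\<Sum>u\<in>S. card (nb u \<inter> S)) \<le> (\<Sum>u\<in>S. card (nb u \<inter> nb v))"
    using S fin_nb by (intro sum_mono card_mono) auto
  also have "\<dots> \<le> (\<Sum>u\<in>nb v. card (nb u \<inter> nb v))" using S fin_nb by (intro sum_mono2) auto
  also have "\<dots> \<le> 4 * l * card V"
    using sparse_neighbourhood[OF cf, of v] mult_le_mono2[OF deg_le[of v], of "4 * l"] unfolding deg_def by linarith
  finally have "real (\<Sum>u\<in>S. card (nb u \<inter> S)) \<le> real (4 * l * card V)" by (simp only: of_nat_le_iff)
  then have "real (card {u \<in> S. \<epsilon> * N < real (card (nb u \<inter> S))}) * (\<epsilon> * N) \<le> real (4 * l * card V)"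
    using \<epsilon> n0 finS by (intro card_few_large) auto
  also have "\<dots> \<le> (\<epsilon> * N) * (\<epsilon> * N)"
    using mult_right_mono[OF n, of N] by (simp add: power2_eq_square mult.assoc mult.left_commute)
  finally show ?thesis using \<epsilon> n0 by (simp add: mult_le_cancel_right)
qed

text \<open>The part \<open>A\<close> consists of most of the neighbours of a typical vertex, and the part \<open>B\<close> of most of the
  neighbours, outside of \<open>A\<close>, of a typical vertex of \<open>A\<close>. Both neighbourhoods span few edges, so after
  removing the few vertices with many neighbours in their own part, a vertex of degree about
  \<open>N / 2\<close> in one part must be adjacent to almost all of the other part.\<close>

lemma kernel_exists:
  fixes \<epsilon> :: real
  assumes cf: "cycle_free (2 * l + 1)" "0 < l" and \<epsilon>: "0 < \<epsilon>" "\<epsilon> \<le> 1 / 10"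
    and n: "8 * real l \<le> \<epsilon> ^ 3 * N"
    and D: "(1 / 2 - \<epsilon> ^ 3) * N ^ 2 \<le> real degsum"
  shows "\<exists>A B. kernel (10 * \<epsilon>) A B"
proof -
  define R where "R = {v \<in> V. \<epsilon> * N < \<bar>real (deg v) - N / 2\<bar>}"
  define e where "e = \<epsilon> * N"
  have n0: "0 < N" using n cf(2) by (cases "card V = 0") auto
  then have e0: "0 < e" "10 * e \<le> N" using \<epsilon> by (auto simp: e_def)
  have R: "real (card R) \<le> e" unfolding R_def e_def by (rule card_atypical_le[OF cf \<epsilon>(1) n D])
  have finR: "finite R" using fin by (simp add: R_def)
  have n2: "4 * real l \<le> \<epsilon> ^ 2 * N"
  proof -
    have "\<epsilon> ^ 3 * N \<le> \<epsilon> ^ 2 * N" using \<epsilon> by (intro mult_right_mono power_decreasing) auto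
    then show ?thesis using n by linarith
  qed
  have typd: "N / 2 - e \<le> real (card (nb v))" "real (card (nb v)) \<le> N / 2 + e" if "v \<in> V" "v \<notin> R" for v
    using that by (auto simp: R_def e_def deg_def)
  have "\<exists>v0\<in>V. v0 \<notin> R"
  proof (rule ccontr)
    assume "\<not> ?thesis"
    then have "card V \<le> card R" using finR by (intro card_mono) auto
    then show False using R e0 by linarith
  qed
  then obtain v0 where v0: "v0 \<in> V" "v0 \<notin> R" by blast
  define A where "A = nb v0 - R"
  define A1 where "A1 = {u \<in> A. e < real (card (nb u \<inter> A))}"
  define A0 where "A0 = A - A1"
  have A: "A \<subseteq> nb v0" "finite A" using fin_nb by (auto simp: A_def)
  have A1: "real (card A1) \<le> e"
    unfolding A1_def e_def by (rule sparse_part[OF cf \<epsilon>(1) n2 A(1)])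
  have finA1: "finite A1" using A by (simp add: A1_def)
  have A0low: "N / 2 - 3 * e \<le> real (card A0)"
  proof -
    have "real (card (nb v0)) \<le> real (card A) + real (card R)"
      using A finR by (intro card_split_le) (auto simp: A_def)
    moreover have "real (card A) \<le> real (card A0) + real (card A1)"
      using A finA1 by (intro card_split_le) (auto simp: A0_def)
    ultimately show ?thesis using typd[OF v0] A1 R e0 by linarith
  qed
  have A0up: "real (card A0) \<le> N / 2 + e"
  proof -
    have "card A0 \<le> card (nb v0)" using fin_nb by (intro card_mono) (auto simp: A_def A0_def)
    then show ?thesis using typd(2)[OF v0] by linarith
  qed
  then have "A0 \<noteq> {}" using A0low e0 by auto
  then obtain a1 where a1: "a1 \<in> A0" by blast
  then have a1V: "a1 \<in> V" "a1 \<notin> R" using nb_sub by (auto simp: A0_def A_def)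
  define B where "B = nb a1 - R - A"
  define B1 where "B1 = {u \<in> B. e < real (card (nb u \<inter> B))}"
  define B0 where "B0 = B - B1"
  have B: "B \<subseteq> nb a1" "finite B" using fin_nb by (auto simp: B_def)
  have B1: "real (card B1) \<le> e"
    unfolding B1_def e_def by (rule sparse_part[OF cf \<epsilon>(1) n2 B(1)])
  have finB1: "finite B1" using B by (simp add: B1_def)
  have a1A: "real (card (nb a1 \<inter> A)) \<le> e" using a1 by (auto simp: A0_def A1_def)
  have B0low: "N / 2 - 4 * e \<le> real (card B0)"
  proof -
    have "real (card (nb a1)) \<le> real (card (B \<union> (nb a1 \<inter> A))) + real (card R)"
      using A B finR by (intro card_split_le) (auto simp: B_def)
    moreover have "real (card (B \<union> (nb a1 \<inter> A))) \<le> real (card B) + real (card (nb a1 \<inter> A))"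
      using A B by (intro card_split_le) auto
    moreover have "real (card B) \<le> real (card B0) + real (card B1)"
      using B finB1 by (intro card_split_le) (auto simp: B0_def)
    ultimately show ?thesis using typd[OF a1V] B1 R a1A e0 by linarith
  qed
  have B0up: "real (card B0) \<le> N / 2 + e"
  proof -
    have "card B0 \<le> card (nb a1)" using fin_nb by (intro card_mono) (auto simp: B_def B0_def)
    then show ?thesis using typd(2)[OF a1V] by linarith
  qed
  have sub: "A0 \<subseteq> V" "B0 \<subseteq> V" "A0 \<inter> B0 = {}" using nb_sub by (auto simp: A0_def B0_def A_def B_def)
  have rest: "real (card (V - A0 - B0)) \<le> 7 * e"
  proof -
    have "card V = card (V - A0 - B0) + card (A0 \<union> B0)"
    proof -
      have "V = (V - A0 - B0) \<union> (A0 \<union> B0)" using sub by blast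
      moreover have "card ((V - A0 - B0) \<union> (A0 \<union> B0)) = card (V - A0 - B0) + card (A0 \<union> B0)"
        using sub fin fin_sub by (intro card_Un_disjoint) auto
      ultimately show ?thesis by simp
    qed
    moreover have "card (A0 \<union> B0) = card A0 + card B0"
      using sub fin_sub by (intro card_Un_disjoint) auto
    ultimately show ?thesis using A0low B0low by linarith
  qed
  have missA: "real (card (B0 - nb a)) \<le> 10 * e" if a: "a \<in> A0" for a
  proof -
    have aV: "a \<in> V" "a \<notin> R" using a nb_sub by (auto simp: A0_def A_def)
    have "real (card (nb a \<inter> A)) \<le> e" using a by (auto simp: A0_def A1_def)
    moreover have "real (card (nb a)) \<le> real (card (nb a \<inter> B0)) + real (card ((nb a \<inter> A) \<union> (V - A0 - B0)))"
      using fin fin_nb A nb_sub by (intro card_split_le) (auto simp: A0_def)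
    moreover have "real (card ((nb a \<inter> A) \<union> (V - A0 - B0))) \<le> real (card (nb a \<inter> A)) + real (card (V - A0 - B0))"
      using fin fin_nb by (intro card_split_le) auto
    moreover have "card B0 = card (nb a \<inter> B0) + card (B0 - nb a)"
      using card_Int_Diff_split[of B0 "nb a"] sub fin_sub by (simp add: Int_commute)
    ultimately show ?thesis using rest typd[OF aV] B0up by linarith
  qed
  have missB: "real (card (A0 - nb b)) \<le> 10 * e" if b: "b \<in> B0" for b
  proof -
    have bV: "b \<in> V" "b \<notin> R" using b nb_sub by (auto simp: B0_def B_def)
    have "real (card (nb b \<inter> B)) \<le> e" using b by (auto simp: B0_def B1_def)
    moreover have "real (card (nb b)) \<le> real (card (nb b \<inter> A0)) + real (card ((nb b \<inter> B) \<union> (V - A0 - B0)))"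
      using fin fin_nb B nb_sub by (intro card_split_le) (auto simp: B0_def)
    moreover have "real (card ((nb b \<inter> B) \<union> (V - A0 - B0))) \<le> real (card (nb b \<inter> B)) + real (card (V - A0 - B0))"
      using fin fin_nb by (intro card_split_le) auto
    moreover have "card A0 = card (nb b \<inter> A0) + card (A0 - nb b)"
      using card_Int_Diff_split[of A0 "nb b"] sub fin_sub by (simp add: Int_commute)
    ultimately show ?thesis using rest typd[OF bV] A0up by linarith
  qed
  have "kernel (10 * \<epsilon>) A0 B0"
    unfolding kernel_def using sub A0low B0low rest missA missB e0
    by (auto simp: e_def algebra_simps)
  then show ?thesis by blast
qed

section \<open>Paths of prescribed length through the kernel\<close>

text \<open>The number \<open>m\<close> counts the inner vertices, so the path has \<open>m + 1\<close> edges, and only the inner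
  vertices are required to avoid \<open>F\<close>.\<close>

definition linked :: "'a set \<Rightarrow> 'a \<Rightarrow> nat \<Rightarrow> 'a \<Rightarrow> bool" where
  "linked F a m b \<longleftrightarrow> (\<exists>xs. length xs = m \<and> distinct (a # xs @ [b]) \<and>
     successively E (a # xs @ [b]) \<and> set xs \<inter> F = {})"

lemma kernel_pick:
  assumes K: "kernel \<kappa> A B" and "a \<in> A" "S \<subseteq> B" "finite F"
    and big: "\<kappa> * N + real (card F) < real (card S)"
  shows "\<exists>b\<in>S. E a b \<and> b \<notin> F"
proof (rule ccontr)
  assume "\<not> ?thesis"
  then have "S \<subseteq> (B - nb a) \<union> F" using \<open>S \<subseteq> B\<close> by (auto simp: nb_iff)
  moreover have "finite (B - nb a)" using K fin_sub by (auto simp: kernel_def)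
  ultimately have "real (card S) \<le> real (card (B - nb a)) + real (card F)"
    using assms(4) by (intro card_split_le) auto
  moreover have "real (card (B - nb a)) \<le> \<kappa> * N" using K \<open>a \<in> A\<close> by (simp add: kernel_def)
  ultimately show False using big by linarith
qed

lemma kernel_sizes:
  assumes "kernel \<kappa> A B"
  shows "N / 2 - \<kappa> * N \<le> real (card A)"
    "N / 2 - \<kappa> * N \<le> real (card B)"
  using assms by (simp_all add: kernel_def algebra_simps)

lemma kernel_common:
  assumes K: "kernel \<kappa> A B" "\<kappa> \<le> 1 / 32" and a: "a \<in> A" "a' \<in> A" and F: "finite F"
    and small: "real (card F) \<le> \<kappa> * N" and n: "0 < card V"
  shows "\<exists>b\<in>B. E a b \<and> E a' b \<and> b \<notin> F"
proof -
  have finB: "finite B" using K fin_sub by (auto simp: kernel_def)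
  have "card B = card (B \<inter> nb a') + card (B - nb a')" by (rule card_Int_Diff_split[OF finB])
  moreover have "real (card (B - nb a')) \<le> \<kappa> * N"
    using K a by (auto simp: kernel_def)
  moreover have "\<kappa> * N \<le> 1 / 32 * N" using K(2) by (rule mult_right_mono) simp
  ultimately have "\<kappa> * N + real (card F) < real (card (B \<inter> nb a'))"
    using small n kernel_sizes[OF K(1)] by linarith
  from kernel_pick[OF K(1) a(1) _ F this] show ?thesis by (auto simp: nb_iff)
qed

text \<open>The path is built greedily, two vertices at a time. Each new vertex \<open>a1\<close> is chosen adjacent to the
  target \<open>b\<close>, so that the path can be completed by an edge when the required length is reached.\<close>

lemma kernel_path_odd:
  assumes "kernel \<kappa> A B" and \<kappa>: "\<kappa> \<le> 1 / 32" and n: "0 < card V"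
    and "a \<in> A" "b \<in> B" "finite F" "a \<notin> F" "b \<notin> F" "0 < k \<or> E a b"
    and "real (card F) + 2 * real k \<le> \<kappa> * N"
  shows "linked F a (2 * k) b"
  using assms(1,4-)
proof (induction k arbitrary: a F)
  case 0
  have "a \<noteq> b" using 0 by (auto simp: kernel_def)
  then show ?case unfolding linked_def using 0 by (intro exI[of _ "[]"]) auto
next
  case (Suc k)
  note K = \<open>kernel \<kappa> A B\<close>
  have K': "kernel \<kappa> B A" by (rule kernel_sym[OF K])
  have disj: "A \<inter> B = {}" using K by (simp add: kernel_def)
  have B: "N / 2 - \<kappa> * N \<le> real (card B)" by (rule kernel_sizes[OF K])
  have kn: "\<kappa> * N \<le> 1 / 32 * N" using \<kappa> by (rule mult_right_mono) simp
  have cF: "real (card (insert u F)) \<le> \<kappa> * N" "real (card (insert u F)) + 1 \<le> \<kappa> * N" for u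
    using Suc.prems(4,8) by (auto simp: card_insert_if)
  have "\<exists>b1\<in>B. E a b1 \<and> b1 \<notin> insert b F"
  proof (rule kernel_pick[OF K])
    show "\<kappa> * N + real (card (insert b F)) < real (card B)" using cF[of b] kn B n by linarith
  qed (use Suc.prems in auto)
  then obtain b1 where b1: "b1 \<in> B" "E a b1" "b1 \<noteq> b" "b1 \<notin> F" by auto
  have "\<exists>a1\<in>A. E b1 a1 \<and> E b a1 \<and> a1 \<notin> insert a F"
    using Suc.prems b1 n cF by (intro kernel_common[OF K' \<kappa>]) auto
  then obtain a1 where a1: "a1 \<in> A" "E b1 a1" "E b a1" "a1 \<noteq> a" "a1 \<notin> F" by auto
  let ?F = "insert a (insert b1 F)"
  have "real (card ?F) \<le> real (card F) + 2" using Suc.prems(4) by (simp add: card_insert_if)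
  then have "real (card ?F) + 2 * real k \<le> \<kappa> * N" using Suc.prems(8) by simp
  then have "linked ?F a1 (2 * k) b"
    using Suc.prems a1 b1 disj E_sym by (intro Suc.IH) auto
  then obtain xs where xs: "length xs = 2 * k" "distinct (a1 # xs @ [b])"
    "successively E (a1 # xs @ [b])" "set xs \<inter> ?F = {}" unfolding linked_def by blast
  have "successively E (a # (b1 # a1 # xs) @ [b])" using xs(3) b1 a1 by simp
  moreover have "distinct (a # (b1 # a1 # xs) @ [b])" using xs b1 a1 disj Suc.prems by auto
  moreover have "set (b1 # a1 # xs) \<inter> F = {}" using xs b1 a1 by auto
  moreover have "length (b1 # a1 # xs) = 2 * Suc k" using xs by simp
  ultimately show ?case unfolding linked_def by blast
qed

lemma kernel_path_even:
  assumes K: "kernel \<kappa> A B" and \<kappa>: "\<kappa> \<le> 1 / 32" and n: "0 < card V"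
    and a: "a \<in> A" "a' \<in> A" "a \<noteq> a'" "a \<notin> F" "a' \<notin> F" and F: "finite F"
    and small: "real (card F) + 2 * real k + 2 \<le> \<kappa> * N"
  shows "linked F a (2 * k + 1) a'"
proof -
  have disj: "A \<inter> B = {}" using K by (simp add: kernel_def)
  have "\<exists>b\<in>B. E a b \<and> E a' b \<and> b \<notin> F"
    using K \<kappa> a F n small by (intro kernel_common[OF K \<kappa>]) auto
  then obtain b where b: "b \<in> B" "E a b" "E a' b" "b \<notin> F" by blast
  have "real (card (insert a F)) + 2 * real k \<le> \<kappa> * N" using F small by (simp add: card_insert_if)
  then have "linked (insert a F) a' (2 * k) b"
    using a b F disj by (intro kernel_path_odd[OF K \<kappa> n]) auto
  then obtain xs where xs: "length xs = 2 * k" "distinct (a' # xs @ [b])" "successively E (a' # xs @ [b])"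
    "set xs \<inter> insert a F = {}" unfolding linked_def by blast
  let ?ys = "b # rev xs"
  have "successively E (rev (a' # xs @ [b]))"
    using xs(3) unfolding successively_rev by (rule successively_mono) (use E_sym in blast)
  then have "successively E (a # ?ys @ [a'])" using b by simp
  moreover have "distinct (a # ?ys @ [a'])" using xs a b disj by auto
  moreover have "set ?ys \<inter> F = {}" "length ?ys = 2 * k + 1" using xs b by auto
  ultimately show ?thesis unfolding linked_def by blast
qed

text \<open>For a kernel with parts \<open>A\<close> and \<open>B\<close>, the sets \<open>side \<kappa> B\<close> and \<open>side \<kappa> A\<close> extend \<open>A\<close> and \<open>B\<close> to the
  two sides of a larger bipartite core.\<close>

definition side :: "real \<Rightarrow> 'a set \<Rightarrow> 'a set" where
  "side \<kappa> B = {v \<in> V. 2 * \<kappa> * N \<le> real (card (nb v \<inter> B))}"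

end

locale kernel_graph = fin_graph +
  fixes l :: nat and \<kappa> :: real and A B :: "'a set"
  assumes l: "2 \<le> l" and cf: "cycle_free (2 * l + 1)"
    and K: "kernel \<kappa> A B" and \<kappa>: "\<kappa> \<le> 1 / 32" and big: "2 * real l + 10 \<le> \<kappa> * N"
begin

lemma swap: "kernel_graph V E l \<kappa> B A"
  using K kernel_sym l cf \<kappa> big by unfold_locales auto

lemma n0: "0 < card V" using big by (cases "card V = 0") auto

lemma \<kappa>_nonneg: "0 \<le> \<kappa>"
proof (rule ccontr)
  assume "\<not> 0 \<le> \<kappa>"
  then have "\<kappa> * N \<le> 0" by (intro mult_nonpos_nonneg) auto
  then show False using big by linarith
qed

lemma \<kappa>_le: "\<kappa> * N \<le> N / 32"
  using mult_right_mono[OF \<kappa>, of "N"] by simp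

lemma A_V: "A \<subseteq> V" and B_V: "B \<subseteq> V" and AB: "A \<inter> B = {}" and finA: "finite A" and finB: "finite B"
  using K fin_sub by (auto simp: kernel_def)

lemmas card_AB = kernel_sizes[OF K]

lemma no_cycle:
  assumes "length xs = 2 * l + 1" "distinct xs" "successively E xs" "E (last xs) (hd xs)"
  shows False
  using assms cf unfolding cycle_free_def by blast

lemma part_subset_side: "A \<subseteq> side \<kappa> B"
proof
  fix a assume a: "a \<in> A"
  have "card B = card (B \<inter> nb a) + card (B - nb a)" by (rule card_Int_Diff_split[OF finB])
  moreover have "real (card (B - nb a)) \<le> \<kappa> * N" using K a by (simp add: kernel_def)
  ultimately have "2 * (\<kappa> * N) \<le> real (card (B \<inter> nb a))"
    using \<kappa>_le card_AB n0 by linarith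
  then show "a \<in> side \<kappa> B" using a A_V by (auto simp: side_def Int_commute mult.assoc)
qed

text \<open>A path of length \<open>2 * l - 1\<close> in the kernel joins \<open>a\<close> and \<open>b\<close>, and \<open>v\<close> would close it to a forbidden
  cycle.\<close>

lemma not_both_parts:
  assumes "a \<in> A" "b \<in> B" "E v a" "E v b"
  shows False
proof -
  have ne: "v \<noteq> a" "v \<noteq> b" using assms E_irrefl by auto
  have "real (card {v}) + 2 * real (l - 1) \<le> \<kappa> * N" using big l by (simp add: of_nat_diff)
  then have "linked {v} a (2 * (l - 1)) b"
    using assms ne l by (intro kernel_path_odd[OF K \<kappa> n0]) auto
  then obtain xs where xs: "length xs = 2 * (l - 1)" "distinct (a # xs @ [b])" "successively E (a # xs @ [b])"
    "set xs \<inter> {v} = {}" unfolding linked_def by blast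
  show False
  proof (rule no_cycle[of "v # a # xs @ [b]"])
    show "length (v # a # xs @ [b]) = 2 * l + 1" using xs l by simp
    show "distinct (v # a # xs @ [b])" using xs ne by auto
    show "successively E (v # a # xs @ [b])" using xs assms by simp
    show "E (last (v # a # xs @ [b])) (hd (v # a # xs @ [b]))" using assms E_sym by simp
  qed
qed

lemma side_avoid:
  assumes "x \<in> side \<kappa> B" "finite F" "card F \<le> 5"
  shows "\<exists>b\<in>B. E x b \<and> b \<notin> F"
proof (rule ccontr)
  assume "\<not> ?thesis"
  then have "nb x \<inter> B \<subseteq> F" by (auto simp: nb_iff)
  then have "card (nb x \<inter> B) \<le> card F" using assms by (intro card_mono) auto
  then show False using assms big l by (auto simp: side_def)
qed

lemma card_triple: "card {a, b, c} \<le> 3"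
  using card_length[of "[a, b, c]"] by simp

lemma sides_disjoint: "side \<kappa> A \<inter> side \<kappa> B = {}"
proof (rule ccontr)
  interpret sw: kernel_graph V E l \<kappa> B A by (rule swap)
  assume "\<not> ?thesis"
  then obtain v where v: "v \<in> side \<kappa> A" "v \<in> side \<kappa> B" by blast
  obtain a b where "a \<in> A" "E v a" "b \<in> B" "E v b"
    using side_avoid[OF v(2), of "{}"] sw.side_avoid[OF v(1), of "{}"] by auto
  then show False using not_both_parts by blast
qed

text \<open>Neighbours of \<open>x\<close> and \<open>x'\<close> in \<open>B\<close> are joined by a path of length \<open>2 * l - 2\<close> in the kernel.\<close>

lemma side_independent:
  assumes x: "x \<in> side \<kappa> B" "x' \<in> side \<kappa> B" "E x x'"
  shows False
proof -
  interpret sw: kernel_graph V E l \<kappa> B A by (rule swap)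
  have ne: "x \<noteq> x'" using x E_irrefl by auto
  obtain b where b: "b \<in> B" "E x b" "b \<notin> {x, x'}" using side_avoid[OF x(1), of "{x, x'}"] ne by auto
  obtain b' where b': "b' \<in> B" "E x' b'" "b' \<notin> {x, x', b}"
    using side_avoid[OF x(2), of "{x, x', b}"] card_triple[of x x' b] by auto
  have "real (card {x, x'}) + 2 * real (l - 2) + 2 \<le> \<kappa> * N" using big l ne by (simp add: of_nat_diff)
  then have "linked {x, x'} b' (2 * (l - 2) + 1) b"
    using b b' by (intro kernel_path_even[OF sw.K \<kappa> n0]) auto
  then obtain xs where xs: "length xs = 2 * (l - 2) + 1" "distinct (b' # xs @ [b])" "successively E (b' # xs @ [b])"
    "set xs \<inter> {x, x'} = {}" unfolding linked_def by blast
  show False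
  proof (rule no_cycle[of "x # x' # b' # xs @ [b]"])
    show "length (x # x' # b' # xs @ [b]) = 2 * l + 1" using xs l by simp
    show "distinct (x # x' # b' # xs @ [b])" using xs ne b b' by auto
    show "successively E (x # x' # b' # xs @ [b])" using xs x b' by simp
    show "E (last (x # x' # b' # xs @ [b])) (hd (x # x' # b' # xs @ [b]))" using b E_sym by simp
  qed
qed

text \<open>The forbidden cycle runs from \<open>z\<close> through \<open>x\<close> into the kernel and back through \<open>y\<close>. The kernel
  vertices \<open>b\<close> and \<open>a\<close> next to \<open>x\<close> and \<open>y\<close> are chosen adjacent, since for \<open>l = 2\<close> the cycle has no
  room for further vertices.\<close>

lemma not_both_sides:
  assumes x: "x \<in> side \<kappa> B" "y \<in> side \<kappa> A" "E z x" "E z y"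
  shows False
proof -
  interpret sw: kernel_graph V E l \<kappa> B A by (rule swap)
  have ne: "z \<noteq> x" "z \<noteq> y" "x \<noteq> y" using x E_irrefl sides_disjoint by auto
  obtain b where b: "b \<in> B" "E x b" "b \<notin> {x, y, z}"
    using side_avoid[OF x(1), of "{x, y, z}"] card_triple[of x y z] by auto
  have "\<exists>a\<in>nb y \<inter> A. E b a \<and> a \<notin> {x, y, z}"
  proof (rule kernel_pick[OF sw.K])
    have "real (card {x, y, z}) \<le> 3" using card_triple[of x y z] by simp
    then show "\<kappa> * N + real (card {x, y, z}) < real (card (nb y \<inter> A))"
      using x(2) big by (simp add: side_def)
  qed (use b in auto)
  then obtain a where a: "a \<in> A" "E y a" "E b a" "a \<notin> {x, y, z}" by (auto simp: nb_iff)
  have "real (card {x, y, z}) + 2 * real (l - 2) \<le> \<kappa> * N" using big l ne by (simp add: of_nat_diff)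
  then have "linked {x, y, z} b (2 * (l - 2)) a"
    using a b by (intro kernel_path_odd[OF sw.K \<kappa> n0]) auto
  then obtain xs where xs: "length xs = 2 * (l - 2)" "distinct (b # xs @ [a])" "successively E (b # xs @ [a])"
    "set xs \<inter> {x, y, z} = {}" unfolding linked_def by blast
  have eq: "z # x # b # xs @ [a, y] = z # x # (b # xs @ [a]) @ [y]" by simp
  show False
  proof (rule no_cycle[of "z # x # b # xs @ [a, y]"])
    show "length (z # x # b # xs @ [a, y]) = 2 * l + 1" using xs l by simp
    show "distinct (z # x # b # xs @ [a, y])" using xs ne b a by auto
    have "successively E ((b # xs @ [a]) @ [y])"
      using xs(3) a E_sym unfolding successively_append_iff by simp
    then show "successively E (z # x # b # xs @ [a, y])" using x b by simp
    show "E (last (z # x # b # xs @ [a, y])) (hd (z # x # b # xs @ [a, y]))" using x E_sym by simp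
  qed
qed

lemma card_nb_side:
  assumes x: "x \<in> side \<kappa> B"
  shows "real (deg x) \<le> real (card (nb x \<inter> B)) + \<kappa> * N"
proof -
  have "nb x \<inter> A = {}"
  proof (rule ccontr)
    assume "\<not> ?thesis"
    then obtain a where "a \<in> A" "E x a" by (auto simp: nb_iff)
    moreover obtain b where "b \<in> B" "E x b" using side_avoid[OF x, of "{}"] by auto
    ultimately show False using not_both_parts by blast
  qed
  then have "nb x \<subseteq> (nb x \<inter> B) \<union> (V - A - B)" using nb_sub by blast
  then have "real (card (nb x)) \<le> real (card (nb x \<inter> B)) + real (card (V - A - B))"
    using fin_nb fin by (intro card_split_le) auto
  then show ?thesis using K by (simp add: kernel_def deg_def)
qed

text \<open>The degree condition makes the neighbourhoods of \<open>x\<close> and \<open>x'\<close> in \<open>B\<close> overlap, and for \<open>l = 2\<close> a common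
  neighbour \<open>y\<close> completes the forbidden cycle. For larger \<open>l\<close> it runs through the kernel.\<close>

lemma unique_attachment:
  assumes x: "x \<in> side \<kappa> B" "x' \<in> side \<kappa> B" "x \<noteq> x'"
    and d: "3 / 8 * N \<le> real (deg x)" "3 / 8 * N \<le> real (deg x')"
    and z: "z \<notin> side \<kappa> A" "z \<notin> side \<kappa> B" "z' \<notin> side \<kappa> A" "z' \<notin> side \<kappa> B"
      "E z z'" "E z x" "E z' x'"
  shows False
proof -
  interpret sw: kernel_graph V E l \<kappa> B A by (rule swap)
  have ne: "z \<noteq> z'" using z E_irrefl by auto
  have nkB: "u \<noteq> x \<and> u \<noteq> x' \<and> u \<noteq> z \<and> u \<noteq> z'" if "u \<in> B" for u
    using that sw.part_subset_side sides_disjoint x z by blast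
  have zx: "z \<noteq> x" "z \<noteq> x'" "z' \<noteq> x" "z' \<noteq> x'" using x z by auto
  have Bup: "real (card B) \<le> N / 2 + \<kappa> * N"
  proof -
    have "card A + card B = card (A \<union> B)" using finA finB AB by (simp add: card_Un_disjoint)
    also have "\<dots> \<le> card V" using A_V B_V fin by (intro card_mono) auto
    finally show ?thesis using card_AB by linarith
  qed
  have "nb x \<inter> B \<inter> (nb x' \<inter> B) \<noteq> {}"
  proof
    assume disj: "nb x \<inter> B \<inter> (nb x' \<inter> B) = {}"
    have "card (nb x \<inter> B) + card (nb x' \<inter> B) = card ((nb x \<inter> B) \<union> (nb x' \<inter> B))"
      using disj finB by (intro card_Un_disjoint[symmetric]) auto
    also have "\<dots> \<le> card B" using finB by (intro card_mono) auto
    finally show False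
      using card_nb_side[OF x(1)] card_nb_side[OF x(2)] d Bup \<kappa>_le n0 by linarith
  qed
  then obtain y where y: "y \<in> B" "E x y" "E x' y" by (auto simp: nb_iff)
  show False
  proof (cases "l = 2")
    case True
    show False
    proof (rule no_cycle[of "[z, x, y, x', z']"])
      show "distinct [z, x, y, x', z']" using ne zx nkB[OF y(1)] x(3) by auto
      show "successively E [z, x, y, x', z']" using z y E_sym by auto
    qed (use True z E_sym in auto)
  next
    case False
    obtain y' where y': "y' \<in> B" "E x' y'" "y' \<noteq> y" using side_avoid[OF x(2), of "{y}"] by auto
    have c4: "card {x, x', z, z'} = 4" using ne zx x(3) by auto
    have "real (card {x, x', z, z'}) + 2 * real (l - 3) + 2 \<le> \<kappa> * N"
      unfolding c4 using big l False by (simp add: of_nat_diff)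
    then have "linked {x, x', z, z'} y (2 * (l - 3) + 1) y'"
      using y y' nkB by (intro kernel_path_even[OF sw.K \<kappa> n0]) auto
    then obtain xs where xs: "length xs = 2 * (l - 3) + 1" "distinct (y # xs @ [y'])" "successively E (y # xs @ [y'])"
      "set xs \<inter> {x, x', z, z'} = {}" unfolding linked_def by blast
    show False
    proof (rule no_cycle[of "z # x # y # xs @ [y', x', z']"])
      show "length (z # x # y # xs @ [y', x', z']) = 2 * l + 1" using xs l False by simp
      show "distinct (z # x # y # xs @ [y', x', z'])" using xs ne zx x(3) nkB[OF y(1)] nkB[OF y'(1)] by auto
      have "successively E ((y # xs @ [y']) @ [x', z'])"
        using xs(3) y' z E_sym unfolding successively_append_iff by simp
      then show "successively E (z # x # y # xs @ [y', x', z'])" using z y by simp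
      show "E (last (z # x # y # xs @ [y', x', z'])) (hd (z # x # y # xs @ [y', x', z']))" using z E_sym by simp
    qed
  qed
qed

lemma outside_degree:
  assumes "z \<notin> side \<kappa> A" "z \<notin> side \<kappa> B" "z \<in> V"
  shows "real (deg z) \<le> 5 * \<kappa> * N"
proof -
  have "nb z \<subseteq> ((nb z \<inter> A) \<union> (nb z \<inter> B)) \<union> (V - A - B)" using nb_sub by blast
  then have "real (deg z) \<le> real (card ((nb z \<inter> A) \<union> (nb z \<inter> B))) + real (card (V - A - B))"
    unfolding deg_def using fin_nb fin by (intro card_split_le) auto
  moreover have "real (card ((nb z \<inter> A) \<union> (nb z \<inter> B))) \<le> real (card (nb z \<inter> A)) + real (card (nb z \<inter> B))"
    using fin_nb by (intro card_split_le) auto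
  ultimately show ?thesis using assms K by (auto simp: side_def kernel_def)
qed

end

section \<open>Colouring a bipartite graph with few extra vertices\<close>

text \<open>Adjacency in the graph that arises from the complete bipartite graph with parts \<open>X\<close> and \<open>Y\<close> by
  suspending a clique at \<open>x\<close>; the other vertices of the clique form \<open>Z\<close>.\<close>

definition suspended :: "'a set \<Rightarrow> 'a set \<Rightarrow> 'a set \<Rightarrow> 'a \<Rightarrow> 'a \<Rightarrow> 'a \<Rightarrow> bool" where
  "suspended X Y Z x u v \<longleftrightarrow> bip X Y u v \<or> u \<noteq> v \<and> u \<in> insert x Z \<and> v \<in> insert x Z"

context fin_graph begin

definition colouring :: "nat \<Rightarrow> 'a set \<Rightarrow> ('a \<Rightarrow> nat) \<Rightarrow> bool" where
  "colouring q W c \<longleftrightarrow> (\<forall>v\<in>W. c v < q) \<and> (\<forall>u\<in>W. \<forall>v\<in>W. E u v \<longrightarrow> c u \<noteq> c v)"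

lemma colouring_extend:
  assumes c: "colouring q W c" and z: "z \<notin> W" and few: "card (c ` (nb z \<inter> W)) < q"
  shows "\<exists>i. colouring q (insert z W) (c(z := i))"
proof -
  have "\<not> {..<q} \<subseteq> c ` (nb z \<inter> W)"
    using few card_mono[of "c ` (nb z \<inter> W)" "{..<q}"] fin_nb by auto
  then obtain i where i: "i < q" "i \<notin> c ` (nb z \<inter> W)" by blast
  have "c w \<noteq> i" if "E z w \<or> E w z" "w \<in> W" for w
    using i(2) that E_sym by (auto simp: nb_iff)
  then have "colouring q (insert z W) (c(z := i))"
    using c i(1) z E_irrefl by (auto simp: colouring_def)
  then show ?thesis by blast
qed

text \<open>Since \<open>z\<close> is attached to one side only, its neighbours in the bipartite part show at most one colour.\<close>

lemma forbidden_colours: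
  assumes "finite Z" and X: "\<forall>v\<in>X. c v = 0" and Y: "\<forall>v\<in>Y. c v = 1"
    and "nb z \<inter> X = {} \<or> nb z \<inter> Y = {}"
  shows "card (c ` (nb z \<inter> (X \<union> Y \<union> Z))) \<le> card (nb z \<inter> Z) + (if nb z \<inter> (X \<union> Y) = {} then 0 else 1)"
proof -
  have "card (c ` (nb z \<inter> (X \<union> Y))) \<le> (if nb z \<inter> (X \<union> Y) = {} then 0 else 1)"
  proof (cases "nb z \<inter> (X \<union> Y) = {}")
    case False
    have "c ` (nb z \<inter> (X \<union> Y)) \<subseteq> {0} \<or> c ` (nb z \<inter> (X \<union> Y)) \<subseteq> {1}"
      using assms by auto
    then have "card (c ` (nb z \<inter> (X \<union> Y))) \<le> 1"
      by (elim disjE) (drule card_mono[rotated], simp, simp)+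
    then show ?thesis using False by simp
  qed simp
  moreover have "card (c ` (nb z \<inter> Z)) \<le> card (nb z \<inter> Z)" using assms(1) by (intro card_image_le) auto
  moreover have "c ` (nb z \<inter> (X \<union> Y \<union> Z)) = c ` (nb z \<inter> Z) \<union> c ` (nb z \<inter> (X \<union> Y))" by blast
  ultimately show ?thesis using card_Un_le[of "c ` (nb z \<inter> Z)" "c ` (nb z \<inter> (X \<union> Y))"] by simp
qed

text \<open>Greedy colouring: the vertices of \<open>Z\<close> coloured before forbid at most \<open>card Z - 1\<close> colours, and the
  bipartite part forbids at most one.\<close>

lemma colouring_few_extra:
  assumes XY: "X \<inter> Y = {}" "\<forall>u\<in>X. \<forall>v\<in>X. \<not> E u v" "\<forall>u\<in>Y. \<forall>v\<in>Y. \<not> E u v" and q: "2 \<le> q"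
    and "finite Z" "Z \<inter> (X \<union> Y) = {}" "\<forall>z\<in>Z. nb z \<inter> X = {} \<or> nb z \<inter> Y = {}" "card Z < q"
  shows "\<exists>c. colouring q (X \<union> Y \<union> Z) c \<and> (\<forall>v\<in>X. c v = 0) \<and> (\<forall>v\<in>Y. c v = 1)"
  using assms(5-)
proof (induction Z)
  case empty
  let ?c = "\<lambda>v. if v \<in> X then 0 else 1 :: nat"
  have "colouring q (X \<union> Y \<union> {}) ?c" using XY q by (auto simp: colouring_def)
  then show ?case using XY by (intro exI[of _ ?c]) auto
next
  case (insert z Z)
  then obtain c where c: "colouring q (X \<union> Y \<union> Z) c" "\<forall>v\<in>X. c v = 0" "\<forall>v\<in>Y. c v = 1" by auto
  have "card (c ` (nb z \<inter> (X \<union> Y \<union> Z))) \<le> card (nb z \<inter> Z) + (if nb z \<inter> (X \<union> Y) = {} then 0 else 1)"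
    using insert c by (intro forbidden_colours) auto
  also have "\<dots> \<le> card Z + 1" using insert(1) by (intro add_mono card_mono) auto
  also have "\<dots> < q" using insert by simp
  finally have few: "card (c ` (nb z \<inter> (X \<union> Y \<union> Z))) < q" .
  have zn: "z \<notin> X \<union> Y \<union> Z" using insert by auto
  obtain i where i: "colouring q (insert z (X \<union> Y \<union> Z)) (c(z := i))"
    using colouring_extend[OF c(1) zn few] by blast
  have "X \<union> Y \<union> insert z Z = insert z (X \<union> Y \<union> Z)" by auto
  with i have "colouring q (X \<union> Y \<union> insert z Z) (c(z := i))" by simp
  moreover have "\<forall>v\<in>X. (c(z := i)) v = 0" "\<forall>v\<in>Y. (c(z := i)) v = 1" using c zn by auto
  ultimately show ?case by blast
qed

text \<open>All vertices except \<open>z\<close> can be coloured greedily, so the neighbours of \<open>z\<close> must show all \<open>q\<close>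
  colours. The other vertices of \<open>Z\<close> account for at most \<open>q - 1\<close> of them.\<close>

lemma critical_clique:
  assumes XY: "X \<inter> Y = {}" "\<forall>u\<in>X. \<forall>v\<in>X. \<not> E u v" "\<forall>u\<in>Y. \<forall>v\<in>Y. \<not> E u v" and q: "2 \<le> q"
    and Z: "finite Z" "Z \<inter> (X \<union> Y) = {}" "\<forall>z\<in>Z. nb z \<inter> X = {} \<or> nb z \<inter> Y = {}" "card Z = q"
    and nc: "\<nexists>c. colouring q (X \<union> Y \<union> Z) c" and z: "z \<in> Z"
  shows "Z - {z} \<subseteq> nb z \<and> nb z \<inter> (X \<union> Y) \<noteq> {}"
proof -
  let ?Z = "Z - {z}"
  have cZ: "card ?Z = q - 1" using z Z by simp
  obtain c where c: "colouring q (X \<union> Y \<union> ?Z) c" "\<forall>v\<in>X. c v = 0" "\<forall>v\<in>Y. c v = 1"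
    using colouring_few_extra[OF XY q, of ?Z] Z cZ q by auto
  have zn: "z \<notin> X \<union> Y \<union> ?Z" and ins: "insert z (X \<union> Y \<union> ?Z) = X \<union> Y \<union> Z" using z Z(2) by auto
  have "\<not> card (c ` (nb z \<inter> (X \<union> Y \<union> ?Z))) < q"
    using colouring_extend[OF c(1) zn] nc unfolding ins by blast
  then have "q \<le> card (c ` (nb z \<inter> (X \<union> Y \<union> ?Z)))" by simp
  also have "\<dots> \<le> card (nb z \<inter> ?Z) + (if nb z \<inter> (X \<union> Y) = {} then 0 else 1)"
    using Z z c by (intro forbidden_colours) auto
  finally have le: "q \<le> card (nb z \<inter> ?Z) + (if nb z \<inter> (X \<union> Y) = {} then 0 else 1)" .
  have "card (nb z \<inter> ?Z) \<le> card ?Z" using Z by (intro card_mono) auto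
  with le cZ q have 1: "nb z \<inter> (X \<union> Y) \<noteq> {}" "card (nb z \<inter> ?Z) = card ?Z" by (auto split: if_splits)
  have "nb z \<inter> ?Z = ?Z" using 1(2) Z by (intro card_subset_eq) auto
  with 1 show ?thesis by auto
qed

text \<open>The vertex \<open>z1\<close> can reuse the colour of \<open>Y\<close> and \<open>z2\<close> that of \<open>X\<close>. This leaves \<open>q - 2\<close> colours for the
  other \<open>q - 2\<close> vertices of \<open>Z\<close>.\<close>

lemma colouring_mixed_attachment:
  assumes XY: "X \<inter> Y = {}" "\<forall>u\<in>X. \<forall>v\<in>X. \<not> E u v" "\<forall>u\<in>Y. \<forall>v\<in>Y. \<not> E u v"
    and Z: "finite Z" "Z \<inter> (X \<union> Y) = {}" "card Z = q"
    and z1: "z1 \<in> Z" "nb z1 \<inter> Y = {}" and z2: "z2 \<in> Z" "nb z2 \<inter> X = {}" and ne: "z1 \<noteq> z2"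
  shows "\<exists>c. colouring q (X \<union> Y \<union> Z) c"
proof -
  have c2: "card {z1, z2} = 2" using ne by simp
  then have q2: "2 \<le> q" using Z z1 z2 card_mono[of Z "{z1, z2}"] by auto
  have "card (Z - {z1, z2}) = q - 2" using Z z1 z2 c2 by (subst card_Diff_subset) auto
  then obtain h where h: "bij_betw h (Z - {z1, z2}) {2..<q}"
    using finite_same_card_bij[of "Z - {z1, z2}" "{2..<q}"] Z by auto
  have h2: "2 \<le> h v \<and> h v < q" if "v \<in> Z" "v \<noteq> z1" "v \<noteq> z2" for v
    using bij_betwE[OF h] that by auto
  have hinj: "h u \<noteq> h v" if "u \<in> Z" "u \<noteq> z1" "u \<noteq> z2" "v \<in> Z" "v \<noteq> z1" "v \<noteq> z2" "u \<noteq> v" for u v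
    using bij_betw_imp_inj_on[OF h] that by (auto simp: inj_on_def)
  define c where "c v = (if v \<in> X then 0 else if v \<in> Y then 1 else if v = z1 then 1 else if v = z2 then 0 else h v)" for v
  have cX: "c v = 0" if "v \<in> X" for v using that by (simp add: c_def)
  have cY: "c v = 1" if "v \<in> Y" for v using that XY by (auto simp: c_def)
  have c1: "c z1 = 1" "c z2 = 0" using z1 z2 Z ne by (auto simp: c_def)
  have ch: "c v = h v" if "v \<in> Z" "v \<noteq> z1" "v \<noteq> z2" for v using that Z by (auto simp: c_def)
  have "c v < q" if "v \<in> X \<union> Y \<union> Z" for v
    using that cX cY c1 ch h2 q2 by (cases "v = z1"; cases "v = z2") auto
  moreover have "c u \<noteq> c v" if uv: "u \<in> X \<union> Y \<union> Z" "v \<in> X \<union> Y \<union> Z" "E u v" for u v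
  proof -
    have nE: "\<not> E z1 w" if "w \<in> Y" for w using z1 that by (auto simp: nb_iff)
    have nE2: "\<not> E z2 w" if "w \<in> X" for w using z2 that by (auto simp: nb_iff)
    have key: "c u \<noteq> c v" if "u \<in> Z" "v \<in> X \<union> Y \<union> Z" "E u v" for u v
    proof (cases "u = z1 \<or> u = z2")
      case True
      show ?thesis
      proof (cases "v \<in> Z")
        case vZ: True
        have "u \<noteq> v" using that E_irrefl by auto
        with True vZ show ?thesis using c1 ch[OF vZ] h2[OF vZ] by (cases "v = z1 \<or> v = z2") auto
      next
        case False
        with True that show ?thesis using nE nE2 cX cY c1 by auto
      qed
    next
      case False
      then have u: "c u = h u" "2 \<le> h u" using ch h2 that by auto
      show ?thesis
      proof (cases "v \<in> Z \<and> v \<noteq> z1 \<and> v \<noteq> z2")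
        case True
        have "u \<noteq> v" using that E_irrefl by auto
        then show ?thesis using hinj[of u v] True False that u ch by auto
      next
        case False
        then have "c v \<le> 1" using that cX cY c1 by auto
        then show ?thesis using u by simp
      qed
    qed
    show ?thesis
    proof (cases "u \<in> Z \<or> v \<in> Z")
      case True
      then show ?thesis using key[of u v] key[of v u] uv E_sym by metis
    next
      case False
      then show ?thesis using uv XY cX cY by auto
    qed
  qed
  ultimately show ?thesis unfolding colouring_def by blast
qed

end

context kernel_graph begin

abbreviation "X \<equiv> side \<kappa> B"
abbreviation "Y \<equiv> side \<kappa> A"
abbreviation "Z \<equiv> V - X - Y"

lemma X_V: "X \<subseteq> V" and Y_V: "Y \<subseteq> V" by (auto simp: side_def)

lemma parts: "X \<inter> Y = {}" "\<forall>u\<in>X. \<forall>v\<in>X. \<not> E u v" "\<forall>u\<in>Y. \<forall>v\<in>Y. \<not> E u v"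
  "X \<union> Y \<union> Z = V" "Z \<inter> (X \<union> Y) = {}"
proof -
  interpret sw: kernel_graph V E l \<kappa> B A by (rule swap)
  show "X \<inter> Y = {}" using sides_disjoint by blast
  show "\<forall>u\<in>X. \<forall>v\<in>X. \<not> E u v" using side_independent by blast
  show "\<forall>u\<in>Y. \<forall>v\<in>Y. \<not> E u v" using sw.side_independent by blast
  show "X \<union> Y \<union> Z = V" using X_V Y_V by blast
qed blast

lemma one_side: "nb v \<inter> X = {} \<or> nb v \<inter> Y = {}"
  using not_both_sides[of _ _ v] by (auto simp: nb_iff)

lemma enough_outside:
  assumes "\<nexists>c. colouring q V c" "2 \<le> q"
  shows "q \<le> card Z"
proof (rule ccontr)
  assume "\<not> q \<le> card Z"
  then have "\<exists>c. colouring q (X \<union> Y \<union> Z) c \<and> (\<forall>v\<in>X. c v = 0) \<and> (\<forall>v\<in>Y. c v = 1)"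
    using parts assms(2) one_side fin by (intro colouring_few_extra) auto
  then show False using assms(1) parts(4) by auto
qed

text \<open>By \<open>critical_clique\<close>, \<open>Z\<close> is a clique and each of its vertices is attached to the core. A vertex
  attached to \<open>Y\<close> would allow a colouring, and different attachment vertices in \<open>X\<close> contradict
  \<open>unique_attachment\<close>.\<close>

lemma suspended_if_all_in_X:
  assumes nc: "\<nexists>c. colouring q V c" "2 \<le> q" and cZ: "card Z = q"
    and d: "\<And>v. v \<in> X \<union> Y \<Longrightarrow> 3 / 8 * N \<le> real (deg v)"
    and z0: "z0 \<in> Z" "nb z0 \<inter> Y = {}"
  shows "\<exists>x\<in>X. (\<forall>u v. E u v \<longrightarrow> suspended X Y Z x u v) \<and>
    (\<forall>u v. u \<in> insert x Z \<longrightarrow> v \<in> insert x Z \<longrightarrow> u \<noteq> v \<longrightarrow> E u v)"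
proof -
  have finZ: "finite Z" using fin by simp
  have cl: "Z - {z} \<subseteq> nb z \<and> nb z \<inter> (X \<union> Y) \<noteq> {}" if "z \<in> Z" for z
    using parts nc(1) that one_side finZ cZ by (intro critical_clique[OF parts(1-3) nc(2)]) auto
  have inX: "nb z \<inter> Y = {} \<and> nb z \<inter> X \<noteq> {}" if "z \<in> Z" for z
  proof -
    have "nb z \<inter> Y = {}"
    proof (rule ccontr)
      assume a: "nb z \<inter> Y \<noteq> {}"
      then have "nb z \<inter> X = {}" "z \<noteq> z0" using one_side z0 by auto
      then have "\<exists>c. colouring q (X \<union> Y \<union> Z) c"
        using parts z0 that finZ cZ by (intro colouring_mixed_attachment[of X Y Z q z0 z]) auto
      then show False using nc parts(4) by simp
    qed
    then show ?thesis using cl[OF that] by blast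
  qed
  have same: "a = b" if "z \<in> Z" "z' \<in> Z" "z \<noteq> z'" "a \<in> nb z \<inter> X" "b \<in> nb z' \<inter> X" for z z' a b
  proof (rule ccontr)
    assume "a \<noteq> b"
    moreover have "E z z'" using cl[OF that(1)] that by (auto simp: nb_iff)
    ultimately show False
      using unique_attachment[of a b z z'] that d[of a] d[of b] by (auto simp: nb_iff)
  qed
  obtain x where x: "x \<in> nb z0 \<inter> X" using inX[OF z0(1)] by blast
  have "Z - {z0} \<noteq> {}"
  proof
    assume "Z - {z0} = {}"
    then have "card Z \<le> card {z0}" by (intro card_mono) auto
    then show False using cZ nc(2) by simp
  qed
  then obtain z1 where z1: "z1 \<in> Z" "z1 \<noteq> z0" by blast
  have att: "nb z \<inter> X = {x}" if z: "z \<in> Z" for z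
  proof (cases "z = z0")
    case False
    then have "\<And>a. a \<in> nb z \<inter> X \<Longrightarrow> a = x" using same[OF z z0(1)] x by blast
    then show ?thesis using inX[OF z] by blast
  next
    case True
    obtain b where b: "b \<in> nb z1 \<inter> X" using inX[OF z1(1)] by blast
    have "a = b" if "a \<in> nb z0 \<inter> X" for a using same[OF z0(1) z1(1)] z1 that b by blast
    then show ?thesis using x True by blast
  qed
  have zE: "E z v \<longleftrightarrow> v = x \<or> v \<in> Z \<and> v \<noteq> z" if "z \<in> Z" for z v
  proof
    assume v: "E z v"
    show "v = x \<or> v \<in> Z \<and> v \<noteq> z"
    proof (cases "v \<in> Z")
      case True
      then show ?thesis using v E_irrefl by auto
    next
      case False
      then have "v \<in> X \<union> Y" using v E_V' by blast
      then show ?thesis using v att[OF that] inX[OF that] by (auto simp: nb_iff)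
    qed
  next
    assume "v = x \<or> v \<in> Z \<and> v \<noteq> z"
    then show "E z v" using att[OF that] cl[OF that] by (auto simp: nb_iff)
  qed
  have x_Z: "x \<notin> Z" "x \<in> X" using x by auto
  have "suspended X Y Z x u v" if uv: "E u v" for u v
  proof (cases "u \<in> Z \<or> v \<in> Z")
    case True
    moreover have "u \<noteq> v" using uv E_irrefl by auto
    ultimately show ?thesis using zE[of u v] zE[of v u] uv E_sym unfolding suspended_def by blast
  next
    case False
    then have "u \<in> X \<union> Y" "v \<in> X \<union> Y" using uv E_V E_V' by blast+
    then show ?thesis using uv parts(2,3) by (auto simp: suspended_def bip_def)
  qed
  moreover have "E u v" if "u \<in> insert x Z" "v \<in> insert x Z" "u \<noteq> v" for u v
    using that zE[of u v] zE[of v u] E_sym by blast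
  ultimately show ?thesis using x_Z by blast
qed

lemma suspended_structure:
  assumes nc: "\<nexists>c. colouring q V c" "2 \<le> q" and cZ: "card Z = q"
    and d: "\<And>v. v \<in> X \<union> Y \<Longrightarrow> 3 / 8 * N \<le> real (deg v)"
  shows "\<exists>X' Y' x. {X', Y'} = {X, Y} \<and> x \<in> X' \<and> (\<forall>u v. E u v \<longrightarrow> suspended X' Y' Z x u v) \<and>
    (\<forall>u v. u \<in> insert x Z \<longrightarrow> v \<in> insert x Z \<longrightarrow> u \<noteq> v \<longrightarrow> E u v)"
proof -
  interpret sw: kernel_graph V E l \<kappa> B A by (rule swap)
  have "Z \<noteq> {}" using cZ nc(2) by (metis card.empty not_numeral_le_zero)
  then obtain z0 where z0: "z0 \<in> Z" by blast
  have ZZ: "V - Y - X = Z" by blast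
  consider "nb z0 \<inter> Y = {}" | "nb z0 \<inter> X = {}" using one_side by blast
  then show ?thesis
  proof cases
    case 1
    obtain x where x: "x \<in> X" "\<forall>u v. E u v \<longrightarrow> suspended X Y Z x u v"
      "\<forall>u v. u \<in> insert x Z \<longrightarrow> v \<in> insert x Z \<longrightarrow> u \<noteq> v \<longrightarrow> E u v"
      using suspended_if_all_in_X[OF nc cZ d z0 1] by blast
    show ?thesis by (intro exI[of _ X] exI[of _ Y] exI[of _ x] conjI refl x)
  next
    case 2
    have d': "v \<in> Y \<union> X \<Longrightarrow> 3 / 8 * N \<le> real (deg v)" for v using d by blast
    obtain x where x: "x \<in> Y" "\<forall>u v. E u v \<longrightarrow> suspended Y X Z x u v"
      "\<forall>u v. u \<in> insert x Z \<longrightarrow> v \<in> insert x Z \<longrightarrow> u \<noteq> v \<longrightarrow> E u v"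
      using sw.suspended_if_all_in_X[OF nc, unfolded ZZ, OF cZ d' z0 2] by blast
    show ?thesis by (intro exI[of _ Y] exI[of _ X] exI[of _ x] conjI insert_commute x)
  qed
qed

end

section \<open>Graphs with almost extremal path count\<close>

context kernel_graph begin

lemma X_large: "N / 2 - \<kappa> * N \<le> real (card X)"
  and Y_large: "N / 2 - \<kappa> * N \<le> real (card Y)"
proof -
  interpret sw: kernel_graph V E l \<kappa> B A by (rule swap)
  have "card A \<le> card X" "card B \<le> card Y"
    using part_subset_side sw.part_subset_side X_V Y_V fin_sub by (auto intro!: card_mono)
  then show "N / 2 - \<kappa> * N \<le> real (card X)"
    "N / 2 - \<kappa> * N \<le> real (card Y)"
    using card_AB by linarith+
qed

lemma Z_small: "real (card Z) \<le> \<kappa> * N"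
proof -
  interpret sw: kernel_graph V E l \<kappa> B A by (rule swap)
  have "card Z \<le> card (V - A - B)" using part_subset_side sw.part_subset_side fin by (intro card_mono) auto
  then show ?thesis using K by (simp add: kernel_def)
qed

lemma card_parts: "card X + card Y + card Z = card V"
proof -
  have "card (X \<union> Y \<union> Z) = card (X \<union> Y) + card Z" using fin X_V Y_V fin_sub by (intro card_Un_disjoint) auto
  moreover have "card (X \<union> Y) = card X + card Y" using X_V Y_V fin_sub parts(1) by (intro card_Un_disjoint) auto
  ultimately show ?thesis using parts(4) by simp
qed

lemma core_paths_sub: "paths (X \<union> Y) E k \<subseteq> paths (X \<union> Y) (bip X Y) k"
  using parts(2,3) by (intro paths_mono) (auto simp: bip_def)

lemma card_core_paths: "0 < k \<Longrightarrow> card (paths (X \<union> Y) (bip X Y) k) = bip_count k (card X) (card Y)"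
  using X_V Y_V fin_sub parts(1) by (intro card_paths_bip) auto

text \<open>Paths that leave the core pass through a vertex of degree at most \<open>5 * \<kappa> * N\<close>.\<close>

lemma card_paths_le_core:
  assumes "2 \<le> t"
  shows "real (card (paths V E t)) \<le> real (card (paths (X \<union> Y) E t)) + 
    real (card Z) * (5 * real t * \<kappa>) * N ^ (t - 1)"
proof -
  define D where "D = nat \<lfloor>5 * \<kappa> * N\<rfloor>"
  have k0: "0 \<le> 5 * \<kappa> * N" using big l by (simp add: mult.assoc)
  have "card {u \<in> V. E z u} \<le> D" if "z \<in> Z" for z
  proof -
    have "{u \<in> V. E z u} = nb z" using E_V' by (auto simp: nb_def)
    moreover have "real (deg z) \<le> 5 * \<kappa> * N" using that by (intro outside_degree) auto
    ultimately show ?thesis by (simp add: D_def deg_def le_nat_floor)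
  qed
  then have "card {xs \<in> paths V E t. set xs \<inter> Z \<noteq> {}} \<le> card Z * t * D * card V ^ (t - 2)"
    using assms fin E_sym by (intro card_paths_touching_low_degree) auto
  then have "real (card {xs \<in> paths V E t. set xs \<inter> Z \<noteq> {}}) \<le> real (card Z * t * D * card V ^ (t - 2))"
    by (rule of_nat_mono)
  also have "\<dots> = real (card Z) * real t * real D * N ^ (t - 2)" by simp
  also have "\<dots> \<le> real (card Z) * real t * (5 * \<kappa> * N) * N ^ (t - 2)"
    using k0 by (intro mult_right_mono mult_left_mono) (auto simp: D_def)
  also have "\<dots> = real (card Z) * (5 * real t * \<kappa>) * (N * N ^ (t - 2))" by simp
  also have "N * N ^ (t - 2) = N ^ (t - 1)"
  proof -
    have "t - 1 = Suc (t - 2)" using assms by simp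
    then show ?thesis by simp
  qed
  finally have touch: "real (card {xs \<in> paths V E t. set xs \<inter> Z \<noteq> {}})
      \<le> real (card Z) * (5 * real t * \<kappa>) * N ^ (t - 1)" .
  have "paths V E t = paths (X \<union> Y) E t \<union> {xs \<in> paths V E t. set xs \<inter> Z \<noteq> {}}"
    using X_V Y_V by (auto simp: paths_def)
  then have "card (paths V E t) \<le> card (paths (X \<union> Y) E t) + card {xs \<in> paths V E t. set xs \<inter> Z \<noteq> {}}"
    using card_Un_le[of "paths (X \<union> Y) E t" "{xs \<in> paths V E t. set xs \<inter> Z \<noteq> {}}"] by simp
  then show ?thesis using touch by linarith
qed

text \<open>Compared with \<open>turan_count t (card V - r + 1)\<close>, the core loses at least \<open>(N / 8) ^ (t - 1)\<close> paths for
  each vertex of \<open>Z\<close> beyond the first \<open>r - 1\<close>, and the paths leaving the core do not make up for this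
  if \<open>\<kappa>\<close> is small.\<close>

lemma few_outside:
  assumes t: "2 \<le> t" and r: "1 \<le> r" and \<kappa>2: "10 * real r * real t * \<kappa> * 8 ^ (t - 1) < 1"
    and n: "16 * (t + 1) \<le> card V"
    and p: "turan_count t (card V - r + 1) \<le> card (paths V E t)"
  shows "card Z < r"
proof (rule ccontr)
  assume "\<not> card Z < r"
  then have rZ: "r \<le> card Z" by simp
  define j where "j = card Z - r + 1"
  have m: "card V - r + 1 = (card V - card Z) + j"
    using rZ card_parts by (auto simp: j_def)
  have "N / 8 \<le> real ((card V - card Z) div 2 - t)"
  proof -
    have "31 / 32 * N \<le> real (card V - card Z)" using Z_small \<kappa>_le card_parts by linarith
    moreover have "card V - card Z \<le> 2 * ((card V - card Z) div 2) + 1" by linarith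
    then have "real (card V - card Z) \<le> 2 * real ((card V - card Z) div 2) + 1" by linarith
    moreover have "16 * real (t + 1) \<le> N" using n by linarith
    moreover have "(card V - card Z) div 2 \<le> ((card V - card Z) div 2 - t) + t" by simp
    then have "real ((card V - card Z) div 2) \<le> real ((card V - card Z) div 2 - t) + real t" by linarith
    ultimately show ?thesis by simp
  qed
  then have "(N / 8) ^ (t - 1) \<le> real ((card V - card Z) div 2 - t) ^ (t - 1)" by (intro power_mono) auto
  then have grow: "real (turan_count t (card V - card Z)) + real j * (N / 8) ^ (t - 1)
      \<le> real (turan_count t (card V - r + 1))"
  proof -
    assume a: "(N / 8) ^ (t - 1) \<le> real ((card V - card Z) div 2 - t) ^ (t - 1)"
    have "turan_count t (card V - card Z) + j * ((card V - card Z) div 2 - t) ^ (t - 1)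
        \<le> turan_count t (card V - r + 1)"
      unfolding m using t by (intro turan_count_add) simp
    then have "real (turan_count t (card V - card Z) + j * ((card V - card Z) div 2 - t) ^ (t - 1))
        \<le> real (turan_count t (card V - r + 1))" by (rule of_nat_mono)
    moreover have "real j * (N / 8) ^ (t - 1) \<le> real j * real ((card V - card Z) div 2 - t) ^ (t - 1)"
      using a by (rule mult_left_mono) simp
    ultimately show ?thesis by simp
  qed
  have "card (paths (X \<union> Y) E t) \<le> bip_count t (card X) (card Y)"
  proof -
    have "finite (paths (X \<union> Y) (bip X Y) t)" using X_V Y_V fin_sub by (intro finite_paths) auto
    from card_mono[OF this core_paths_sub] show ?thesis using card_core_paths[of t] t by simp
  qed
  also have "\<dots> \<le> turan_count t (card X + card Y)" by (rule bip_count_le_turan)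
  also have "card X + card Y = card V - card Z" using card_parts by linarith
  finally have "real (turan_count t (card V - r + 1))
      \<le> real (turan_count t (card V - card Z)) + real (card Z) * (5 * real t * \<kappa>) * N ^ (t - 1)"
    using card_paths_le_core[OF t] p by linarith
  with grow have "real j * (N / 8) ^ (t - 1) \<le> real (card Z) * (5 * real t * \<kappa>) * N ^ (t - 1)" by linarith
  also have "\<dots> \<le> (real r * real j) * (5 * real t * \<kappa>) * N ^ (t - 1)"
  proof -
    \<comment> \<open>This makes the bound on \<open>\<kappa>\<close> independent of the size of \<open>Z\<close>.\<close>
    have "card Z \<le> r * j"
    proof -
      obtain i where i: "card Z = r + i" using rZ le_Suc_ex by blast
      obtain r' where "r = Suc r'" using r by (cases r) auto
      then show ?thesis unfolding j_def i by simp
    qed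
    then have "real (card Z) \<le> real (r * j)" by (rule of_nat_mono)
    then show ?thesis using \<kappa>_nonneg by (intro mult_right_mono) auto
  qed
  finally have "real j * ((1 / 8) ^ (t - 1) * N ^ (t - 1)) \<le> real j * (5 * real r * real t * \<kappa> * N ^ (t - 1))"
    by (simp add: power_divide algebra_simps)
  moreover have "0 < real j" "0 < N ^ (t - 1)" using n0 by (auto simp: j_def)
  ultimately have "(1 / 8) ^ (t - 1) \<le> 5 * real r * real t * \<kappa>" by (simp add: mult_le_cancel_left_pos)
  then have "(1 / 8) ^ (t - 1) * 8 ^ (t - 1) \<le> 5 * real r * real t * \<kappa> * 8 ^ (t - 1)"
    by (rule mult_right_mono) simp
  moreover have "(1 / 8 :: real) ^ (t - 1) * 8 ^ (t - 1) = 1" by (simp add: power_divide)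
  ultimately show False using \<kappa>2 by linarith
qed

text \<open>A vertex of \<open>X\<close> of smaller degree is not adjacent to at least \<open>N / 16\<close> vertices of \<open>Y\<close>. The paths
  lost with these edges outnumber all paths that leave the core.\<close>

lemma core_degree_X:
  assumes t: "2 \<le> t" and r: "1 \<le> r" and \<kappa>2: "10 * real r * real t * \<kappa> * 8 ^ (t - 1) < 1"
    and n: "16 * (t + 1) \<le> card V" and cZ: "card Z < r"
    and p: "turan_count t (card X + card Y) \<le> card (paths V E t)"
    and v: "v \<in> X"
  shows "3 / 8 * N \<le> real (deg v)"
proof (rule ccontr)
  assume low: "\<not> ?thesis"
  define W where "W = Y - nb v"
  have fin': "finite X" "finite Y" using X_V Y_V fin_sub by auto
  have W: "N / 16 \<le> real (card W)"
  proof -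
    have "real (card Y) \<le> real (card W) + real (card (nb v))"
      using fin' fin_nb by (intro card_split_le) (auto simp: W_def)
    then show ?thesis using low[unfolded deg_def] Y_large \<kappa>_le n0 by linarith
  qed
  obtain k where k: "t = Suc (Suc k)" using t by (metis add_2_eq_Suc le_Suc_ex)
  have alt: "(N / 8) ^ k \<le> real (alt_count k (card X - 1) (card Y - 1))"
  proof -
    have "N / 8 \<le> real (min (card X - 1) (card Y - 1) - k)"
    proof -
      define m where "m = min (card X - 1) (card Y - 1)"
      define g where "g = m - k"
      have "16 * real t + 16 \<le> N" using of_nat_mono[OF n, where 'a=real] by simp
      moreover have "m \<le> g + k" by (simp add: g_def)
      then have "real m \<le> real g + real k" by linarith
      moreover have "card X \<le> m + 1 \<or> card Y \<le> m + 1" by (auto simp: m_def)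
      then have "N / 2 - \<kappa> * N \<le> real m + 1"
      proof
        assume "card X \<le> m + 1"
        then have "real (card X) \<le> real m + 1" by linarith
        then show ?thesis using X_large by linarith
      next
        assume "card Y \<le> m + 1"
        then have "real (card Y) \<le> real m + 1" by linarith
        then show ?thesis using Y_large by linarith
      qed
      moreover have "real t = real k + 2" using k by simp
      ultimately show ?thesis unfolding m_def[symmetric] g_def[symmetric] using \<kappa>_le by linarith
    qed
    then have "(N / 8) ^ k \<le> real (min (card X - 1) (card Y - 1) - k) ^ k" by (intro power_mono) auto
    also have "\<dots> \<le> real (alt_count k (card X - 1) (card Y - 1))"
      using of_nat_mono[OF alt_count_lower[of "card X - 1" "card Y - 1" k], where 'a=real] by simp
    finally show ?thesis .
  qed
  let ?L = "{xs \<in> paths (X \<union> Y) (bip X Y) t. hd xs = v \<and> xs ! 1 \<in> W}"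
  have "card W * alt_count k (card X - 1) (card Y - 1) \<le> card ?L"
    unfolding k using fin' parts(1) v by (intro card_paths_bip_first_edge) (auto simp: W_def)
  then have "real (card W * alt_count k (card X - 1) (card Y - 1)) \<le> real (card ?L)" by (rule of_nat_mono)
  moreover have "N / 16 * (N / 8) ^ k \<le> real (card W) * real (alt_count k (card X - 1) (card Y - 1))"
    using W alt by (intro mult_mono) auto
  ultimately have lost: "N / 16 * (N / 8) ^ k \<le> real (card ?L)" by simp
  have "paths (X \<union> Y) E t \<inter> ?L = {}"
  proof (rule ccontr)
    assume "\<not> ?thesis"
    then obtain xs where xs: "length xs = t" "successively E xs" "hd xs = v" "xs ! 1 \<in> W"
      by (auto simp: paths_def)
    then have "E (xs ! 0) (xs ! Suc 0)" using xs(1,2) t successively_nth[of E xs 0] by simp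
    moreover have "xs ! 0 = v" using xs t by (metis hd_conv_nth length_0_conv not_numeral_le_zero)
    ultimately show False using xs(4) by (simp add: W_def nb_iff)
  qed
  then have "card (paths (X \<union> Y) E t) + card ?L = card (paths (X \<union> Y) E t \<union> ?L)"
    using fin' finite_paths[of "X \<union> Y"] by (intro card_Un_disjoint[symmetric]) auto
  also have "\<dots> \<le> card (paths (X \<union> Y) (bip X Y) t)"
    using fin' finite_paths[of "X \<union> Y"] core_paths_sub by (intro card_mono) auto
  also have "\<dots> \<le> turan_count t (card X + card Y)"
    using card_core_paths[of t] bip_count_le_turan t by simp
  finally have "real (card (paths (X \<union> Y) E t)) + N / 16 * (N / 8) ^ k \<le> real (turan_count t (card X + card Y))"
    using lost by linarith
  then have "N / 16 * (N / 8) ^ k \<le> real (card Z) * (5 * real t * \<kappa>) * N ^ (t - 1)"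
    using card_paths_le_core[OF t] p by linarith
  also have "\<dots> \<le> real r * (5 * real t * \<kappa>) * N ^ (t - 1)"
    using cZ \<kappa>_nonneg by (intro mult_right_mono) auto
  finally have "(1 / 2 * (1 / 8) ^ (t - 1)) * N ^ (t - 1) \<le> (5 * real r * real t * \<kappa>) * N ^ (t - 1)"
    unfolding k by (simp add: power_divide algebra_simps)
  moreover have "0 < N ^ (t - 1)" using n0 by auto
  ultimately have "1 / 2 * (1 / 8) ^ (t - 1) \<le> 5 * real r * real t * \<kappa>" by (simp only: mult_le_cancel_right_pos)
  then have "(1 / 2 * (1 / 8) ^ (t - 1)) * 8 ^ (t - 1) \<le> (5 * real r * real t * \<kappa>) * 8 ^ (t - 1)"
    by (rule mult_right_mono) simp
  moreover have "(1 / 2 * (1 / 8 :: real) ^ (t - 1)) * 8 ^ (t - 1) = 1 / 2" by (simp add: power_divide)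
  ultimately show False using \<kappa>2 by linarith
qed

lemma near_extremal_structure:
  assumes t: "2 \<le> t" and r: "3 \<le> r" and \<kappa>2: "10 * real r * real t * \<kappa> * 8 ^ (t - 1) < 1"
    and n: "16 * (t + 1) \<le> card V"
    and p: "turan_count t (card V - r + 1) \<le> card (paths V E t)"
    and nc: "\<nexists>c. colouring (r - 1) V c"
  shows "\<exists>X' Y' Z' x. X' \<inter> Y' = {} \<and> X' \<inter> Z' = {} \<and> Y' \<inter> Z' = {} \<and> X' \<union> Y' \<union> Z' = V \<and> card Z' = r - 1 \<and> x \<in> X'
    \<and> card V \<le> 4 * card X' \<and> card V \<le> 4 * card Y' \<and> (\<forall>u v. E u v \<longrightarrow> suspended X' Y' Z' x u v)
    \<and> (\<forall>u v. u \<in> insert x Z' \<longrightarrow> v \<in> insert x Z' \<longrightarrow> u \<noteq> v \<longrightarrow> E u v)"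
proof -
  interpret sw: kernel_graph V E l \<kappa> B A by (rule swap)
  have r1: "1 \<le> r" "2 \<le> r - 1" using r by auto
  have lt: "card Z < r" by (rule few_outside[OF t r1(1) \<kappa>2 n p])
  have cZ: "card Z = r - 1" using enough_outside[OF nc r1(2)] lt by simp
  have large: "card V \<le> 4 * card X" "card V \<le> 4 * card Y"
    using X_large Y_large \<kappa>_le by linarith+
  then have m: "card V - r + 1 = card X + card Y" using cZ card_parts r n0 by simp
  have ZZ: "V - Y - X = Z" by blast
  have d: "3 / 8 * N \<le> real (deg v)" if "v \<in> X \<union> Y" for v
  proof -
    have pX: "turan_count t (card X + card Y) \<le> card (paths V E t)" using p unfolding m .
    then have pY: "turan_count t (card Y + card X) \<le> card (paths V E t)" by (simp only: add.commute)
    from that show ?thesis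
    proof
      assume "v \<in> X"
      then show ?thesis by (rule core_degree_X[OF t r1(1) \<kappa>2 n lt pX])
    next
      assume "v \<in> Y"
      then show ?thesis by (rule sw.core_degree_X[OF t r1(1) \<kappa>2 n, unfolded ZZ, OF lt pY])
    qed
  qed
  have "\<exists>X' Y' x. {X', Y'} = {X, Y} \<and> x \<in> X' \<and> (\<forall>u v. E u v \<longrightarrow> suspended X' Y' Z x u v) \<and>
    (\<forall>u v. u \<in> insert x Z \<longrightarrow> v \<in> insert x Z \<longrightarrow> u \<noteq> v \<longrightarrow> E u v)"
    by (rule suspended_structure[OF nc r1(2) cZ]) (rule d)
  then obtain X' Y' x where X': "{X', Y'} = {X, Y}" "x \<in> X'" "\<forall>u v. E u v \<longrightarrow> suspended X' Y' Z x u v"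
    "\<forall>u v. u \<in> insert x Z \<longrightarrow> v \<in> insert x Z \<longrightarrow> u \<noteq> v \<longrightarrow> E u v"
    by (elim exE conjE) (rule that)
  have XY': "X' = X \<and> Y' = Y \<or> X' = Y \<and> Y' = X" using X'(1) unfolding doubleton_eq_iff .
  have "X' \<inter> Y' = {}" "X' \<inter> Z = {}" "Y' \<inter> Z = {}" "X' \<union> Y' \<union> Z = V"
    using XY' parts(1,4) by blast+
  moreover have "card V \<le> 4 * card X'" "card V \<le> 4 * card Y'" using XY' large by blast+
  ultimately show ?thesis
    by (intro exI[of _ X'] exI[of _ Y'] exI[of _ Z] exI[of _ x] conjI cZ X')
qed

end

section \<open>Paths in a complete bipartite graph with a suspended clique\<close>

text \<open>The vertex \<open>x\<close> separates the rest of the clique from the rest of the graph.\<close>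

lemma suspended_avoiding:
  assumes "X \<inter> Z = {}" "Y \<inter> Z = {}" "successively (suspended X Y Z x) xs" "x \<notin> set xs" "set xs \<subseteq> X \<union> Y \<union> Z"
  shows "set xs \<subseteq> Z \<or> set xs \<subseteq> X \<union> Y"
  using assms(3-)
proof (induction xs)
  case (Cons a xs)
  show ?case
  proof (cases "xs = []")
    case True
    then show ?thesis using Cons.prems by auto
  next
    case False
    then have h: "hd xs \<in> set xs" "suspended X Y Z x a (hd xs)" and
      IH: "set xs \<subseteq> Z \<or> set xs \<subseteq> X \<union> Y"
      using Cons by (auto simp: successively_Cons)
    have "hd xs \<noteq> x" "a \<noteq> x" using h Cons.prems by auto
    then show ?thesis using h IH assms(1,2) by (auto simp: suspended_def bip_def)
  qed
qed simp

lemma paths_suspended_split: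
  assumes "X \<inter> Z = {}" "Y \<inter> Z = {}" "x \<in> X"
  shows "{xs \<in> paths (X \<union> Y \<union> Z) (suspended X Y Z x) t. set xs \<inter> Z = {}} = paths (X \<union> Y) (bip X Y) t"
    (is "?L = ?R")
proof (intro equalityI subsetI)
  fix xs assume xs: "xs \<in> ?L"
  have "successively (bip X Y) xs"
    by (rule successively_mono[of "suspended X Y Z x"])
       (use xs assms in \<open>auto simp: paths_def suspended_def\<close>)
  then show "xs \<in> ?R" using xs by (auto simp: paths_def)
next
  fix xs assume xs: "xs \<in> ?R"
  have "successively (suspended X Y Z x) xs"
    by (rule successively_mono[of "bip X Y"]) (use xs in \<open>auto simp: paths_def suspended_def\<close>)
  then show "xs \<in> ?L" using xs assms by (auto simp: paths_def)
qed

text \<open>Here \<open>u\<close> moves between the parts. The paths avoiding \<open>Z\<close> are counted by \<open>bip_count\<close>, and the paths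
  that meet \<open>Z\<close> but not \<open>u\<close> are the same before and after the move. The paths that meet \<open>Z\<close> and
  contain \<open>u\<close> must pass through \<open>x\<close>, which leaves only \<open>t - 3\<close> of their vertices free.\<close>

lemma suspended_move:
  assumes fin: "finite X" "finite Y" "finite Z" and disj: "X \<inter> Y = {}" "X \<inter> Z = {}" "Y \<inter> Z = {}"
    and disj': "X' \<inter> Y' = {}" and un: "X' \<union> Y' = X \<union> Y" and x: "x \<in> X" "x \<in> X'" and u: "u \<noteq> x" "u \<in> X \<union> Y"
    and same: "X' - {u} = X - {u}" "Y' - {u} = Y - {u}" and t: "0 < t"
  shows "card (paths (X \<union> Y \<union> Z) (suspended X Y Z x) t) + bip_count t (card X') (card Y')
    \<le> card (paths (X \<union> Y \<union> Z) (suspended X' Y' Z x) t) + bip_count t (card X) (card Y)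
      + card Z * t ^ 3 * card (X \<union> Y \<union> Z) ^ (t - 3)"
proof -
  let ?V = "X \<union> Y \<union> Z"
  let ?S = "suspended X Y Z x" and ?S' = "suspended X' Y' Z x"
  have finV: "finite ?V" using fin by simp
  have fin': "finite X'" "finite Y'" using un fin by (metis finite_Un)+
  have disj'': "X' \<inter> Z = {}" "Y' \<inter> Z = {}" using un disj by blast+
  let ?P0 = "{xs \<in> paths ?V ?S t. set xs \<inter> Z = {}}"
  let ?P1 = "{xs \<in> paths ?V ?S t. set xs \<inter> Z \<noteq> {} \<and> u \<notin> set xs}"
  let ?P2 = "{xs \<in> paths ?V ?S t. set xs \<inter> Z \<noteq> {} \<and> u \<in> set xs}"
  let ?Q0 = "{xs \<in> paths ?V ?S' t. set xs \<inter> Z = {}}"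
  let ?Q1 = "{xs \<in> paths ?V ?S' t. set xs \<inter> Z \<noteq> {}}"
  have finP: "finite (paths ?V R t)" for R by (rule finite_paths[OF finV])
  have P0: "card ?P0 = bip_count t (card X) (card Y)"
    unfolding paths_suspended_split[OF disj(2,3) x(1)] by (rule card_paths_bip[OF fin(1,2) disj(1) t])
  have "?Q0 = paths (X' \<union> Y') (bip X' Y') t"
    using paths_suspended_split[OF disj'' x(2), of t] by (simp add: un)
  then have Q0: "card ?Q0 = bip_count t (card X') (card Y')"
    using card_paths_bip[OF fin' disj' t] by simp
  have "?P1 \<subseteq> ?Q1"
  proof
    fix xs assume xs: "xs \<in> ?P1"
    have "successively ?S' xs"
    proof (rule successively_mono[of ?S])
      show "successively ?S xs" using xs by (simp add: paths_def)
      fix a b assume ab: "a \<in> set xs" "b \<in> set xs" "?S a b"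
      then have "a \<noteq> u" "b \<noteq> u" using xs by auto
      then have "bip X Y a b \<longleftrightarrow> bip X' Y' a b" using same by (auto simp: bip_def)
      then show "?S' a b" using ab(3) by (simp add: suspended_def)
    qed
    then show "xs \<in> ?Q1" using xs by (simp add: paths_def)
  qed
  then have P1: "card ?P1 \<le> card ?Q1" using finP by (intro card_mono) auto
  have "?P2 \<subseteq> {xs \<in> paths ?V ?S t. set xs \<inter> Z \<noteq> {} \<and> x \<in> set xs \<and> u \<in> set xs}"
  proof
    fix xs assume xs: "xs \<in> ?P2"
    have "x \<in> set xs"
    proof (rule ccontr)
      assume "x \<notin> set xs"
      then have "set xs \<subseteq> Z \<or> set xs \<subseteq> X \<union> Y"
        using xs disj by (intro suspended_avoiding[of X Z Y x]) (auto simp: paths_def)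
      then show False using xs disj u by auto
    qed
    then show "xs \<in> {xs \<in> paths ?V ?S t. set xs \<inter> Z \<noteq> {} \<and> x \<in> set xs \<and> u \<in> set xs}" using xs by simp
  qed
  then have "card ?P2 \<le> card {xs \<in> paths ?V ?S t. set xs \<inter> Z \<noteq> {} \<and> x \<in> set xs \<and> u \<in> set xs}"
    using finP by (intro card_mono) auto
  also have "\<dots> \<le> card Z * t ^ 3 * card ?V ^ (t - 3)"
    using finV u x disj by (intro card_paths_through_three) auto
  finally have P2: "card ?P2 \<le> card Z * t ^ 3 * card ?V ^ (t - 3)" .
  have "paths ?V ?S t = ?P0 \<union> (?P1 \<union> ?P2)" by blast
  then have "card (paths ?V ?S t) \<le> card ?P0 + (card ?P1 + card ?P2)"
    using card_Un_le[of ?P0 "?P1 \<union> ?P2"] card_Un_le[of ?P1 ?P2] by simp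
  moreover have "card (paths ?V ?S' t) = card ?Q0 + card ?Q1"
  proof -
    have "paths ?V ?S' t = ?Q0 \<union> ?Q1" by blast
    moreover have "card (?Q0 \<union> ?Q1) = card ?Q0 + card ?Q1" using finP by (intro card_Un_disjoint) auto
    ultimately show ?thesis by simp
  qed
  ultimately show ?thesis using P0 Q0 P1 P2 by linarith
qed

text \<open>One vertex at a time is moved from the larger to the smaller part. By \<open>bip_count_shift_less\<close> this
  gains at least \<open>(b - t) ^ (t - 2)\<close> paths, where \<open>b\<close> is the size of the smaller part, and for large
  graphs this exceeds the loss allowed by \<open>suspended_move\<close>.\<close>

lemma suspended_balance:
  assumes t: "4 \<le> t"
    and n: "8 * t \<le> card (X \<union> Y \<union> Z)" "8 ^ (t - 2) * card Z * t ^ 3 < card (X \<union> Y \<union> Z)"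
    and fin: "finite X" "finite Y" "finite Z" and disj: "X \<inter> Y = {}" "X \<inter> Z = {}" "Y \<inter> Z = {}"
    and large: "card (X \<union> Y \<union> Z) \<le> 4 * card X" "card (X \<union> Y \<union> Z) \<le> 4 * card Y"
    and x: "x \<in> X" and unbal: "card X + 2 \<le> card Y \<or> card Y + 2 \<le> card X"
  shows "\<exists>X' Y'. X' \<inter> Y' = {} \<and> X' \<union> Y' = X \<union> Y \<and> x \<in> X' \<and> card X' \<le> card Y' + 1 \<and> card Y' \<le> card X' + 1 \<and>
    card (paths (X \<union> Y \<union> Z) (suspended X Y Z x) t) < card (paths (X \<union> Y \<union> Z) (suspended X' Y' Z x) t)"
  using assms
proof (induction "max (card X) (card Y)" arbitrary: X Y rule: less_induct)
  case less
  let ?V = "X \<union> Y \<union> Z" and ?p = "\<lambda>X Y. card (paths (X \<union> Y \<union> Z) (suspended X Y Z x) t)"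
  note f = less.prems(4-6) and d = less.prems(7-9) and lg = less.prems(10,11) and xX = less.prems(12)
  have gain: "card Z * t ^ 3 * card ?V ^ (t - 3) < (b - t) ^ (t - 2)" if "card ?V \<le> 4 * b" for b
  proof -
    have "card ?V \<le> 8 * (b - t)" unfolding diff_mult_distrib2 using that less.prems(2) by linarith
    then have "card ?V ^ (t - 2) \<le> (8 * (b - t)) ^ (t - 2)" by (rule power_mono) simp
    then have "card ?V ^ (t - 2) \<le> 8 ^ (t - 2) * (b - t) ^ (t - 2)" by (simp only: power_mult_distrib)
    moreover have "card ?V ^ (t - 2) = card ?V * card ?V ^ (t - 3)"
    proof -
      have "t - 2 = Suc (t - 3)" using t by simp
      then show ?thesis by simp
    qed
    moreover have "8 ^ (t - 2) * card Z * t ^ 3 * card ?V ^ (t - 3) < card ?V * card ?V ^ (t - 3)"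
      using less.prems(3) by (intro mult_strict_right_mono) auto
    ultimately have "8 ^ (t - 2) * (card Z * t ^ 3 * card ?V ^ (t - 3)) < 8 ^ (t - 2) * (b - t) ^ (t - 2)"
      by (simp only: mult.assoc)
    then show ?thesis using mult_less_cancel1 by blast
  qed
  have "\<exists>X1 Y1. X1 \<inter> Y1 = {} \<and> X1 \<union> Y1 = X \<union> Y \<and> x \<in> X1 \<and> ?p X Y < ?p X1 Y1 \<and>
    max (card X1) (card Y1) < max (card X) (card Y) \<and> min (card X) (card Y) \<le> min (card X1) (card Y1)"
  proof (cases "card X \<le> card Y")
    case True
    then have un: "card X + 2 \<le> card Y" using less.prems by linarith
    then have "Y \<noteq> {}" by auto
    then obtain u where u: "u \<in> Y" by blast
    then have nu: "u \<notin> X" "u \<noteq> x" using d(1) xX by auto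
    let ?X = "insert u X" and ?Y = "Y - {u}"
    have c: "card ?X = card X + 1" "card ?Y = card Y - 1" using u nu f by auto
    have eq: "?X \<union> ?Y = X \<union> Y" using u by auto
    have "?p X Y + bip_count t (card ?X) (card ?Y) \<le> card (paths ?V (suspended ?X ?Y Z x) t) + bip_count t (card X) (card Y)
      + card Z * t ^ 3 * card ?V ^ (t - 3)"
      using f d xX u nu t by (intro suspended_move) auto
    moreover have "bip_count t (card X) (card Y) + (card X - t) ^ (t - 2) \<le> bip_count t (card ?X) (card ?Y)"
      unfolding c bip_count_commute[of t "card X"] bip_count_commute[of t "card X + 1"]
      using un lg less.prems(2) t by (intro bip_count_shift_less) linarith+
    ultimately have "?p X Y < card (paths ?V (suspended ?X ?Y Z x) t)"
      using gain[OF lg(1)] by linarith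
    then have "?p X Y < ?p ?X ?Y" unfolding eq .
    moreover have "?X \<inter> ?Y = {}" "x \<in> ?X" using d nu u xX by auto
    moreover have "max (card ?X) (card ?Y) < max (card X) (card Y)" "min (card X) (card Y) \<le> min (card ?X) (card ?Y)"
      unfolding c using un by auto
    ultimately show ?thesis using eq by (intro exI[of _ ?X] exI[of _ ?Y]) (intro conjI)
  next
    case False
    then have un: "card Y + 2 \<le> card X" using less.prems by linarith
    have "X - {x} \<noteq> {}"
    proof
      assume "X - {x} = {}"
      then have "card X \<le> card {x}" by (intro card_mono) auto
      then show False using un by simp
    qed
    then obtain u where u: "u \<in> X" "u \<noteq> x" by blast
    then have nu: "u \<notin> Y" using d(1) by auto
    let ?X = "X - {u}" and ?Y = "insert u Y"
    have c: "card ?X = card X - 1" "card ?Y = card Y + 1" using u nu f by auto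
    have eq: "?X \<union> ?Y = X \<union> Y" using u by auto
    have "?p X Y + bip_count t (card ?X) (card ?Y) \<le> card (paths ?V (suspended ?X ?Y Z x) t) + bip_count t (card X) (card Y)
      + card Z * t ^ 3 * card ?V ^ (t - 3)"
      using f d xX u nu t by (intro suspended_move) auto
    moreover have "bip_count t (card X) (card Y) + (card Y - t) ^ (t - 2) \<le> bip_count t (card ?X) (card ?Y)"
      unfolding c using un lg less.prems(2) t by (intro bip_count_shift_less) linarith+
    ultimately have "?p X Y < card (paths ?V (suspended ?X ?Y Z x) t)"
      using gain[OF lg(2)] by linarith
    then have "?p X Y < ?p ?X ?Y" unfolding eq .
    moreover have "?X \<inter> ?Y = {}" "x \<in> ?X" using d nu u xX by auto
    moreover have "max (card ?X) (card ?Y) < max (card X) (card Y)" "min (card X) (card Y) \<le> min (card ?X) (card ?Y)"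
      unfolding c using un by auto
    ultimately show ?thesis using eq by (intro exI[of _ ?X] exI[of _ ?Y]) (intro conjI)
  qed
  then obtain X1 Y1 where 1: "X1 \<inter> Y1 = {}" "X1 \<union> Y1 = X \<union> Y" "x \<in> X1" "?p X Y < ?p X1 Y1"
    "max (card X1) (card Y1) < max (card X) (card Y)" "min (card X) (card Y) \<le> min (card X1) (card Y1)"
    by blast
  show ?case
  proof (cases "card X1 + 2 \<le> card Y1 \<or> card Y1 + 2 \<le> card X1")
    case False
    then have "card X1 \<le> card Y1 + 1" "card Y1 \<le> card X1 + 1" by linarith+
    moreover have "?p X Y < card (paths ?V (suspended X1 Y1 Z x) t)" using 1(4) unfolding 1(2) .
    ultimately show ?thesis using 1(1-3) by blast
  next
    case True
    have f1: "finite X1" "finite Y1" using 1(2) f by (metis finite_Un)+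
    have d1: "X1 \<inter> Z = {}" "Y1 \<inter> Z = {}" using 1(2) d by blast+
    have lg1: "card (X1 \<union> Y1 \<union> Z) \<le> 4 * card X1" "card (X1 \<union> Y1 \<union> Z) \<le> 4 * card Y1"
      unfolding 1(2) using lg 1(6) by linarith+
    have n1: "8 * t \<le> card (X1 \<union> Y1 \<union> Z)" "8 ^ (t - 2) * card Z * t ^ 3 < card (X1 \<union> Y1 \<union> Z)"
      unfolding 1(2) by (fact less.prems)+
    obtain X' Y' where 2: "X' \<inter> Y' = {}" "X' \<union> Y' = X1 \<union> Y1" "x \<in> X'" "card X' \<le> card Y' + 1"
      "card Y' \<le> card X' + 1" "?p X1 Y1 < card (paths (X1 \<union> Y1 \<union> Z) (suspended X' Y' Z x) t)"
      using less.hyps[OF 1(5) t n1 f1 f(3) 1(1) d1 lg1 1(3) True] by blast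
    have "?p X Y < card (paths ?V (suspended X' Y' Z x) t)"
      using less_trans[OF 1(4) 2(6)] unfolding 1(2) .
    then show ?thesis using 2 1(2) by (intro exI[of _ X'] exI[of _ Y']) simp
  qed
qed

section \<open>From lists of vertices to copies of graphs\<close>

definition adj :: "'a graph \<Rightarrow> 'a \<Rightarrow> 'a \<Rightarrow> bool" where
  "adj G u v \<longleftrightarrow> {u, v} \<in> edges G"

abbreviation path_count :: "nat \<Rightarrow> 'a graph \<Rightarrow> nat" where
  "path_count t G \<equiv> card (paths (verts G) (adj G) t)"

lemma simple_edgeE:
  assumes "simple_graph G" "e \<in> edges G"
  obtains u v where "e = {u, v}" "u \<in> verts G" "v \<in> verts G" "u \<noteq> v"
proof -
  have "e \<subseteq> verts G" "card e = 2" using assms by (auto simp: simple_graph_def)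
  then show ?thesis using that by (auto simp: card_2_iff)
qed

lemma fin_graph_adj: "simple_graph G \<Longrightarrow> fin_graph (verts G) (adj G)"
proof
  fix u v assume G: "simple_graph G"
  show "finite (verts G)" using G by (simp add: simple_graph_def)
  show "u \<in> verts G" if "adj G u v" using that G by (auto simp: simple_graph_def adj_def)
  show "adj G v u" if "adj G u v" using that by (simp add: adj_def insert_commute)
  show "\<not> adj G v v" using G by (auto simp: simple_graph_def adj_def)
qed

lemma isomorphic_edges:
  assumes "simple_graph H" "simple_graph F" and f: "bij_betw f (verts H) (verts F)"
    and e: "\<forall>u\<in>verts H. \<forall>v\<in>verts H. {u, v} \<in> edges H \<longleftrightarrow> {f u, f v} \<in> edges F"
  shows "edges F = (`) f ` edges H"
proof (intro equalityI subsetI)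
  fix a assume "a \<in> edges F"
  then obtain p q where a: "a = {p, q}" "p \<in> verts F" "q \<in> verts F" "{p, q} \<in> edges F"
    using assms(2) by (metis simple_edgeE)
  have "p \<in> f ` verts H" "q \<in> f ` verts H" using a(2,3) f by (simp_all add: bij_betw_def)
  then obtain u v where "u \<in> verts H" "v \<in> verts H" "p = f u" "q = f v" by blast
  then have "{u, v} \<in> edges H" "a = f ` {u, v}" using a e by auto
  then show "a \<in> (`) f ` edges H" by blast
next
  fix a assume "a \<in> (`) f ` edges H"
  then obtain b where b: "b \<in> edges H" "a = f ` b" by blast
  then obtain u v where "b = {u, v}" "u \<in> verts H" "v \<in> verts H" using assms(1) by (metis simple_edgeE)
  then show "a \<in> edges F" using b e by auto
qed

lemma isomorphicI:
  assumes h: "bij_betw h (verts F) (verts H)" and e: "edges H = (`) h ` edges F" and F: "simple_graph F"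
  shows "isomorphic H F"
proof -
  let ?f = "inv_into (verts F) h"
  have inj: "inj_on h (verts F)" using h by (rule bij_betw_imp_inj_on)
  have f: "bij_betw ?f (verts H) (verts F)" using h by (rule bij_betw_inv_into)
  have "{u, v} \<in> edges H \<longleftrightarrow> {?f u, ?f v} \<in> edges F" if uv: "u \<in> verts H" "v \<in> verts H" for u v
  proof -
    have im: "h ` {?f u, ?f v} = {u, v}" "{?f u, ?f v} \<subseteq> verts F"
      using uv h f by (auto simp: bij_betw_inv_into_right bij_betw_apply)
    show ?thesis
    proof
      assume "{u, v} \<in> edges H"
      then obtain a where a: "a \<in> edges F" "h ` a = {u, v}" using e by auto
      then have "a \<subseteq> verts F" using F by (auto simp: simple_graph_def)
      then have "a = {?f u, ?f v}" using a im inj_on_image_eq_iff[OF inj, of a "{?f u, ?f v}"] by auto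
      then show "{?f u, ?f v} \<in> edges F" using a by simp
    next
      assume "{?f u, ?f v} \<in> edges F"
      then have "h ` {?f u, ?f v} \<in> edges H" using e by blast
      then show "{u, v} \<in> edges H" unfolding im .
    qed
  qed
  then show ?thesis using f unfolding isomorphic_def by blast
qed

definition list_graph :: "'a list \<Rightarrow> 'a graph" where
  "list_graph xs = Graph (set xs) ((\<lambda>i. {xs ! i, xs ! Suc i}) ` {i. Suc i < length xs})"

lemma list_graph_map: "list_graph (map f xs) = Graph (f ` verts (list_graph xs)) ((`) f ` edges (list_graph xs))"
proof -
  have "(\<lambda>i. {map f xs ! i, map f xs ! Suc i}) ` {i. Suc i < length xs}
      = (\<lambda>i. f ` {xs ! i, xs ! Suc i}) ` {i. Suc i < length xs}"
    by (intro image_cong) auto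
  then show ?thesis by (simp add: list_graph_def image_image)
qed

lemma path_graph_list: "path_graph t = list_graph [0..<t]"
proof -
  have "(\<lambda>i. {[0..<t] ! i, [0..<t] ! Suc i}) ` {i. Suc i < t} = (\<lambda>i. {i, Suc i}) ` {i. Suc i < t}"
    by (intro image_cong) auto
  then show ?thesis
    by (simp add: path_graph_def list_graph_def lessThan_atLeast0 setcompr_eq_image)
qed

lemma simple_list_graph: "distinct xs \<Longrightarrow> simple_graph (list_graph xs)"
  by (auto simp: simple_graph_def list_graph_def nth_eq_iff_index_eq)

lemma paths_iff_subgraph:
  assumes "distinct xs"
  shows "xs \<in> paths (verts G) (adj G) t \<longleftrightarrow> length xs = t \<and> subgraph (list_graph xs) G"
proof -
  have "successively (adj G) xs \<longleftrightarrow> edges (list_graph xs) \<subseteq> edges G"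
    by (auto simp: successively_conv_nth adj_def list_graph_def)
  then show ?thesis using assms simple_list_graph[OF assms] by (auto simp: paths_def subgraph_def list_graph_def)
qed

text \<open>For \<open>2 \<le> t\<close> these are the two directions in which the path can be traversed.\<close>

definition path_orders :: "nat \<Rightarrow> nat list set" where
  "path_orders t = {ys. distinct ys \<and> list_graph ys = path_graph t}"

lemma path_orders_pos: "0 < card (path_orders t)"
proof -
  have "path_orders t \<subseteq> {ys. set ys \<subseteq> {..<t} \<and> length ys = t}"
  proof
    fix ys assume "ys \<in> path_orders t"
    then have d: "distinct ys" "set ys = {..<t}" by (auto simp: path_orders_def list_graph_def path_graph_def)
    then have "length ys = t" using distinct_card[OF d(1)] by simp
    then show "ys \<in> {ys. set ys \<subseteq> {..<t} \<and> length ys = t}" using d by simp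
  qed
  then have "finite (path_orders t)" by (rule finite_subset) (simp add: finite_lists_length_eq)
  moreover have "[0..<t] \<in> path_orders t" by (simp add: path_orders_def path_graph_list)
  ultimately show ?thesis by (auto simp: card_gt_0_iff)
qed

text \<open>An isomorphism transports the orders in which a path traverses its vertices.\<close>

lemma card_orders_of_copy:
  assumes H: "simple_graph H" "isomorphic H (path_graph t)"
  shows "card {xs. distinct xs \<and> list_graph xs = H} = card (path_orders t)"
proof -
  have F: "simple_graph (path_graph t)" unfolding path_graph_list by (simp add: simple_list_graph)
  obtain f where f: "bij_betw f (verts H) (verts (path_graph t))"
    "\<forall>u\<in>verts H. \<forall>v\<in>verts H. {u, v} \<in> edges H \<longleftrightarrow> {f u, f v} \<in> edges (path_graph t)"
    using H(2) by (auto simp: isomorphic_def)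
  have e: "edges (path_graph t) = (`) f ` edges H" by (rule isomorphic_edges[OF H(1) F f])
  have v: "verts (path_graph t) = f ` verts H" using f(1) by (simp add: bij_betw_def)
  have inj: "inj_on f (verts H)" using f(1) by (simp add: bij_betw_def)
  let ?g = "inv_into (verts H) f"
  have gf: "?g ` f ` S = S" if "S \<subseteq> verts H" for S using inv_into_image_cancel[OF inj that] .
  have "(`) ?g ` edges (path_graph t) = (\<lambda>S. ?g ` f ` S) ` edges H" unfolding e by (simp add: image_image)
  also have "\<dots> = (\<lambda>S. S) ` edges H"
    using H(1) gf by (intro image_cong) (auto simp: simple_graph_def)
  finally have eg: "(`) ?g ` edges (path_graph t) = edges H" by simp
  have vg: "?g ` verts (path_graph t) = verts H" unfolding v by (rule gf) simp
  have "bij_betw (map f) {xs. distinct xs \<and> list_graph xs = H} (path_orders t)"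
  proof (rule bij_betw_byWitness[where f' = "map ?g"])
    have fg: "f (?g y) = y" if "y \<in> verts (path_graph t)" for y
      using f(1) that by (rule bij_betw_inv_into_right)
    show "\<forall>xs\<in>{xs. distinct xs \<and> list_graph xs = H}. map ?g (map f xs) = xs"
    proof
      fix xs assume "xs \<in> {xs. distinct xs \<and> list_graph xs = H}"
      then have set: "set xs = verts H" by (auto simp: list_graph_def)
      show "map ?g (map f xs) = xs" unfolding map_map by (rule map_idI) (use inj set in simp)
    qed
    show "\<forall>ys\<in>path_orders t. map f (map ?g ys) = ys"
    proof
      fix ys assume "ys \<in> path_orders t"
      then have "list_graph ys = path_graph t" by (simp add: path_orders_def)
      then have set: "set ys = verts (path_graph t)" by (metis graph.sel(1) list_graph_def)
      show "map f (map ?g ys) = ys" unfolding map_map by (rule map_idI) (use fg set in simp)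
    qed
    show "map f ` {xs. distinct xs \<and> list_graph xs = H} \<subseteq> path_orders t"
    proof
      fix ys assume "ys \<in> map f ` {xs. distinct xs \<and> list_graph xs = H}"
      then obtain xs where xs: "ys = map f xs" "distinct xs" "list_graph xs = H" by auto
      then have "set xs = verts H" by (auto simp: list_graph_def)
      then have "distinct ys" using xs inj by (simp add: distinct_map)
      moreover have "list_graph ys = path_graph t"
        unfolding xs(1) list_graph_map xs(3) using e v by (cases "path_graph t") auto
      ultimately show "ys \<in> path_orders t" by (simp add: path_orders_def)
    qed
    show "map ?g ` path_orders t \<subseteq> {xs. distinct xs \<and> list_graph xs = H}"
    proof
      fix xs assume "xs \<in> map ?g ` path_orders t"
      then obtain ys where ys: "xs = map ?g ys" "distinct ys" "list_graph ys = path_graph t"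
        by (auto simp: path_orders_def)
      then have "set ys = verts (path_graph t)" by (metis graph.sel(1) list_graph_def)
      moreover have "inj_on ?g (verts (path_graph t))"
        using bij_betw_inv_into[OF f(1)] by (rule bij_betw_imp_inj_on)
      ultimately have "distinct xs" using ys by (simp add: distinct_map)
      moreover have "list_graph xs = H"
        unfolding ys(1) list_graph_map ys(3) using eg vg by (cases H) auto
      ultimately show "xs \<in> {xs. distinct xs \<and> list_graph xs = H}" by simp
    qed
  qed
  then show ?thesis by (rule bij_betw_same_card)
qed

text \<open>So comparing numbers of lists amounts to comparing numbers of copies.\<close>

lemma card_paths_eq_copies:
  assumes G: "simple_graph G"
  shows "path_count t G = num_copies (path_graph t) G * card (path_orders t)"
proof -
  let ?C = "{H. subgraph H G \<and> isomorphic H (path_graph t)}"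
  let ?L = "\<lambda>H. {xs. distinct xs \<and> list_graph xs = H}"
  have finV: "finite (verts G)" "finite (edges G)"
    using G finite_subset[of "edges G" "Pow (verts G)"] by (auto simp: simple_graph_def)
  have "?C \<subseteq> (\<lambda>(A, B). Graph A B) ` (Pow (verts G) \<times> Pow (edges G))"
  proof
    fix H assume "H \<in> ?C"
    then have "H = Graph (verts H) (edges H)" "verts H \<subseteq> verts G" "edges H \<subseteq> edges G"
      by (auto simp: subgraph_def)
    then show "H \<in> (\<lambda>(A, B). Graph A B) ` (Pow (verts G) \<times> Pow (edges G))"
      by (intro image_eqI[of _ _ "(verts H, edges H)"]) auto
  qed
  then have finC: "finite ?C" by (rule finite_subset) (use finV in simp)
  have len: "length xs = t" if "distinct xs" "isomorphic (list_graph xs) (path_graph t)" for xs :: "'a list"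
  proof -
    have "card (verts (list_graph xs)) = card (verts (path_graph t))"
      using that(2) by (auto simp: isomorphic_def dest: bij_betw_same_card)
    then show ?thesis using that(1) by (simp add: list_graph_def path_graph_def distinct_card)
  qed
  have iso: "isomorphic (list_graph xs) (path_graph t)" if "distinct xs" "length xs = t" for xs :: "'a list"
  proof (rule isomorphicI)
    have xs: "xs = map ((!) xs) [0..<t]" using that by (simp add: map_nth flip: that(2))
    then have eq: "list_graph xs = Graph ((!) xs ` verts (path_graph t)) ((`) ((!) xs) ` edges (path_graph t))"
      using list_graph_map[of "(!) xs" "[0..<t]"] by (simp add: path_graph_list)
    show "edges (list_graph xs) = (`) ((!) xs) ` edges (path_graph t)" using arg_cong[OF eq, of edges] by simp
    have "inj_on ((!) xs) {..<t}" using that by (auto simp: inj_on_def nth_eq_iff_index_eq)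
    then show "bij_betw ((!) xs) (verts (path_graph t)) (verts (list_graph xs))"
      using arg_cong[OF eq, of verts] by (simp add: bij_betw_def path_graph_def)
    show "simple_graph (path_graph t)" unfolding path_graph_list by (simp add: simple_list_graph)
  qed
  have "paths (verts G) (adj G) t = (\<Union>H\<in>?C. ?L H)"
  proof (intro equalityI subsetI)
    fix xs assume xs: "xs \<in> paths (verts G) (adj G) t"
    then have d: "distinct xs" by (simp add: paths_def)
    then show "xs \<in> (\<Union>H\<in>?C. ?L H)" using xs paths_iff_subgraph[OF d, of G t] iso[OF d] by auto
  next
    fix xs assume "xs \<in> (\<Union>H\<in>?C. ?L H)"
    then have d: "distinct xs" "subgraph (list_graph xs) G" "isomorphic (list_graph xs) (path_graph t)" by auto
    then show "xs \<in> paths (verts G) (adj G) t" using paths_iff_subgraph[OF d(1), of G t] len by auto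
  qed
  also have "card (\<Union>H\<in>?C. ?L H) = (\<Sum>H\<in>?C. card (?L H))"
  proof (rule card_UN_disjoint[OF finC])
    show "\<forall>H\<in>?C. finite (?L H)"
    proof
      fix H assume "H \<in> ?C"
      then have "0 < card (?L H)"
        using card_orders_of_copy[of H t] path_orders_pos[of t] by (simp add: subgraph_def)
      then show "finite (?L H)" by (rule card_ge_0_finite)
    qed
  qed auto
  also have "\<dots> = (\<Sum>H\<in>?C. card (path_orders t))"
    using card_orders_of_copy by (intro sum.cong) (auto simp: subgraph_def)
  finally show ?thesis by (simp add: num_copies_def)
qed

lemma simple_cycle_graph:
  assumes "3 \<le> k"
  shows "simple_graph (cycle_graph k)"
proof -
  have "card {i, Suc i mod k} = 2" "Suc i mod k < k" if "i < k" for i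
  proof -
    have "i \<noteq> Suc i mod k" using that assms by (cases "Suc i = k") auto
    then show "card {i, Suc i mod k} = 2" by simp
    show "Suc i mod k < k" using assms by simp
  qed
  then show ?thesis by (auto simp: simple_graph_def cycle_graph_def)
qed

lemma cycle_free_if_free_of:
  assumes G: "simple_graph G" and k: "3 \<le> k" and free: "free_of (cycle_graph k) G"
  shows "fin_graph.cycle_free (adj G) k"
proof -
  interpret fin_graph "verts G" "adj G" by (rule fin_graph_adj[OF G])
  show ?thesis unfolding cycle_free_def
  proof
    assume "\<exists>xs. length xs = k \<and> distinct xs \<and> successively (adj G) xs \<and> adj G (last xs) (hd xs)"
    then obtain xs where xs: "length xs = k" "distinct xs" "successively (adj G) xs" "adj G (last xs) (hd xs)"
      by blast
    have step: "adj G (xs ! i) (xs ! (Suc i mod k))" if "i < k" for i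
    proof (cases "Suc i = k")
      case True
      then have "xs ! i = last xs" "xs ! (Suc i mod k) = hd xs"
        using xs(1) k last_conv_nth[of xs] hd_conv_nth[of xs] by fastforce+
      then show ?thesis using xs(4) by simp
    next
      case False
      then show ?thesis using that xs(1,3) by (simp add: successively_nth)
    qed
    let ?H = "Graph (set xs) ((`) ((!) xs) ` edges (cycle_graph k))"
    have inj: "inj_on ((!) xs) {..<k}" using xs by (auto simp: inj_on_def nth_eq_iff_index_eq)
    have set: "set xs = (!) xs ` {..<k}" using xs(1) by (auto simp: set_conv_nth)
    have iso: "isomorphic ?H (cycle_graph k)"
      by (rule isomorphicI[where h = "(!) xs"])
         (use inj set simple_cycle_graph[OF k] in \<open>simp_all add: bij_betw_def cycle_graph_def\<close>)
    have sub: "edges ?H \<subseteq> edges G" using step by (auto simp: cycle_graph_def adj_def)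
    have "xs ! i \<in> verts G" if "i < k" for i using E_V[OF step[OF that]] .
    then have "set xs \<subseteq> verts G" using set by auto
    moreover have "simple_graph ?H"
    proof -
      have "e \<subseteq> set xs \<and> card e = 2" if e: "e \<in> edges ?H" for e
      proof -
        obtain a where a: "a \<in> edges (cycle_graph k)" "e = (!) xs ` a" using e by auto
        then have "a \<subseteq> {..<k}" "card a = 2"
          using simple_cycle_graph[OF k] by (auto simp: simple_graph_def cycle_graph_def)
        then show ?thesis using a set inj card_image[of "(!) xs" a] inj_on_subset[OF inj] by auto
      qed
      then show ?thesis by (simp add: simple_graph_def)
    qed
    ultimately have "subgraph ?H G" using sub by (simp add: subgraph_def)
    then show False using free iso by (auto simp: free_of_def)
  qed
qed

lemma free_of_if_cycle_free:
  assumes G: "simple_graph G" and k: "3 \<le> k" and cf: "fin_graph.cycle_free (adj G) k"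
  shows "free_of (cycle_graph k) G"
  unfolding free_of_def
proof
  interpret fin_graph "verts G" "adj G" by (rule fin_graph_adj[OF G])
  assume "\<exists>H. subgraph H G \<and> isomorphic H (cycle_graph k)"
  then obtain H f where H: "subgraph H G" and f: "bij_betw f (verts H) {..<k}"
    "\<forall>u\<in>verts H. \<forall>v\<in>verts H. {u, v} \<in> edges H \<longleftrightarrow> {f u, f v} \<in> edges (cycle_graph k)"
    by (auto simp: isomorphic_def cycle_graph_def)
  let ?g = "inv_into (verts H) f"
  have g: "?g i \<in> verts H" "f (?g i) = i" if "i < k" for i
    using that bij_betw_inv_into_right[OF f(1)] bij_betw_apply[OF bij_betw_inv_into[OF f(1)]] by auto
  have step: "adj G (?g i) (?g (Suc i mod k))" if "i < k" for i
  proof -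
    have "Suc i mod k < k" using k by simp
    then have "{?g i, ?g (Suc i mod k)} \<in> edges H"
      using f(2) g that by (auto simp: cycle_graph_def)
    then show ?thesis using H by (auto simp: subgraph_def adj_def)
  qed
  define xs where "xs = map ?g [0..<k]"
  have "length xs = k" by (simp add: xs_def)
  moreover have "distinct xs"
    unfolding xs_def distinct_map using bij_betw_imp_inj_on[OF bij_betw_inv_into[OF f(1)]]
    by (simp add: lessThan_atLeast0)
  moreover have "successively (adj G) xs"
    unfolding successively_conv_nth
  proof (intro allI impI)
    fix i assume "Suc i < length xs"
    then show "adj G (xs ! i) (xs ! Suc i)" using step[of i] by (simp add: xs_def)
  qed
  moreover have "adj G (last xs) (hd xs)"
  proof -
    have "last xs = ?g (k - 1)" "hd xs = ?g 0" using k by (auto simp: xs_def last_map hd_map)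
    then show ?thesis using step[of "k - 1"] k by simp
  qed
  ultimately show False using cf unfolding cycle_free_def by blast
qed

lemma not_colourable_if_chromatic_number:
  assumes G: "simple_graph G" and r: "0 < r" "r \<le> chromatic_number G"
  shows "\<nexists>c. fin_graph.colouring (adj G) (r - 1) (verts G) c"
proof
  interpret fin_graph "verts G" "adj G" by (rule fin_graph_adj[OF G])
  assume "\<exists>c. colouring (r - 1) (verts G) c"
  then obtain c where c: "colouring (r - 1) (verts G) c" by blast
  have "proper_colouring G (r - 1) c"
    unfolding proper_colouring_def
  proof (intro conjI ballI allI impI)
    show "c v < r - 1" if "v \<in> verts G" for v using c that by (simp add: colouring_def)
    fix u v assume "{u, v} \<in> edges G"
    then have "adj G u v" by (simp add: adj_def)
    then show "c u \<noteq> c v" using c E_V[of u v] E_V'[of u v] by (simp add: colouring_def)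
  qed
  then have "chromatic_number G \<le> r - 1" unfolding chromatic_number_def by (intro Least_le) blast
  then show False using r by simp
qed

lemma chromatic_number_ge_clique:
  assumes G: "simple_graph G" and K: "K \<subseteq> verts G" "\<forall>u\<in>K. \<forall>v\<in>K. u \<noteq> v \<longrightarrow> adj G u v"
  shows "card K \<le> chromatic_number G"
proof -
  have finV: "finite (verts G)" using G by (simp add: simple_graph_def)
  obtain h where h: "bij_betw h (verts G) {0..<card (verts G)}"
    using ex_bij_betw_finite_nat[OF finV] by blast
  have "proper_colouring G (card (verts G)) h"
    unfolding proper_colouring_def
  proof (intro conjI ballI allI impI)
    show "h v < card (verts G)" if "v \<in> verts G" for v using bij_betw_apply[OF h that] by simp
    fix u v assume uv: "{u, v} \<in> edges G"
    then have "u \<in> verts G" "v \<in> verts G" "u \<noteq> v" using G by (auto simp: simple_graph_def)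
    then show "h u \<noteq> h v" using bij_betw_imp_inj_on[OF h] by (auto simp: inj_on_def)
  qed
  then have "\<exists>k c. proper_colouring G k c" by blast
  then have "\<exists>c. proper_colouring G (chromatic_number G) c"
    unfolding chromatic_number_def by (rule LeastI_ex)
  then obtain c where c: "proper_colouring G (chromatic_number G) c" by blast
  have "inj_on c K" using c K(2) unfolding inj_on_def proper_colouring_def adj_def by blast
  moreover have "c ` K \<subseteq> {..<chromatic_number G}" using c K(1) by (auto simp: proper_colouring_def)
  ultimately show ?thesis using card_inj_on_le[of c K "{..<chromatic_number G}"] by simp
qed

section \<open>Suspending a clique on a balanced complete bipartite graph\<close>

definition suspended_graph :: "'a set \<Rightarrow> 'a set \<Rightarrow> 'a set \<Rightarrow> 'a \<Rightarrow> 'a graph" where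
  "suspended_graph X Y Z x = Graph (X \<union> Y \<union> Z) {{u, v} | u v. suspended X Y Z x u v}"

lemma suspended_sym: "suspended X Y Z x u v \<longleftrightarrow> suspended X Y Z x v u"
  by (auto simp: suspended_def bip_def)

lemma adj_suspended_graph: "adj (suspended_graph X Y Z x) u v \<longleftrightarrow> suspended X Y Z x u v"
  using suspended_sym[of X Y Z x u v] by (auto simp: adj_def suspended_graph_def doubleton_eq_iff)

lemma adj_suspended_graph': "adj (suspended_graph X Y Z x) = suspended X Y Z x"
  by (simp add: fun_eq_iff adj_suspended_graph)

lemma verts_suspended_graph: "verts (suspended_graph X Y Z x) = X \<union> Y \<union> Z"
  by (simp add: suspended_graph_def)

lemma suspended_verts: "x \<in> X \<Longrightarrow> suspended X Y Z x u v \<Longrightarrow> u \<in> X \<union> Y \<union> Z \<and> v \<in> X \<union> Y \<union> Z"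
  by (auto simp: suspended_def bip_def)

lemma suspended_irrefl: "X \<inter> Y = {} \<Longrightarrow> \<not> suspended X Y Z x u u"
  by (auto simp: suspended_def bip_def)

lemma simple_suspended_graph:
  assumes "finite (X \<union> Y \<union> Z)" "X \<inter> Y = {}" "x \<in> X"
  shows "simple_graph (suspended_graph X Y Z x)"
  unfolding simple_graph_def
proof (intro conjI ballI)
  show "finite (verts (suspended_graph X Y Z x))" using assms by (simp add: verts_suspended_graph)
  fix e assume "e \<in> edges (suspended_graph X Y Z x)"
  then obtain u v where e: "e = {u, v}" "suspended X Y Z x u v" by (auto simp: suspended_graph_def)
  then have "u \<noteq> v" using suspended_irrefl[OF assms(2)] by metis
  then show "card e = 2" using e by simp
  show "e \<subseteq> verts (suspended_graph X Y Z x)"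
    using suspended_verts[OF assms(3) e(2)] e(1) by (simp add: verts_suspended_graph)
qed

lemma graph_eqI:
  assumes "simple_graph G" "simple_graph H" "verts G = verts H" "\<And>u v. adj G u v \<longleftrightarrow> adj H u v"
  shows "G = H"
proof -
  have "edges G = edges H"
  proof (intro equalityI subsetI)
    fix e assume e: "e \<in> edges G"
    then obtain u v where "e = {u, v}" using assms(1) by (metis simple_edgeE)
    then show "e \<in> edges H" using e assms(4)[of u v] by (simp add: adj_def)
  next
    fix e assume e: "e \<in> edges H"
    then obtain u v where "e = {u, v}" using assms(2) by (metis simple_edgeE)
    then show "e \<in> edges G" using e assms(4)[of u v] by (simp add: adj_def)
  qed
  then show ?thesis using assms(3) by (cases G; cases H) simp
qed

text \<open>The parts of a member of \<open>T_star r n\<close>; which of \<open>X\<close> and \<open>Y\<close> is larger decides on which side of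
  the bipartite graph the clique is attached.\<close>

definition turan_suspension :: "nat \<Rightarrow> nat \<Rightarrow> 'a set \<Rightarrow> 'a set \<Rightarrow> 'a set \<Rightarrow> 'a \<Rightarrow> bool" where
  "turan_suspension r n X Y Z x \<longleftrightarrow> finite X \<and> finite Y \<and> finite Z \<and> X \<inter> Y = {} \<and> X \<inter> Z = {} \<and> Y \<inter> Z = {} \<and>
     x \<in> X \<and> card Z = r - 1 \<and> card X + card Y = n - r + 1 \<and> card X \<le> card Y + 1 \<and> card Y \<le> card X + 1"

lemma bij_betw_fixing:
  assumes "finite A" "finite B" "card A = card B" "a \<in> A" "b \<in> B"
  shows "\<exists>f. bij_betw f A B \<and> f a = b"
proof -
  have "card (A - {a}) = card (B - {b})" using assms by simp
  then obtain f where f: "bij_betw f (A - {a}) (B - {b})"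
    using finite_same_card_bij[of "A - {a}" "B - {b}"] assms by auto
  have "bij_betw (f(a := b)) (A - {a}) (B - {b})"
    using f bij_betw_cong[of "A - {a}" "f(a := b)" f "B - {b}"] by simp
  then have "bij_betw (f(a := b)) ({a} \<union> (A - {a})) ({b} \<union> (B - {b}))"
    by (intro bij_betw_combine) (simp_all add: bij_betw_def)
  moreover have "{a} \<union> (A - {a}) = A" "{b} \<union> (B - {b}) = B" using assms by auto
  ultimately have "bij_betw (f(a := b)) A B" by simp
  then show ?thesis by (intro exI[of _ "f(a := b)"] conjI) simp_all
qed

lemma suspended_graph_iso:
  assumes fin: "finite X" "finite Y" "finite Z" "finite X'" "finite Y'" "finite Z'"
    and disj: "X \<inter> Y = {}" "X \<inter> Z = {}" "Y \<inter> Z = {}" "X' \<inter> Y' = {}" "X' \<inter> Z' = {}" "Y' \<inter> Z' = {}"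
    and c: "card X = card X'" "card Y = card Y'" "card Z = card Z'" and x: "x \<in> X" "x' \<in> X'"
  shows "isomorphic (suspended_graph X Y Z x) (suspended_graph X' Y' Z' x')"
proof -
  obtain fX where fX: "bij_betw fX X X'" "fX x = x'" using bij_betw_fixing[OF fin(1,4) c(1) x] by blast
  obtain fY where fY: "bij_betw fY Y Y'" using finite_same_card_bij[OF fin(2,5) c(2)] by blast
  obtain fZ where fZ: "bij_betw fZ Z Z'" using finite_same_card_bij[OF fin(3,6) c(3)] by blast
  define f where "f v = (if v \<in> X then fX v else if v \<in> Y then fY v else fZ v)" for v
  have f: "bij_betw f X X'" "bij_betw f Y Y'" "bij_betw f Z Z'"
  proof -
    have "bij_betw f X X' \<longleftrightarrow> bij_betw fX X X'" by (rule bij_betw_cong) (simp add: f_def)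
    then show "bij_betw f X X'" using fX(1) by simp
    have "bij_betw f Y Y' \<longleftrightarrow> bij_betw fY Y Y'" using disj by (intro bij_betw_cong) (auto simp: f_def)
    then show "bij_betw f Y Y'" using fY by simp
    have "bij_betw f Z Z' \<longleftrightarrow> bij_betw fZ Z Z'" using disj by (intro bij_betw_cong) (auto simp: f_def)
    then show "bij_betw f Z Z'" using fZ by simp
  qed
  have XY: "bij_betw f (X \<union> Y) (X' \<union> Y')" using f disj by (intro bij_betw_combine) auto
  have bij: "bij_betw f (X \<union> Y \<union> Z) (X' \<union> Y' \<union> Z')" using XY f disj by (intro bij_betw_combine) auto
  have fx: "f x = x'" using fX x by (simp add: f_def)
  have inj: "f u = f v \<longleftrightarrow> u = v" if "u \<in> X \<union> Y \<union> Z" "v \<in> X \<union> Y \<union> Z" for u v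
    using bij_betw_imp_inj_on[OF bij] that by (auto simp: inj_on_def)
  have mX: "f v \<in> X' \<longleftrightarrow> v \<in> X" and mY: "f v \<in> Y' \<longleftrightarrow> v \<in> Y" and mZ: "f v \<in> Z' \<longleftrightarrow> v \<in> Z"
    if "v \<in> X \<union> Y \<union> Z" for v
    using that bij_betw_apply[OF f(1), of v] bij_betw_apply[OF f(2), of v] bij_betw_apply[OF f(3), of v] disj by blast+
  have eqx: "f v = x' \<longleftrightarrow> v = x" if "v \<in> X \<union> Y \<union> Z" for v
    using inj[OF that, of x] x(1) fx by auto
  have "suspended X Y Z x u v \<longleftrightarrow> suspended X' Y' Z' x' (f u) (f v)"
    if "u \<in> X \<union> Y \<union> Z" "v \<in> X \<union> Y \<union> Z" for u v
    unfolding suspended_def bip_def insert_iff mX[OF that(1)] mX[OF that(2)] mY[OF that(1)] mY[OF that(2)]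
      mZ[OF that(1)] mZ[OF that(2)] eqx[OF that(1)] eqx[OF that(2)] inj[OF that] by (rule refl)
  then show ?thesis
    unfolding isomorphic_def adj_def[symmetric] adj_suspended_graph verts_suspended_graph using bij by blast
qed

lemma Collect_pair_disj: "{{u, v} | u v. P u v \<or> Q u v} = {{u, v} | u v. P u v} \<union> {{u, v} | u v. Q u v}"
  by auto

text \<open>The part of the bipartite graph that contains the attachment vertex plays the role of \<open>X\<close>.\<close>

lemma suspend_turan:
  assumes x: "x < m" and y: "y < r" and
    XY: "X = (if x < m div 2 then Inl ` {..<m div 2} else Inl ` {m div 2..<m})"
      "Y = (if x < m div 2 then Inl ` {m div 2..<m} else Inl ` {..<m div 2})"
    and Z: "Z = Inr ` ({..<r} - {y})"
  shows "suspend (complete_graph r) y (turan_bipartite m) x = suspended_graph X Y Z (Inl x :: nat + nat)"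
proof -
  define g where "g v = (if v = y then Inl x else Inr v :: nat + nat)" for v
  have gim: "g ` {..<r} = insert (Inl x) Z"
    using y unfolding Z g_def by auto
  have ginj: "inj g" by (auto simp: inj_def g_def)
  have xX: "Inl x \<in> X" using x XY by auto
  have XYu: "X \<union> Y = Inl ` {..<m}"
  proof -
    have "{..<m div 2} \<union> {m div 2..<m} = {..<m}" by auto
    then have "Inl ` {..<m div 2} \<union> Inl ` {m div 2..<m} = Inl ` {..<m}" by (metis image_Un)
    then show ?thesis unfolding XY by (auto simp: Un_commute)
  qed
  let ?T = "(\<lambda>e. Inl ` e) ` edges (turan_bipartite m) :: (nat + nat) set set"
  have eT: "?T = {{u, v} | u v. bip X Y u v}"
  proof (intro equalityI subsetI)
    fix e assume "e \<in> ?T"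
    then obtain i j where ij: "i < m div 2" "m div 2 \<le> j" "j < m" "e = {Inl i, Inl j}"
      by (auto simp: turan_bipartite_def)
    then have "bip X Y (Inl i) (Inl j)" by (auto simp: bip_def XY)
    then show "e \<in> {{u, v} | u v. bip X Y u v}" using ij(4) by blast
  next
    fix e assume "e \<in> {{u, v} | u v. bip X Y u v}"
    then obtain u v where e: "e = {u, v}" "bip X Y u v" by blast
    then obtain i j where ij: "i < m div 2" "m div 2 \<le> j" "j < m" "e = {Inl i, Inl j}"
      unfolding bip_def XY by (fastforce split: if_splits)
    then have "{i, j} \<in> edges (turan_bipartite m)" "e = Inl ` {i, j}" by (auto simp: turan_bipartite_def)
    then show "e \<in> ?T" by blast
  qed
  have eK: "(\<lambda>e. g ` e) ` edges (complete_graph r)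
      = {{u, v} | u v. u \<noteq> v \<and> u \<in> insert (Inl x) Z \<and> v \<in> insert (Inl x) Z}"
  proof (intro equalityI subsetI)
    fix e assume "e \<in> (\<lambda>e. g ` e) ` edges (complete_graph r)"
    then obtain i j where ij: "i < r" "j < r" "i \<noteq> j" "e = {g i, g j}" by (auto simp: complete_graph_def)
    then have "g i \<noteq> g j" using ginj by (auto simp: inj_def)
    moreover have "g i \<in> insert (Inl x) Z" "g j \<in> insert (Inl x) Z" using ij unfolding gim[symmetric] by auto
    ultimately show "e \<in> {{u, v} | u v. u \<noteq> v \<and> u \<in> insert (Inl x) Z \<and> v \<in> insert (Inl x) Z}" using ij(4) by blast
  next
    fix e assume "e \<in> {{u, v} | u v. u \<noteq> v \<and> u \<in> insert (Inl x) Z \<and> v \<in> insert (Inl x) Z}"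
    then obtain u v where e: "e = {u, v}" "u \<noteq> v" "u \<in> g ` {..<r}" "v \<in> g ` {..<r}" unfolding gim by blast
    then obtain i j where "u = g i" "v = g j" "i < r" "j < r" by blast
    then have "{i, j} \<in> edges (complete_graph r)" "e = g ` {i, j}" using e by (auto simp: complete_graph_def)
    then show "e \<in> (\<lambda>e. g ` e) ` edges (complete_graph r)" by blast
  qed
  have v: "Inl ` verts (turan_bipartite m) \<union> g ` verts (complete_graph r) = X \<union> Y \<union> Z"
  proof -
    have "verts (turan_bipartite m) = {..<m}" "verts (complete_graph r) = {..<r}"
      by (simp_all add: turan_bipartite_def complete_graph_def)
    then have "Inl ` verts (turan_bipartite m) \<union> g ` verts (complete_graph r) = (X \<union> Y) \<union> insert (Inl x) Z"
      using gim XYu by simp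
    moreover have "(X \<union> Y) \<union> insert (Inl x) Z = X \<union> Y \<union> Z" using xX by auto
    ultimately show ?thesis by simp
  qed
  have "{{u, v} | u v. suspended X Y Z (Inl x) u v} = {{u, v} | u v. bip X Y u v} \<union>
      {{u, v} | u v. u \<noteq> v \<and> u \<in> insert (Inl x) Z \<and> v \<in> insert (Inl x) Z}"
    unfolding suspended_def by (rule Collect_pair_disj)
  then show ?thesis
    unfolding suspend_def Let_def suspended_graph_def g_def[symmetric] using v eT eK by simp
qed

lemma suspend_turan_parts:
  assumes "x < m" "y < r"
  obtains X Y Z where "finite X" "finite Y" "finite Z" "X \<inter> Y = {}" "X \<inter> Z = {}" "Y \<inter> Z = {}" "Inl x \<in> X"
    "card X = (if x < m div 2 then m div 2 else m - m div 2)"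
    "card Y = (if x < m div 2 then m - m div 2 else m div 2)" "card Z = r - 1"
    "suspend (complete_graph r) y (turan_bipartite m) x = suspended_graph X Y Z (Inl x :: nat + nat)"
proof (rule that)
  let ?X = "if x < m div 2 then Inl ` {..<m div 2} else Inl ` {m div 2..<m} :: (nat + nat) set"
  let ?Y = "if x < m div 2 then Inl ` {m div 2..<m} else Inl ` {..<m div 2} :: (nat + nat) set"
  let ?Z = "Inr ` ({..<r} - {y}) :: (nat + nat) set"
  show "finite ?X" "finite ?Y" "finite ?Z" "?X \<inter> ?Y = {}" "?X \<inter> ?Z = {}" "?Y \<inter> ?Z = {}" "Inl x \<in> ?X"
    using assms by auto
  show "card ?X = (if x < m div 2 then m div 2 else m - m div 2)"
    "card ?Y = (if x < m div 2 then m - m div 2 else m div 2)" "card ?Z = r - 1"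
    using assms by (simp_all add: card_image)
  show "suspend (complete_graph r) y (turan_bipartite m) x = suspended_graph ?X ?Y ?Z (Inl x)"
    using assms by (intro suspend_turan) auto
qed

lemma suspended_graph_pullback:
  assumes G: "simple_graph G" and f: "bij_betw f (verts G) (X' \<union> Y' \<union> Z')"
    and e: "\<forall>u\<in>verts G. \<forall>v\<in>verts G. {u, v} \<in> edges G \<longleftrightarrow> {f u, f v} \<in> edges (suspended_graph X' Y' Z' x')"
    and x: "x' \<in> X'" and disj: "X' \<inter> Y' = {}"
  shows "\<exists>X Y Z x. bij_betw f X X' \<and> bij_betw f Y Y' \<and> bij_betw f Z Z' \<and> x \<in> X \<and>
    X = {v \<in> verts G. f v \<in> X'} \<and> Y = {v \<in> verts G. f v \<in> Y'} \<and> Z = {v \<in> verts G. f v \<in> Z'} \<and>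
    G = suspended_graph X Y Z x"
proof -
  define pre where "pre A = {v \<in> verts G. f v \<in> A}" for A
  have inj: "inj_on f (verts G)" and im: "f ` verts G = X' \<union> Y' \<union> Z'" using f by (auto simp: bij_betw_def)
  have bij: "bij_betw f (pre A) A" if "A \<subseteq> X' \<union> Y' \<union> Z'" for A
    unfolding bij_betw_def
  proof
    show "inj_on f (pre A)" using inj by (rule inj_on_subset) (auto simp: pre_def)
    have "A \<subseteq> f ` verts G" using that im by simp
    then show "f ` pre A = A" by (auto simp: pre_def)
  qed
  obtain x where x0: "x \<in> verts G" "f x = x'" using im x by (metis UnI1 imageE)
  have eq: "suspended X' Y' Z' x' (f u) (f v) \<longleftrightarrow> suspended (pre X') (pre Y') (pre Z') x u v"
    if "u \<in> verts G" "v \<in> verts G" for u v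
  proof -
    have "f u = x' \<longleftrightarrow> u = x" "f v = x' \<longleftrightarrow> v = x" "f u = f v \<longleftrightarrow> u = v"
      using that x0 inj by (auto simp: inj_on_def)
    then show ?thesis using that by (simp add: suspended_def bip_def pre_def)
  qed
  have xX: "x \<in> pre X'" using x0 x by (simp add: pre_def)
  have un: "pre X' \<union> pre Y' \<union> pre Z' = verts G" using im by (auto simp: pre_def)
  have fin: "finite (verts G)" using G by (simp add: simple_graph_def)
  have dj: "pre X' \<inter> pre Y' = {}" using disj by (auto simp: pre_def)
  interpret fin_graph "verts G" "adj G" by (rule fin_graph_adj[OF G])
  have "G = suspended_graph (pre X') (pre Y') (pre Z') x"
  proof (rule graph_eqI[OF G])
    show "simple_graph (suspended_graph (pre X') (pre Y') (pre Z') x)"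
      using fin dj xX by (intro simple_suspended_graph) (simp_all add: un)
    show "verts G = verts (suspended_graph (pre X') (pre Y') (pre Z') x)" by (simp add: verts_suspended_graph un)
    show "adj G u v \<longleftrightarrow> adj (suspended_graph (pre X') (pre Y') (pre Z') x) u v" for u v
    proof (cases "u \<in> verts G \<and> v \<in> verts G")
      case True
      then have "adj G u v \<longleftrightarrow> suspended X' Y' Z' x' (f u) (f v)"
        using e unfolding adj_def[symmetric] adj_suspended_graph by blast
      then show ?thesis using eq True by (simp add: adj_suspended_graph)
    next
      case False
      then show ?thesis using E_V[of u v] E_V'[of u v] suspended_verts[OF xX, of "pre Y'" "pre Z'" u v]
        unfolding adj_suspended_graph un by blast
    qed
  qed
  then show ?thesis using bij xX unfolding pre_def by blast
qed

text \<open>Membership up to isomorphism becomes the existence of suitable parts of the vertex set itself.\<close>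

lemma T_star_iff:
  assumes "0 < r" "r \<le> n"
  shows "G \<in> T_star r n \<longleftrightarrow> (\<exists>X Y Z x. turan_suspension r n X Y Z x \<and> G = suspended_graph X Y Z x)"
proof
  let ?m = "n - r + 1"
  assume "G \<in> T_star r n"
  then obtain x0 y0 where G: "simple_graph G" and xy: "x0 < ?m" "y0 < r"
    and iso: "isomorphic G (suspend (complete_graph r) y0 (turan_bipartite ?m) x0)"
    by (auto simp: T_star_def turan_bipartite_def complete_graph_def)
  obtain X' Y' Z' where fin: "finite X'" "finite Y'" "finite Z'"
    and disj: "X' \<inter> Y' = {}" "X' \<inter> Z' = {}" "Y' \<inter> Z' = {}" and xX: "Inl x0 \<in> X'"
    and cX: "card X' = (if x0 < ?m div 2 then ?m div 2 else ?m - ?m div 2)"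
      "card Y' = (if x0 < ?m div 2 then ?m - ?m div 2 else ?m div 2)" and cZ: "card Z' = r - 1"
    and eqS: "suspend (complete_graph r) y0 (turan_bipartite ?m) x0 = suspended_graph X' Y' Z' (Inl x0)"
    by (rule suspend_turan_parts[OF xy])
  obtain f where f: "bij_betw f (verts G) (X' \<union> Y' \<union> Z')"
    "\<forall>u\<in>verts G. \<forall>v\<in>verts G. {u, v} \<in> edges G \<longleftrightarrow> {f u, f v} \<in> edges (suspended_graph X' Y' Z' (Inl x0))"
    using iso unfolding eqS isomorphic_def verts_suspended_graph by blast
  obtain X Y Z x where P: "bij_betw f X X'" "bij_betw f Y Y'" "bij_betw f Z Z'" "x \<in> X"
    "X = {v \<in> verts G. f v \<in> X'}" "Y = {v \<in> verts G. f v \<in> Y'}" "Z = {v \<in> verts G. f v \<in> Z'}"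
    "G = suspended_graph X Y Z x"
    using suspended_graph_pullback[OF G f xX disj(1)] by blast
  have c: "card X = card X'" "card Y = card Y'" "card Z = card Z'" using P(1-3) by (auto dest: bij_betw_same_card)
  have "finite (verts G)" using G by (simp add: simple_graph_def)
  then have "finite X" "finite Y" "finite Z" unfolding P(5-7) by auto
  moreover have "X \<inter> Y = {}" "X \<inter> Z = {}" "Y \<inter> Z = {}" unfolding P(5-7) using disj by auto
  moreover have "card X + card Y = ?m" "card X \<le> card Y + 1" "card Y \<le> card X + 1"
    unfolding c cX by (auto split: if_splits)
  ultimately have "turan_suspension r n X Y Z x" using P(4) c cZ by (simp add: turan_suspension_def)
  then show "\<exists>X Y Z x. turan_suspension r n X Y Z x \<and> G = suspended_graph X Y Z x" using P(8) by blast
next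
  let ?m = "n - r + 1"
  assume "\<exists>X Y Z x. turan_suspension r n X Y Z x \<and> G = suspended_graph X Y Z x"
  then obtain X Y Z x where T: "turan_suspension r n X Y Z x" and G: "G = suspended_graph X Y Z x" by blast
  have fin: "finite X" "finite Y" "finite Z" and disj: "X \<inter> Y = {}" "X \<inter> Z = {}" "Y \<inter> Z = {}" and x: "x \<in> X"
    and c: "card Z = r - 1" "card X + card Y = ?m" "card X \<le> card Y + 1" "card Y \<le> card X + 1"
    using T by (auto simp: turan_suspension_def)
  define x0 where "x0 = (if card X \<le> card Y then 0 else ?m div 2)"
  have X0: "0 < card X" using x fin by (auto simp: card_gt_0_iff)
  have x0: "x0 < ?m" by (auto simp: x0_def)
  obtain X' Y' Z' where fin': "finite X'" "finite Y'" "finite Z'"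
    and disj': "X' \<inter> Y' = {}" "X' \<inter> Z' = {}" "Y' \<inter> Z' = {}" and xX: "Inl x0 \<in> X'"
    and cX': "card X' = (if x0 < ?m div 2 then ?m div 2 else ?m - ?m div 2)"
      "card Y' = (if x0 < ?m div 2 then ?m - ?m div 2 else ?m div 2)" and cZ': "card Z' = r - 1"
    and eqS: "suspend (complete_graph r) 0 (turan_bipartite ?m) x0 = suspended_graph X' Y' Z' (Inl x0)"
    by (rule suspend_turan_parts[OF x0 assms(1)])
  have "card X = card X' \<and> card Y = card Y'"
  proof (cases "card X \<le> card Y")
    case True
    then have "card X = ?m div 2" "card Y = ?m - ?m div 2" using c by linarith+
    moreover have "x0 < ?m div 2" using True X0 calculation by (simp add: x0_def)
    ultimately show ?thesis unfolding cX' by simp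
  next
    case False
    then have "card Y = ?m div 2" "card X = ?m - ?m div 2" using c by linarith+
    moreover have "\<not> x0 < ?m div 2" using False by (simp add: x0_def)
    ultimately show ?thesis unfolding cX' by simp
  qed
  moreover have "card Z = card Z'" using c(1) cZ' by simp
  ultimately have "isomorphic G (suspended_graph X' Y' Z' (Inl x0))"
    unfolding G using fin fin' disj disj' x xX by (intro suspended_graph_iso) auto
  then have "isomorphic G (suspend (complete_graph r) 0 (turan_bipartite ?m) x0)" unfolding eqS .
  moreover have "simple_graph G" unfolding G using fin disj x by (intro simple_suspended_graph) auto
  ultimately show "G \<in> T_star r n"
    unfolding T_star_def using x0 assms(1) by (auto simp: turan_bipartite_def complete_graph_def)
qed

section \<open>The extremal graphs\<close>

lemma bip_cycle_free:
  assumes "X \<inter> Y = {}" "odd (length xs)" "successively (bip X Y) xs" "bip X Y (last xs) (hd xs)"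
  shows False
proof -
  have ne: "xs \<noteq> []" using assms(2) by auto
  have alt: "xs ! i \<in> X \<longleftrightarrow> (even i \<longleftrightarrow> xs ! 0 \<in> X)" if "i < length xs" for i
    using that
  proof (induction i)
    case (Suc i)
    then have "bip X Y (xs ! i) (xs ! Suc i)" using assms(3) by (simp add: successively_nth)
    then have "xs ! Suc i \<in> X \<longleftrightarrow> xs ! i \<notin> X" using assms(1) by (auto simp: bip_def)
    then show ?case using Suc by auto
  qed simp
  have "xs ! (length xs - 1) \<in> X \<longleftrightarrow> xs ! 0 \<in> X" using alt[of "length xs - 1"] assms(2) ne by auto
  then show False using assms(1,4) ne by (auto simp: bip_def last_conv_nth hd_conv_nth)
qed

text \<open>Rotate the cycle so that it starts at \<open>x\<close> if it contains \<open>x\<close>. The remaining vertices lie all in the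
  clique, which is too small, or all in the bipartite part, which has no odd cycle.\<close>

lemma suspended_cycle_free:
  assumes disj: "X \<inter> Y = {}" "X \<inter> Z = {}" "Y \<inter> Z = {}" and x: "x \<in> X" and Z: "finite Z" "card Z + 1 < k" and k: "odd k"
    and xs: "length xs = k" "distinct xs" "successively (suspended X Y Z x) xs" "suspended X Y Z x (last xs) (hd xs)"
    "set xs \<subseteq> X \<union> Y \<union> Z"
  shows False
proof -
  obtain ys where ys: "length ys = k" "distinct ys" "successively (suspended X Y Z x) ys"
    "suspended X Y Z x (last ys) (hd ys)" "set ys \<subseteq> X \<union> Y \<union> Z" "x \<in> set ys \<longrightarrow> hd ys = x"
  proof (cases "x \<in> set xs")
    case True
    then obtain as bs where s: "xs = as @ x # bs" by (auto simp: in_set_conv_decomp)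
    let ?ys = "(x # bs) @ as"
    have "successively (suspended X Y Z x) ?ys"
      using xs(3,4) unfolding s successively_append_iff by (cases as) auto
    moreover have "suspended X Y Z x (last ?ys) (hd ?ys)"
      using xs(3,4) unfolding s successively_append_iff by (cases as rule: rev_cases) auto
    ultimately show ?thesis using xs s by (intro that[of ?ys]) auto
  next
    case False
    then show ?thesis using xs by (intro that[of xs]) auto
  qed
  have ne: "ys \<noteq> []" using ys(1) Z by auto
  define zs where "zs = (if x \<in> set ys then tl ys else ys)"
  have xz: "x \<notin> set zs" using ys(2,6) ne by (cases ys) (auto simp: zs_def)
  have "successively (suspended X Y Z x) zs"
    using ys(3) by (cases ys) (auto simp: zs_def successively_Cons)
  moreover have "set zs \<subseteq> X \<union> Y \<union> Z" using ys(5) by (cases ys) (auto simp: zs_def)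
  ultimately have "set zs \<subseteq> Z \<or> set zs \<subseteq> X \<union> Y"
    using disj xz by (intro suspended_avoiding[of X Z Y x]) auto
  moreover have "set ys \<subseteq> insert x (set zs)" using ys(6) by (cases ys) (auto simp: zs_def)
  ultimately consider "set ys \<subseteq> insert x Z" | "set ys \<subseteq> X \<union> Y" using x by blast
  then show False
  proof cases
    case 1
    then have "card (set ys) \<le> card (insert x Z)" using Z by (intro card_mono) auto
    also have "\<dots> \<le> card Z + 1" using Z by (simp add: card_insert_if)
    finally show False using Z ys(1,2) by (simp add: distinct_card)
  next
    case 2
    have b: "bip X Y u v" if "u \<in> set ys" "v \<in> set ys" "suspended X Y Z x u v" for u v
      using that 2 disj by (auto simp: suspended_def)
    have "successively (bip X Y) ys" by (rule successively_mono[OF ys(3)]) (use b in blast)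
    moreover have "bip X Y (last ys) (hd ys)" using b[OF _ _ ys(4)] ne by simp
    ultimately show False using bip_cycle_free[OF disj(1), of ys] k ys(1) by simp
  qed
qed

lemma T_star_admissible:
  assumes r: "0 < r" "r \<le> n" and l: "r \<le> 2 * l" "1 \<le> l" and G: "G \<in> T_star r n"
  shows "G \<in> admissible l r n"
proof -
  obtain X Y Z x where T: "turan_suspension r n X Y Z x" and G: "G = suspended_graph X Y Z x"
    using G T_star_iff[OF r] by blast
  have fXYZ: "finite X" "finite Y" "finite Z" and disj: "X \<inter> Y = {}" "X \<inter> Z = {}" "Y \<inter> Z = {}" and x: "x \<in> X"
    and c: "card Z = r - 1" "card X + card Y = n - r + 1"
    using T by (auto simp: turan_suspension_def)
  have S: "simple_graph G" unfolding G using fXYZ disj x by (intro simple_suspended_graph) auto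
  interpret fin_graph "verts G" "adj G" by (rule fin_graph_adj[OF S])
  have "card (verts G) = card (X \<union> Y) + card Z"
    unfolding G verts_suspended_graph using fXYZ disj by (intro card_Un_disjoint) auto
  also have "card (X \<union> Y) = card X + card Y" using fXYZ disj by (intro card_Un_disjoint) auto
  finally have n: "card (verts G) = n" using c r by simp
  have "cycle_free (2 * l + 1)"
    unfolding cycle_free_def
  proof
    assume "\<exists>xs. length xs = 2 * l + 1 \<and> distinct xs \<and> successively (adj G) xs \<and> adj G (last xs) (hd xs)"
    then obtain xs where xs: "length xs = 2 * l + 1" "distinct xs" "successively (adj G) xs" "adj G (last xs) (hd xs)"
      by blast
    have "set xs \<subseteq> X \<union> Y \<union> Z"
    proof
      fix v assume "v \<in> set xs"
      then obtain i where i: "i < length xs" "v = xs ! i" by (auto simp: in_set_conv_nth)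
      show "v \<in> X \<union> Y \<union> Z"
      proof (cases "Suc i < length xs")
        case True
        then have "adj G v (xs ! Suc i)" using xs(3) i by (simp add: successively_nth)
        then show ?thesis using E_V unfolding G verts_suspended_graph by blast
      next
        case False
        then have "i = length xs - 1" "xs \<noteq> []" using i by auto
        then have "v = last xs" using i by (simp add: last_conv_nth)
        then show ?thesis using xs(4) E_V unfolding G verts_suspended_graph by blast
      qed
    qed
    moreover have "card Z + 1 < 2 * l + 1" using c l r by simp
    ultimately show False
      using suspended_cycle_free[OF disj x fXYZ(3) _ _ xs(1,2) xs(3,4)[unfolded G adj_suspended_graph']] by simp
  qed
  then have "free_of (cycle_graph (2 * l + 1)) G"
    using S l by (intro free_of_if_cycle_free) auto
  moreover have "r \<le> chromatic_number G"
  proof -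
    have "card (insert x Z) \<le> chromatic_number G"
      using x by (intro chromatic_number_ge_clique[OF S])
        (auto simp: G adj_suspended_graph suspended_def verts_suspended_graph)
    moreover have "card (insert x Z) = r" using x disj fXYZ c r by (subst card_insert_disjoint) auto
    ultimately show ?thesis by simp
  qed
  ultimately show ?thesis using S n by (simp add: admissible_def)
qed

lemma turan_count_le_T_star:
  assumes r: "0 < r" "r \<le> n" and t: "0 < t" and G: "G \<in> T_star r n"
  shows "turan_count t (n - r + 1) \<le> path_count t G"
proof -
  obtain X Y Z x where T: "turan_suspension r n X Y Z x" and G: "G = suspended_graph X Y Z x"
    using G T_star_iff[OF r] by blast
  have fin: "finite X" "finite Y" "finite Z" and disj: "X \<inter> Y = {}"
    and c: "card X + card Y = n - r + 1" "card X \<le> card Y + 1" "card Y \<le> card X + 1"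
    using T by (auto simp: turan_suspension_def)
  have "card X = (n - r + 1) div 2 \<and> card Y = n - r + 1 - (n - r + 1) div 2 \<or>
      card Y = (n - r + 1) div 2 \<and> card X = n - r + 1 - (n - r + 1) div 2" using c by linarith
  then have "turan_count t (n - r + 1) = bip_count t (card X) (card Y)"
    unfolding turan_count_def by (metis bip_count_commute)
  also have "\<dots> = card (paths (X \<union> Y) (bip X Y) t)" using fin disj t by (simp add: card_paths_bip)
  also have "\<dots> \<le> path_count t G"
    unfolding G adj_suspended_graph' verts_suspended_graph using fin
    by (intro card_mono finite_paths paths_mono) (auto simp: suspended_def)
  finally show ?thesis .
qed

lemma T_star_nonempty:
  assumes "3 \<le> r" "r + 2 \<le> n"
  shows "T_star r n \<noteq> {}"
proof -
  define a where "a = (n - r + 1) div 2"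
  define m where "m = n - r + 1"
  have "turan_suspension r n {..<a} {a..<m} {m..<n} 0"
    unfolding turan_suspension_def a_def m_def using assms by auto
  then show ?thesis using T_star_iff[of r n] assms by fastforce
qed

text \<open>An edge missing in \<open>G\<close> joins \<open>X\<close> to \<open>Y\<close>, and some path of the complete bipartite graph uses it.\<close>

lemma suspended_strict_subgraph:
  assumes G: "simple_graph G" and V: "verts G = X \<union> Y \<union> Z" and fXY: "finite X" "finite Y"
    and disj: "X \<inter> Y = {}" and x: "x \<in> X"
    and sub: "\<And>u v. adj G u v \<Longrightarrow> suspended X Y Z x u v"
    and clique: "\<And>u v. u \<in> insert x Z \<Longrightarrow> v \<in> insert x Z \<Longrightarrow> u \<noteq> v \<Longrightarrow> adj G u v"
    and large: "t \<le> card X" "t \<le> card Y" "2 \<le> t" and ne: "G \<noteq> suspended_graph X Y Z x"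
  shows "path_count t G < card (paths (X \<union> Y \<union> Z) (suspended X Y Z x) t)"
proof -
  interpret fin_graph "verts G" "adj G" by (rule fin_graph_adj[OF G])
  have finV: "finite (X \<union> Y \<union> Z)" using fin_graph.fin[OF fin_graph_adj[OF G]] V by simp
  have "\<exists>u v. suspended X Y Z x u v \<and> \<not> adj G u v"
  proof (rule ccontr)
    assume "\<not> ?thesis"
    then have "adj G u v \<longleftrightarrow> adj (suspended_graph X Y Z x) u v" for u v
      unfolding adj_suspended_graph using sub by blast
    then have "G = suspended_graph X Y Z x"
      using G simple_suspended_graph[OF finV disj x] V by (intro graph_eqI) (auto simp: verts_suspended_graph)
    then show False using ne by blast
  qed
  then obtain u v where uv: "u \<in> X" "v \<in> Y" "\<not> adj G u v"
    using clique E_sym unfolding suspended_def bip_def by metis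
  obtain k where k: "t = Suc (Suc k)" using large(3) by (metis add_2_eq_Suc le_Suc_ex)
  have "0 < min (card X - 1) (card Y - 1) - k" using large k by (auto simp: min_def)
  then have "0 < (min (card X - 1) (card Y - 1) - k) ^ k" by simp
  also have "\<dots> \<le> alt_count k (card X - 1) (card Y - 1)" by (rule alt_count_lower)
  also have "\<dots> \<le> card {xs \<in> paths (X \<union> Y) (bip X Y) t. hd xs = u \<and> xs ! 1 \<in> {v}}"
    unfolding k using card_paths_bip_first_edge[OF fXY disj uv(1), of "{v}" k] uv(2) by simp
  finally have "{xs \<in> paths (X \<union> Y) (bip X Y) t. hd xs = u \<and> xs ! 1 \<in> {v}} \<noteq> {}"
    unfolding card_gt_0_iff by (rule conjunct1)
  then obtain xs where xs: "xs \<in> paths (X \<union> Y) (bip X Y) t" "hd xs = u" "xs ! 1 = v" by blast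
  have "xs \<in> paths (X \<union> Y \<union> Z) (suspended X Y Z x) t"
    using xs(1) paths_mono[of "X \<union> Y" "X \<union> Y \<union> Z" "bip X Y" "suspended X Y Z x" t] by (auto simp: suspended_def)
  moreover have "xs \<notin> paths (verts G) (adj G) t"
  proof
    assume "xs \<in> paths (verts G) (adj G) t"
    then have "adj G (xs ! 0) (xs ! Suc 0)" "xs \<noteq> []"
      using large(3) successively_nth[of "adj G" xs 0] by (auto simp: paths_def)
    then show False using xs uv(3) by (simp add: hd_conv_nth)
  qed
  moreover have "paths (verts G) (adj G) t \<subseteq> paths (X \<union> Y \<union> Z) (suspended X Y Z x) t"
    using sub V by (intro paths_mono) auto
  ultimately show ?thesis using finite_paths[OF finV] by (intro psubset_card_mono) auto
qed

text \<open>Either some member of \<open>T_star\<close> has more paths than \<open>G\<close>, or \<open>G\<close> has enough paths for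
  \<open>near_extremal_structure\<close>. In the second case missing edges are added and the parts are balanced.\<close>

lemma admissible_le_T_star:
  fixes l t r :: nat
  assumes l: "2 \<le> l" and t: "4 \<le> t" and r: "3 \<le> r"
  shows "\<exists>n0. \<forall>n\<ge>n0. \<forall>G\<in>admissible l r n. \<exists>G'\<in>T_star r n.
    path_count t G \<le> path_count t G' \<and>
    (G \<notin> T_star r n \<longrightarrow> path_count t G < path_count t G')"
proof -
  \<comment> \<open>The value of \<open>\<kappa>\<close> is small enough for the two counting estimates; \<open>\<epsilon>\<close> and \<open>\<gamma>\<close> are the
    corresponding parameters for finding a kernel with defect \<open>\<kappa>\<close>.\<close>
  define \<kappa> :: real where "\<kappa> = 1 / (32 * real r * real t * 8 ^ t)"
  define \<epsilon> where "\<epsilon> = \<kappa> / 10"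
  define \<gamma> where "\<gamma> = \<epsilon> ^ 3 / 2"
  have den: "32 \<le> 32 * real r * real t * 8 ^ t"
  proof -
    have "1 * 1 \<le> real r * real t" using r t by (intro mult_mono) auto
    then have "1 * 1 \<le> real r * real t * 8 ^ t" by (intro mult_mono) auto
    then show ?thesis by simp
  qed
  have \<kappa>: "0 < \<kappa>" "\<kappa> \<le> 1 / 32" unfolding \<kappa>_def using den by (auto simp: field_simps)
  have \<kappa>2: "10 * real r * real t * \<kappa> * 8 ^ (t - 1) < 1"
  proof -
    define P where "P = real r * real t * 8 ^ (t - 1)"
    have "t = Suc (t - 1)" using t by simp
    then have "(8 :: real) ^ t = 8 * 8 ^ (t - 1)" by (metis power_Suc)
    then have "\<kappa> = 1 / (256 * P)" by (simp add: \<kappa>_def P_def)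
    moreover have "0 < P" using r t by (simp add: P_def)
    ultimately have "10 * P * \<kappa> < 1" by (simp add: field_simps)
    then show ?thesis by (simp add: P_def ac_simps)
  qed
  have \<epsilon>: "0 < \<epsilon>" "\<epsilon> \<le> 1 / 10" "10 * \<epsilon> = \<kappa>" unfolding \<epsilon>_def using \<kappa> by auto
  have \<gamma>: "0 < \<gamma>" "\<gamma> \<le> 1 / 2"
    unfolding \<gamma>_def using \<epsilon> power_le_one[of \<epsilon> 3] by auto
  define n0 where "n0 = nat \<lceil>(4 * real l + real (r + t) * real t + 1) / \<gamma>\<rceil> + nat \<lceil>(2 * real l + 10) / \<kappa>\<rceil>
    + 16 * (t + 1) + 2 * (r + t) + 8 ^ (t - 2) * (r - 1) * t ^ 3 + 1"
  have "\<exists>G'\<in>T_star r n. path_count t G \<le> path_count t G' \<and>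
    (G \<notin> T_star r n \<longrightarrow> path_count t G < path_count t G')"
    if n: "n0 \<le> n" and adm: "G \<in> admissible l r n" for n G
  proof -
    let ?p = "path_count t :: nat graph \<Rightarrow> nat"
    have n_gamma: "4 * real l + real (r + t) * real t + 1 \<le> \<gamma> * real n"
    proof -
      have "(4 * real l + real (r + t) * real t + 1) / \<gamma> \<le> real (nat \<lceil>(4 * real l + real (r + t) * real t + 1) / \<gamma>\<rceil>)"
        by (rule real_nat_ceiling_ge)
      also have "\<dots> \<le> real n" using n unfolding n0_def by (intro of_nat_mono) linarith
      finally show ?thesis using \<gamma>(1) by (simp add: field_simps)
    qed
    have n_kappa: "2 * real l + 10 \<le> \<kappa> * real n"
    proof -
      have "(2 * real l + 10) / \<kappa> \<le> real (nat \<lceil>(2 * real l + 10) / \<kappa>\<rceil>)" by (rule real_nat_ceiling_ge)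
      also have "\<dots> \<le> real n" using n unfolding n0_def by (intro of_nat_mono) linarith
      finally show ?thesis using \<kappa>(1) by (simp add: field_simps)
    qed
    have n_nat: "16 * (t + 1) \<le> n" "2 * (r + t) \<le> n" "8 ^ (t - 2) * (r - 1) * t ^ 3 < n"
      using n unfolding n0_def by linarith+
    have rn: "0 < r" "r \<le> n" "r + 2 \<le> n" using r t n_nat by auto
    have G: "simple_graph G" "card (verts G) = n" "free_of (cycle_graph (2 * l + 1)) G" "r \<le> chromatic_number G"
      using adm by (auto simp: admissible_def)
    obtain G0 where G0: "G0 \<in> T_star r n" using T_star_nonempty[OF r rn(3)] by blast
    show ?thesis
    proof (cases "?p G < ?p G0")
      case True
      then show ?thesis using G0 by (intro bexI[of _ G0]) auto
    next
      case False
      then have p: "turan_count t (card (verts G) - r + 1) \<le> ?p G"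
        using turan_count_le_T_star[OF rn(1,2) _ G0, of t] t G(2) by simp
      interpret fin_graph "verts G" "adj G" by (rule fin_graph_adj[OF G(1)])
      have cf: "cycle_free (2 * l + 1)" using G(1,3) l by (intro cycle_free_if_free_of) auto
      have gl: "4 * real l \<le> \<gamma> * real (card (verts G))" "real (r + t) * real t < \<gamma> * real (card (verts G))"
      proof -
        have "0 \<le> real (r + t) * real t" "0 \<le> real l" by auto
        then show "4 * real l \<le> \<gamma> * real (card (verts G))" "real (r + t) * real t < \<gamma> * real (card (verts G))"
          using n_gamma unfolding G(2) by linarith+
      qed
      have "(1 / 2 - 2 * \<gamma>) * real (card (verts G)) ^ 2 \<le> real degsum"
        by (rule degsum_large[OF cf _ \<gamma> _ gl _ p]) (use l t n_nat G(2) in auto)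
      then have D: "(1 / 2 - \<epsilon> ^ 3) * real (card (verts G)) ^ 2 \<le> real degsum" by (simp add: \<gamma>_def)
      have "8 * real l \<le> \<epsilon> ^ 3 * real (card (verts G))" using gl(1) by (simp add: \<gamma>_def)
      then obtain A B where K: "kernel \<kappa> A B"
        using kernel_exists[OF cf _ \<epsilon>(1,2) _ D] l unfolding \<epsilon>(3) by auto
      interpret kernel_graph "verts G" "adj G" l \<kappa> A B
        using l cf K \<kappa>(2) n_kappa G(2) by unfold_locales auto
      have nc: "\<nexists>c. colouring (r - 1) (verts G) c"
        using G(1,4) rn(1) by (intro not_colourable_if_chromatic_number)
      have "2 \<le> t" "16 * (t + 1) \<le> card (verts G)" using t n_nat G(2) by auto
      from near_extremal_structure[OF this(1) r \<kappa>2 this(2) p nc]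
      obtain X Y Z x where S: "X \<inter> Y = {}" "X \<inter> Z = {}" "Y \<inter> Z = {}" "X \<union> Y \<union> Z = verts G" "card Z = r - 1" "x \<in> X"
        "card (verts G) \<le> 4 * card X" "card (verts G) \<le> 4 * card Y"
        and sub: "\<forall>u v. adj G u v \<longrightarrow> suspended X Y Z x u v"
        and clique: "\<forall>u v. u \<in> insert x Z \<longrightarrow> v \<in> insert x Z \<longrightarrow> u \<noteq> v \<longrightarrow> adj G u v"
        by (elim exE conjE) (rule that)
      have finXYZ: "finite X" "finite Y" "finite Z" using S(4) fin by (metis finite_Un)+
      let ?Q = "suspended_graph X Y Z x"
      have pQ: "?p ?Q = card (paths (X \<union> Y \<union> Z) (suspended X Y Z x) t)"
        by (simp add: adj_suspended_graph' verts_suspended_graph)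
      have GQ: "?p G < ?p ?Q" if "G \<noteq> ?Q"
      proof -
        have "t \<le> card X" "t \<le> card Y" using S(7,8) n_nat(1) G(2) by simp_all
        then show ?thesis
          unfolding pQ using G(1) S finXYZ sub clique that t by (intro suspended_strict_subgraph) auto
      qed
      have cXY: "card X + card Y = n - r + 1"
      proof -
        have "card (X \<union> Y \<union> Z) = card (X \<union> Y) + card Z" using finXYZ S by (intro card_Un_disjoint) auto
        moreover have "card (X \<union> Y) = card X + card Y" using finXYZ S by (intro card_Un_disjoint) auto
        ultimately show ?thesis using S(4,5) G(2) rn by simp
      qed
      show ?thesis
      proof (cases "card X + 2 \<le> card Y \<or> card Y + 2 \<le> card X")
        case False
        then have "turan_suspension r n X Y Z x"
          using finXYZ S cXY by (auto simp: turan_suspension_def)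
        then have "?Q \<in> T_star r n" using T_star_iff[OF rn(1,2)] by blast
        then show ?thesis using GQ by (cases "G = ?Q") (auto intro!: bexI[of _ ?Q])
      next
        case True
        have cV: "card (X \<union> Y \<union> Z) = n" using S(4) G(2) by simp
        have "\<exists>X' Y'. X' \<inter> Y' = {} \<and> X' \<union> Y' = X \<union> Y \<and> x \<in> X' \<and> card X' \<le> card Y' + 1 \<and> card Y' \<le> card X' + 1 \<and>
          card (paths (X \<union> Y \<union> Z) (suspended X Y Z x) t) < card (paths (X \<union> Y \<union> Z) (suspended X' Y' Z x) t)"
          by (rule suspended_balance[OF t _ _ finXYZ S(1-3) _ _ S(6) True])
             (use cV n_nat S G(2) in auto)
        then obtain X' Y' where X': "X' \<inter> Y' = {}" "X' \<union> Y' = X \<union> Y" "x \<in> X'" "card X' \<le> card Y' + 1"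
          "card Y' \<le> card X' + 1"
          "card (paths (X \<union> Y \<union> Z) (suspended X Y Z x) t) < card (paths (X \<union> Y \<union> Z) (suspended X' Y' Z x) t)"
          by blast
        have fin': "finite X'" "finite Y'" using X'(2) finXYZ by (metis finite_Un)+
        have "card X' + card Y' = card (X' \<union> Y')" using fin' X'(1) by (intro card_Un_disjoint[symmetric])
        also have "\<dots> = n - r + 1" unfolding X'(2) using cXY finXYZ S(1) by (simp add: card_Un_disjoint)
        finally have c': "card X' + card Y' = n - r + 1" .
        have d': "X' \<inter> Z = {}" "Y' \<inter> Z = {}" using X'(2) S(2,3) by blast+
        have "turan_suspension r n X' Y' Z x"
          unfolding turan_suspension_def using fin' finXYZ(3) X' d' c' S(5) by blast
        then have T': "suspended_graph X' Y' Z x \<in> T_star r n" using T_star_iff[OF rn(1,2)] by blast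
        have pQ': "?p (suspended_graph X' Y' Z x) = card (paths (X \<union> Y \<union> Z) (suspended X' Y' Z x) t)"
          by (simp add: adj_suspended_graph' verts_suspended_graph X'(2))
        have "?p G < ?p (suspended_graph X' Y' Z x)"
          using GQ X'(6) unfolding pQ' pQ[symmetric] by (cases "G = ?Q") auto
        then show ?thesis using T' by (intro bexI[of _ "suspended_graph X' Y' Z x"]) auto
      qed
    qed
  qed
  then show ?thesis by blast
qed

theorem corollary1p4:
  fixes l t r :: nat
  assumes "l \<ge> 2" and "t \<ge> 4" and "3 \<le> r" and "r \<le> 2 * l - 1"
  shows "\<exists>n0. \<forall>n\<ge>n0.
    (\<forall>S\<in>S_family t r n.
       Max {num_copies (path_graph t) G | G. G \<in> admissible l r n} = num_copies (path_graph t) S) \<and>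
    {G \<in> admissible l r n.
       num_copies (path_graph t) G =
         Max {num_copies (path_graph t) G' | G'. G' \<in> admissible l r n}} = S_family t r n"
proof -
  obtain n0 where n0: "\<forall>n\<ge>n0. \<forall>G\<in>admissible l r n. \<exists>G'\<in>T_star r n.
    path_count t G \<le> path_count t G' \<and>
    (G \<notin> T_star r n \<longrightarrow> path_count t G < path_count t G')"
    using admissible_le_T_star[OF assms(1-3)] by blast
  have "(\<forall>S\<in>S_family t r n.
       Max {num_copies (path_graph t) G | G. G \<in> admissible l r n} = num_copies (path_graph t) S) \<and>
    {G \<in> admissible l r n.
       num_copies (path_graph t) G =
         Max {num_copies (path_graph t) G' | G'. G' \<in> admissible l r n}} = S_family t r n"
    if n: "max n0 (r + 2) \<le> n" for n
  proof -
    let ?N = "\<lambda>G :: nat graph. num_copies (path_graph t) G" and ?c = "card (path_orders t)"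
    let ?A = "admissible l r n" and ?T = "T_star r n"
    have TA: "?T \<subseteq> ?A"
    proof
      fix G assume "G \<in> ?T"
      then show "G \<in> ?A" using assms n by (intro T_star_admissible) auto
    qed
    have pN: "path_count t G = ?N G * ?c" if "G \<in> ?A" for G
      using that by (intro card_paths_eq_copies) (simp add: admissible_def)
    have up: "\<exists>G'\<in>?T. ?N G \<le> ?N G' \<and> (G \<notin> ?T \<longrightarrow> ?N G < ?N G')" if G: "G \<in> ?A" for G
    proof -
      obtain G' where G': "G' \<in> ?T" "?N G * ?c \<le> ?N G' * ?c" "G \<notin> ?T \<longrightarrow> ?N G * ?c < ?N G' * ?c"
        using n0 n G pN TA by (metis max.boundedE subsetD)
      then show ?thesis using path_orders_pos[of t] by (intro bexI[of _ G']) auto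
    qed
    have bound: "?N G \<le> n ^ t" if G: "G \<in> ?A" for G
    proof -
      have "?N G \<le> ?N G * ?c" using path_orders_pos[of t] by simp
      also have "\<dots> = path_count t G" by (simp add: pN[OF G])
      also have "\<dots> \<le> card (verts G) ^ t"
        using G by (intro card_paths_le) (simp add: admissible_def simple_graph_def)
      finally show ?thesis using G by (simp add: admissible_def)
    qed
    let ?M = "{?N G | G. G \<in> ?A}"
    have finM: "finite ?M" by (rule finite_subset[of _ "{..n ^ t}"]) (use bound in auto)
    have T0: "?T \<noteq> {}" using T_star_nonempty[OF assms(3)] n by simp
    then have neM: "?M \<noteq> {}" using TA by blast
    obtain G1 where G1: "G1 \<in> ?A" "Max ?M = ?N G1" using Max_in[OF finM neM] by auto
    have le: "?N G \<le> Max ?M" if "G \<in> ?A" for G using that by (intro Max_ge[OF finM]) blast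
    obtain S0 where S0: "S0 \<in> ?T" "?N S0 = Max ?M"
      using up[OF G1(1)] G1(2) le TA by (metis le_antisym subsetD)
    have S: "S \<in> S_family t r n \<longleftrightarrow> S \<in> ?T \<and> ?N S = Max ?M" for S
    proof
      assume "S \<in> S_family t r n"
      then have "S \<in> ?T" "?N S0 \<le> ?N S" using S0(1) by (auto simp: S_family_def)
      then show "S \<in> ?T \<and> ?N S = Max ?M" using le[of S] TA S0(2) by auto
    next
      assume S: "S \<in> ?T \<and> ?N S = Max ?M"
      have "?N G' \<le> ?N S" if "G' \<in> ?T" for G' using that S le[of G'] TA by auto
      then show "S \<in> S_family t r n" using S by (simp add: S_family_def)
    qed
    have "G \<in> ?T" if G: "G \<in> ?A" "?N G = Max ?M" for G
    proof (rule ccontr)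
      assume "G \<notin> ?T"
      then obtain G' where "G' \<in> ?T" "?N G < ?N G'" using up[OF G(1)] by blast
      then show False using le[of G'] TA G(2) by auto
    qed
    then show ?thesis using S TA by auto
  qed
  then show ?thesis by blast
qed

end
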